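(* Let $\mathfrak{g}=(\mathfrak{a}\oplus\mathfrak{r})\ltimes\mathfrak{n}$ be a real finite-dimensional Lie algebra, where $\mathfrak{r}$ is a semisimple subalgebra with no compact factors, $\mathfrak{n}$ is a nilpotent ideal, $\mathfrak{a}$ is a subspace and $[\mathfrak{a},\mathfrak{a}\oplus\mathfrak{r}]=0$. Assume in addition that: (1) $\mathfrak{n}$ admits an inner product such that $\operatorname{ad}A|_{\mathfrak{n}}$ is a normal operator for every $A\in\mathfrak{a}$; (2) for no nonzero $A\in\mathfrak{a}$ does $\operatorname{ad}A|_{\mathfrak{n}}$ have all its eigenvalues purely imaginary; (3) there exists an element $A_0\in\mathfrak{a}$ such that all the eigenvalues of $\operatorname{ad}A_0|_{\mathfrak{n}}$ have positive real part; (4) $\mathfrak{r}$ admits an inner product with negative Ricci curvature for which some Cartan decomposition $\mathfrak{r}=\mathfrak{k}\oplus\mathfrak{p}$ is orthogonal. Then $\mathfrak{g}$ admits an inner product with negative Ricci curvature.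
   Context: "Purely imaginary" means having zero real part ($0$ included). "No compact factors" means that no simple ideal of $\mathfrak{r}$ is a compact Lie algebra. Ricci curvature: an inner product $\langle\cdot,\cdot\rangle$ on a real finite-dimensional Lie algebra $\mathfrak{g}$ has negative Ricci curvature if the Ricci operator of the corresponding left-invariant Riemannian metric on a Lie group with Lie algebra $\mathfrak{g}$ is negative definite. Explicitly, the Ricci operator is $\operatorname{Ric}=M-\tfrac12 B-S(\operatorname{ad}H)$, where $H\in\mathfrak{g}$ is defined by $\langle H,X\rangle=\operatorname{tr}\operatorname{ad}X$ for all $X$, $S(A)=\tfrac12(A+A^t)$, $B$ is the symmetric operator with $\langle BX,X\rangle=\operatorname{tr}(\operatorname{ad}X)^2$, and $M$ is the symmetric operator with $\langle MX,X\rangle=-\tfrac12\sum_{i,j}\langle[X,X_i],X_j\rangle^2+\tfrac14\sum_{i,j}\langle[X_i,X_j],X\rangle^2$ for any orthonormal basis $\{X_i\}$ of $\mathfrak{g}$. *)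

theory Defs
  imports "HOL-Analysis.Analysis"
begin

text \<open>
  Lie algebras, and the vector spaces they act on, are finite-dimensional subspaces of an arbitrary
  real vector space, so that a subalgebra is a Lie algebra with the same bracket. Brackets, inner
  products and operators are total functions of which only the values on the carrier matter.
\<close>

section \<open>Linear algebra on a subspace\<close>

definition endomorphism_on :: "'a::real_vector set \<Rightarrow> ('a \<Rightarrow> 'a) \<Rightarrow> bool" where
  "endomorphism_on V f \<longleftrightarrow>
     (\<forall>x\<in>V. f x \<in> V) \<and>
     (\<forall>x\<in>V. \<forall>y\<in>V. f (x + y) = f x + f y) \<and>
     (\<forall>c. \<forall>x\<in>V. f (c *\<^sub>R x) = c *\<^sub>R f x)"

definition trace_on :: "'a::real_vector set \<Rightarrow> ('a \<Rightarrow> 'a) \<Rightarrow> real" where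
  "trace_on V f =
     (let B = (SOME B. independent B \<and> span B = V)
      in \<Sum>b\<in>B. real_vector.representation B (f b) b)"

text \<open>
  Complex eigenvalues are those of the complexified operator on \<open>V \<otimes> \<complex> = V \<oplus> \<i>V\<close>, where the pair
  \<open>(u, v)\<close> stands for \<open>u + \<i>v\<close>.
\<close>

definition complex_scale :: "complex \<Rightarrow> 'a::real_vector \<times> 'a \<Rightarrow> 'a \<times> 'a" where
  "complex_scale c w =
     (Re c *\<^sub>R fst w - Im c *\<^sub>R snd w, Im c *\<^sub>R fst w + Re c *\<^sub>R snd w)"

definition complex_eigenvalue_on :: "'a::real_vector set \<Rightarrow> ('a \<Rightarrow> 'a) \<Rightarrow> complex \<Rightarrow> bool" where
  "complex_eigenvalue_on V f c \<longleftrightarrow>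
     (\<exists>w \<in> V \<times> V. w \<noteq> 0 \<and> map_prod f f w = complex_scale c w)"

definition direct_sum :: "'a::real_vector set \<Rightarrow> 'a set \<Rightarrow> 'a set \<Rightarrow> bool" where
  "direct_sum V U W \<longleftrightarrow>
     subspace U \<and> subspace W \<and> U \<inter> W = {0} \<and> V = {u + w | u w. u \<in> U \<and> w \<in> W}"

section \<open>Inner products\<close>

locale inner_product_on =
  fixes V :: "'a::real_vector set" and ip :: "'a \<Rightarrow> 'a \<Rightarrow> real"
  assumes ip_commute: "x \<in> V \<Longrightarrow> y \<in> V \<Longrightarrow> ip x y = ip y x"
    and ip_add_left: "x \<in> V \<Longrightarrow> y \<in> V \<Longrightarrow> z \<in> V \<Longrightarrow> ip (x + y) z = ip x z + ip y z"
    and ip_scale_left: "x \<in> V \<Longrightarrow> y \<in> V \<Longrightarrow> ip (c *\<^sub>R x) y = c * ip x y"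
    and ip_pos: "x \<in> V \<Longrightarrow> x \<noteq> 0 \<Longrightarrow> ip x x > 0"

definition adjoint_on ::
    "'a::real_vector set \<Rightarrow> ('a \<Rightarrow> 'a \<Rightarrow> real) \<Rightarrow> ('a \<Rightarrow> 'a) \<Rightarrow> 'a \<Rightarrow> 'a" where
  "adjoint_on V ip f x = (THE y. y \<in> V \<and> (\<forall>z\<in>V. ip (f z) x = ip z y))"

definition normal_on ::
    "'a::real_vector set \<Rightarrow> ('a \<Rightarrow> 'a \<Rightarrow> real) \<Rightarrow> ('a \<Rightarrow> 'a) \<Rightarrow> bool" where
  "normal_on V ip f \<longleftrightarrow>
     (\<forall>x\<in>V. f (adjoint_on V ip f x) = adjoint_on V ip f (f x))"

definition symmetric_part ::
    "'a::real_vector set \<Rightarrow> ('a \<Rightarrow> 'a \<Rightarrow> real) \<Rightarrow> ('a \<Rightarrow> 'a) \<Rightarrow> 'a \<Rightarrow> 'a" where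
  "symmetric_part V ip f x = (1/2) *\<^sub>R (f x + adjoint_on V ip f x)"

text \<open>
  The symmetric operator \<open>T\<close> with \<open>\<langle>T x, x\<rangle> = q x\<close>. It is set to \<open>0\<close> outside \<open>V\<close> to make the
  description unique.
\<close>

definition symmetric_operator ::
    "'a::real_vector set \<Rightarrow> ('a \<Rightarrow> 'a \<Rightarrow> real) \<Rightarrow> ('a \<Rightarrow> real) \<Rightarrow> 'a \<Rightarrow> 'a" where
  "symmetric_operator V ip q =
     (THE T. endomorphism_on V T \<and>
             (\<forall>x\<in>V. \<forall>y\<in>V. ip (T x) y = ip x (T y)) \<and>
             (\<forall>x\<in>V. ip (T x) x = q x) \<and>
             (\<forall>x. x \<notin> V \<longrightarrow> T x = 0))"

definition orthonormal_basis ::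
    "'a::real_vector set \<Rightarrow> ('a \<Rightarrow> 'a \<Rightarrow> real) \<Rightarrow> 'a set \<Rightarrow> bool" where
  "orthonormal_basis V ip E \<longleftrightarrow>
     finite E \<and> span E = V \<and> (\<forall>x\<in>E. \<forall>y\<in>E. ip x y = (if x = y then 1 else 0))"

section \<open>Lie algebras\<close>

locale lie_algebra =
  fixes L :: "'a::real_vector set" and br :: "'a \<Rightarrow> 'a \<Rightarrow> 'a"
  assumes subspace_carrier: "subspace L"
    and finite_dimensional: "\<exists>B. finite B \<and> span B = L"
    and br_closed: "x \<in> L \<Longrightarrow> y \<in> L \<Longrightarrow> br x y \<in> L"
    and br_add_left: "x \<in> L \<Longrightarrow> y \<in> L \<Longrightarrow> z \<in> L \<Longrightarrow> br (x + y) z = br x z + br y z"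
    and br_add_right: "x \<in> L \<Longrightarrow> y \<in> L \<Longrightarrow> z \<in> L \<Longrightarrow> br x (y + z) = br x y + br x z"
    and br_scale_left: "x \<in> L \<Longrightarrow> y \<in> L \<Longrightarrow> br (c *\<^sub>R x) y = c *\<^sub>R br x y"
    and br_scale_right: "x \<in> L \<Longrightarrow> y \<in> L \<Longrightarrow> br x (c *\<^sub>R y) = c *\<^sub>R br x y"
    and br_self: "x \<in> L \<Longrightarrow> br x x = 0"
    and jacobi: "x \<in> L \<Longrightarrow> y \<in> L \<Longrightarrow> z \<in> L \<Longrightarrow>
                 br x (br y z) + br y (br z x) + br z (br x y) = 0"

definition lie_subalgebra :: "'a::real_vector set \<Rightarrow> ('a \<Rightarrow> 'a \<Rightarrow> 'a) \<Rightarrow> 'a set \<Rightarrow> bool" where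
  "lie_subalgebra L br K \<longleftrightarrow> subspace K \<and> K \<subseteq> L \<and> (\<forall>x\<in>K. \<forall>y\<in>K. br x y \<in> K)"

definition lie_ideal :: "'a::real_vector set \<Rightarrow> ('a \<Rightarrow> 'a \<Rightarrow> 'a) \<Rightarrow> 'a set \<Rightarrow> bool" where
  "lie_ideal L br I \<longleftrightarrow> subspace I \<and> I \<subseteq> L \<and> (\<forall>x\<in>L. \<forall>y\<in>I. br x y \<in> I)"

definition bracket_space :: "('a::real_vector \<Rightarrow> 'a \<Rightarrow> 'a) \<Rightarrow> 'a set \<Rightarrow> 'a set \<Rightarrow> 'a set" where
  "bracket_space br U W = span {br u w | u w. u \<in> U \<and> w \<in> W}"

definition lie_nilpotent :: "'a::real_vector set \<Rightarrow> ('a \<Rightarrow> 'a \<Rightarrow> 'a) \<Rightarrow> bool" where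
  "lie_nilpotent L br \<longleftrightarrow> (\<exists>m. (bracket_space br L ^^ m) L = {0})"

definition lie_solvable :: "'a::real_vector set \<Rightarrow> ('a \<Rightarrow> 'a \<Rightarrow> 'a) \<Rightarrow> bool" where
  "lie_solvable L br \<longleftrightarrow> (\<exists>m. ((\<lambda>U. bracket_space br U U) ^^ m) L = {0})"

definition lie_semisimple :: "'a::real_vector set \<Rightarrow> ('a \<Rightarrow> 'a \<Rightarrow> 'a) \<Rightarrow> bool" where
  "lie_semisimple L br \<longleftrightarrow> (\<forall>I. lie_ideal L br I \<and> lie_solvable I br \<longrightarrow> I = {0})"

definition lie_simple :: "'a::real_vector set \<Rightarrow> ('a \<Rightarrow> 'a \<Rightarrow> 'a) \<Rightarrow> bool" where
  "lie_simple L br \<longleftrightarrow>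
     (\<exists>x\<in>L. \<exists>y\<in>L. br x y \<noteq> 0) \<and> (\<forall>I. lie_ideal L br I \<longrightarrow> I = {0} \<or> I = L)"

text \<open>A Lie algebra is compact if it carries an \<open>ad\<close>-invariant inner product.\<close>

definition lie_compact :: "'a::real_vector set \<Rightarrow> ('a \<Rightarrow> 'a \<Rightarrow> 'a) \<Rightarrow> bool" where
  "lie_compact L br \<longleftrightarrow>
     (\<exists>ip. inner_product_on L ip \<and>
           (\<forall>x\<in>L. \<forall>y\<in>L. \<forall>z\<in>L. ip (br x y) z = - ip y (br x z)))"

definition no_compact_factors :: "'a::real_vector set \<Rightarrow> ('a \<Rightarrow> 'a \<Rightarrow> 'a) \<Rightarrow> bool" where
  "no_compact_factors L br \<longleftrightarrow>
     (\<forall>I. lie_ideal L br I \<and> lie_simple I br \<longrightarrow> \<not> lie_compact I br)"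

definition killing_form :: "'a::real_vector set \<Rightarrow> ('a \<Rightarrow> 'a \<Rightarrow> 'a) \<Rightarrow> 'a \<Rightarrow> 'a \<Rightarrow> real" where
  "killing_form L br x y = trace_on L (\<lambda>z. br x (br y z))"

text \<open>A Cartan decomposition is the pair of \<open>\<plusminus>1\<close>-eigenspaces of a Cartan involution.\<close>

definition cartan_involution ::
    "'a::real_vector set \<Rightarrow> ('a \<Rightarrow> 'a \<Rightarrow> 'a) \<Rightarrow> ('a \<Rightarrow> 'a) \<Rightarrow> bool" where
  "cartan_involution L br \<theta> \<longleftrightarrow>
     endomorphism_on L \<theta> \<and>
     (\<forall>x\<in>L. \<theta> (\<theta> x) = x) \<and>
     (\<forall>x\<in>L. \<forall>y\<in>L. \<theta> (br x y) = br (\<theta> x) (\<theta> y)) \<and>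
     inner_product_on L (\<lambda>x y. - killing_form L br x (\<theta> y))"

definition cartan_decomposition ::
    "'a::real_vector set \<Rightarrow> ('a \<Rightarrow> 'a \<Rightarrow> 'a) \<Rightarrow> 'a set \<Rightarrow> 'a set \<Rightarrow> bool" where
  "cartan_decomposition L br k p \<longleftrightarrow>
     (\<exists>\<theta>. cartan_involution L br \<theta> \<and> k = {x\<in>L. \<theta> x = x} \<and> p = {x\<in>L. \<theta> x = - x})"

section \<open>Ricci curvature\<close>

definition mean_curvature_vector ::
    "'a::real_vector set \<Rightarrow> ('a \<Rightarrow> 'a \<Rightarrow> 'a) \<Rightarrow> ('a \<Rightarrow> 'a \<Rightarrow> real) \<Rightarrow> 'a" where
  "mean_curvature_vector L br ip = (THE h. h \<in> L \<and> (\<forall>x\<in>L. ip h x = trace_on L (br x)))"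

text \<open>The quadratic form of \<open>M\<close>; its value does not depend on the orthonormal basis \<open>E\<close>.\<close>

definition M_form ::
    "'a::real_vector set \<Rightarrow> ('a \<Rightarrow> 'a \<Rightarrow> 'a) \<Rightarrow> ('a \<Rightarrow> 'a \<Rightarrow> real) \<Rightarrow> 'a \<Rightarrow> real" where
  "M_form L br ip x =
     (let E = (SOME E. orthonormal_basis L ip E)
      in - (1/2) * (\<Sum>u\<in>E. \<Sum>v\<in>E. (ip (br x u) v)\<^sup>2)
         + (1/4) * (\<Sum>u\<in>E. \<Sum>v\<in>E. (ip (br u v) x)\<^sup>2))"

definition ricci_operator ::
    "'a::real_vector set \<Rightarrow> ('a \<Rightarrow> 'a \<Rightarrow> 'a) \<Rightarrow> ('a \<Rightarrow> 'a \<Rightarrow> real) \<Rightarrow> 'a \<Rightarrow> 'a" where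
  "ricci_operator L br ip x =
     symmetric_operator L ip (M_form L br ip) x
     - (1/2) *\<^sub>R symmetric_operator L ip (\<lambda>y. trace_on L (\<lambda>z. br y (br y z))) x
     - symmetric_part L ip (br (mean_curvature_vector L br ip)) x"

definition negative_ricci ::
    "'a::real_vector set \<Rightarrow> ('a \<Rightarrow> 'a \<Rightarrow> 'a) \<Rightarrow> ('a \<Rightarrow> 'a \<Rightarrow> real) \<Rightarrow> bool" where
  "negative_ricci L br ip \<longleftrightarrow> (\<forall>x\<in>L. x \<noteq> 0 \<longrightarrow> ip (ricci_operator L br ip x) x < 0)"

end

theory Submission
  imports Defs "HOL-Library.Function_Algebras"
begin

text \<open>
  Let \<open>P\<close> be an inner product on \<open>n\<close> which is \<^emph>\<open>adapted\<close>: \<open>ad A\<close> is normal for \<open>A \<in> a\<close>, \<open>ad x\<close> is skew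
  for \<open>x \<in> k\<close> and symmetric for \<open>x \<in> p\<close>. Make \<open>a\<close>, \<open>r\<close>, \<open>n\<close> orthogonal, with \<open>P\<close> on \<open>n\<close> and the given
  inner product on \<open>r\<close>. As \<open>k\<close> and \<open>p\<close> are orthogonal, \<open>a + r\<close> has an orthonormal basis that acts on \<open>n\<close>
  by normal operators \<open>u\<close>, and then the contributions of \<open>|u X|\<^sup>2\<close> and \<open>|u\<^sup>t X|\<^sup>2\<close> to the Ricci form cancel. For
  \<open>Z = A + Y + X\<close> with \<open>A \<in> a\<close>, \<open>Y \<in> r\<close>, \<open>X \<in> n\<close> and \<open>D = ad Z\<close> restricted to \<open>n\<close> there remains
  (\<open>semidirect_ricci_form\<close>)

  \<open>\<langle>Ric Z, Z\<rangle> = \<langle>Ric\<^sub>r Y, Y\<rangle> - 1/4 |D + D\<^sup>t|\<^sup>2 + 1/4 \<Sum> \<langle>[e\<^sub>i, e\<^sub>j], X\<rangle>\<^sup>2 - \<langle>[H, X], X\<rangle>\<close>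

  with \<open>e\<^sub>i\<close> an orthonormal basis of \<open>n\<close>. The inner product on \<open>a\<close> is free, and it can be chosen such
  that \<open>H = s A\<^sub>0\<close> with \<open>s\<close> as large as desired (\<open>inner_product_with_dual_vector\<close>). The operator \<open>ad A\<^sub>0\<close>
  is normal on \<open>n\<close> with all eigenvalues in the right half plane, hence coercive
  (\<open>normal_coercive\<close>), so for large \<open>s\<close> the last term dominates the one before it and the form is
  negative unless \<open>X = Y = 0\<close>. In that case \<open>D = ad A\<close> is not skew, for a skew operator has purely
  imaginary eigenvalues, and the second term is negative.

  The hard part is the existence of \<open>P\<close> (\<open>module_adapted\<close>), usually proved by averaging over the compact
  real form and simultaneous diagonalisation of \<open>a\<close>. The proof below stays inside finite-dimensional
  linear algebra. For an irreducible module one minimises the energy \<open>\<Sum> |\<rho>(g)|\<^sub>P\<^sup>2\<close>, where \<open>g\<close> runs through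
  an orthonormal basis of \<open>r\<close> for the Cartan inner product and a basis of \<open>a\<close>. A minimising sequence
  cannot degenerate, because the limit of its orthonormal frames spans a submodule
  (\<open>minimal_energy_exists\<close>). At a minimum \<open>\<Sum> [\<rho>(g), \<rho>(g)\<^sup>t] = 0\<close>, and this alone forces \<open>P\<close> to be adapted
  (\<open>moment_zero_adapted\<close>). A reducible module is an extension of smaller ones, which have adapted
  inner products by induction; these make the Casimir operator on homomorphisms positive
  semidefinite, so that the extension splits by Whitehead's argument (\<open>cocycle_is_coboundary\<close>,
  \<open>hom_cocycle_splits\<close>), and \<open>P\<close> is the orthogonal sum.
\<close>

section \<open>Linear maps on a subspace\<close>

definition lin_on :: "'a::real_vector set \<Rightarrow> ('a \<Rightarrow> 'b::real_vector) \<Rightarrow> bool" where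
  "lin_on V f \<longleftrightarrow> (\<forall>x\<in>V. \<forall>y\<in>V. f (x + y) = f x + f y) \<and> (\<forall>c. \<forall>x\<in>V. f (c *\<^sub>R x) = c *\<^sub>R f x)"

definition bilin_on :: "'a::real_vector set \<Rightarrow> ('a \<Rightarrow> 'a \<Rightarrow> 'b::real_vector) \<Rightarrow> bool" where
  "bilin_on V \<beta> \<longleftrightarrow> (\<forall>y\<in>V. lin_on V (\<lambda>x. \<beta> x y)) \<and> (\<forall>x\<in>V. lin_on V (\<beta> x))"

definition findim :: "'a::real_vector set \<Rightarrow> bool" where
  "findim V \<longleftrightarrow> (\<exists>B. finite B \<and> span B = V)"

lemma lin_onI:
  assumes "\<And>x y. x \<in> V \<Longrightarrow> y \<in> V \<Longrightarrow> f (x + y) = f x + f y"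
    and "\<And>c x. x \<in> V \<Longrightarrow> f (c *\<^sub>R x) = c *\<^sub>R f x"
  shows "lin_on V f"
  using assms by (simp add: lin_on_def)

lemma lin_on_add: "lin_on V f \<Longrightarrow> x \<in> V \<Longrightarrow> y \<in> V \<Longrightarrow> f (x + y) = f x + f y"
  by (simp add: lin_on_def)

lemma lin_on_scale: "lin_on V f \<Longrightarrow> x \<in> V \<Longrightarrow> f (c *\<^sub>R x) = c *\<^sub>R f x"
  by (simp add: lin_on_def)

lemma lin_on_zero: "lin_on V f \<Longrightarrow> subspace V \<Longrightarrow> f 0 = 0"
  using lin_on_scale[of V f 0 0] by (simp add: subspace_0)

lemma lin_on_minus: "lin_on V f \<Longrightarrow> x \<in> V \<Longrightarrow> f (- x) = - f x"
  using lin_on_scale[of V f x "-1"] by simp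

lemma lin_on_diff:
  assumes "lin_on V f" "subspace V" "x \<in> V" "y \<in> V" shows "f (x - y) = f x - f y"
  using lin_on_add[OF assms(1,3), of "- y"] lin_on_minus[OF assms(1,4)] assms
  by (simp add: subspace_neg)

lemma lin_on_sum:
  assumes "lin_on V f" "subspace V" "\<And>i. i \<in> I \<Longrightarrow> x i \<in> V"
  shows "f (\<Sum>i\<in>I. x i) = (\<Sum>i\<in>I. f (x i))"
proof (cases "finite I")
  case True
  then show ?thesis using assms(3)
  proof (induction I)
    case empty
    then show ?case using lin_on_zero[OF assms(1,2)] by simp
  next
    case (insert i I)
    then show ?case
      using lin_on_add[OF assms(1), of "x i" "\<Sum>i\<in>I. x i"] subspace_sum[OF assms(2), of I x] by simp
  qed
next
  case False
  then show ?thesis using lin_on_zero[OF assms(1,2)] by simp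
qed

lemma lin_on_sum_scale:
  assumes "lin_on V f" "subspace V" "\<And>i. i \<in> I \<Longrightarrow> x i \<in> V"
  shows "f (\<Sum>i\<in>I. c i *\<^sub>R x i) = (\<Sum>i\<in>I. c i *\<^sub>R f (x i))"
  using lin_on_sum[OF assms(1,2), of I "\<lambda>i. c i *\<^sub>R x i"] assms
  by (simp add: subspace_scale lin_on_scale)

lemma endomorphism_on_iff: "endomorphism_on V f \<longleftrightarrow> lin_on V f \<and> (\<forall>x\<in>V. f x \<in> V)"
  by (auto simp: endomorphism_on_def lin_on_def)

lemma endo_lin: "endomorphism_on V f \<Longrightarrow> lin_on V f"
  by (simp add: endomorphism_on_iff)

lemma endo_in: "endomorphism_on V f \<Longrightarrow> x \<in> V \<Longrightarrow> f x \<in> V"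
  by (simp add: endomorphism_on_iff)

lemma endoI: "lin_on V f \<Longrightarrow> (\<And>x. x \<in> V \<Longrightarrow> f x \<in> V) \<Longrightarrow> endomorphism_on V f"
  by (simp add: endomorphism_on_iff)

lemma endo_comp:
  assumes "endomorphism_on V f" "endomorphism_on V g" shows "endomorphism_on V (\<lambda>x. f (g x))"
  using assms by (simp add: endomorphism_on_def)

lemma endo_add:
  assumes "endomorphism_on V f" "endomorphism_on V g" "subspace V"
  shows "endomorphism_on V (\<lambda>x. f x + g x)"
  using assms by (simp add: endomorphism_on_def subspace_add scaleR_add_right)

lemma endo_diff:
  assumes "endomorphism_on V f" "endomorphism_on V g" "subspace V"
  shows "endomorphism_on V (\<lambda>x. f x - g x)"
  using assms by (simp add: endomorphism_on_def subspace_diff scaleR_diff_right)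

lemma endo_scale:
  assumes "endomorphism_on V f" "subspace V"
  shows "endomorphism_on V (\<lambda>x. c *\<^sub>R f x)"
  using assms by (simp add: endomorphism_on_def subspace_scale scaleR_add_right)

lemma endo_sum:
  assumes "\<And>i. i \<in> I \<Longrightarrow> endomorphism_on V (f i)" "subspace V"
  shows "endomorphism_on V (\<lambda>x. \<Sum>i\<in>I. f i x)"
  using assms by (simp add: endomorphism_on_def subspace_sum scaleR_sum_right sum.distrib)

lemma bilin_onI:
  assumes "\<And>y. y \<in> V \<Longrightarrow> lin_on V (\<lambda>x. \<beta> x y)" "\<And>x. x \<in> V \<Longrightarrow> lin_on V (\<beta> x)"
  shows "bilin_on V \<beta>"
  using assms by (simp add: bilin_on_def)

lemma bilin_left: "bilin_on V \<beta> \<Longrightarrow> y \<in> V \<Longrightarrow> lin_on V (\<lambda>x. \<beta> x y)"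
  and bilin_right: "bilin_on V \<beta> \<Longrightarrow> x \<in> V \<Longrightarrow> lin_on V (\<beta> x)"
  by (simp_all add: bilin_on_def)

lemma findim_subspace: "findim V \<Longrightarrow> subspace V"
  unfolding findim_def by (metis subspace_span)

lemma findimE:
  assumes "findim V" obtains B where "finite B" "span B = V"
  using assms that unfolding findim_def by (elim exE conjE)

lemma findimI: "finite B \<Longrightarrow> span B = V \<Longrightarrow> findim V"
  unfolding findim_def by (intro exI conjI)

lemma findim_sub:
  assumes "findim V" "subspace W" "W \<subseteq> V" shows "findim W"
proof -
  obtain B where B: "finite B" "span B = V" using assms(1) by (rule findimE)
  obtain C where C: "C \<subseteq> W" "independent C" "W \<subseteq> span C" by (rule maximal_independent_subset[of W])
  have "finite C" using independent_span_bound[OF B(1) C(2)] B(2) C(1) assms(3) by auto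
  moreover have "span C = W" using C assms(2) by (metis span_subspace)
  ultimately show ?thesis by (rule findimI)
qed

lemma findim_basis:
  assumes "findim V" obtains B where "finite B" "independent B" "span B = V"
proof -
  obtain B where B: "finite B" "span B = V" using assms(1) by (rule findimE)
  obtain C where C: "C \<subseteq> V" "independent C" "V \<subseteq> span C" by (rule maximal_independent_subset[of V])
  have "finite C" using independent_span_bound[OF B(1) C(2)] B(2) C(1) by auto
  moreover have "span C = V" using C findim_subspace[OF assms] by (metis span_subspace)
  ultimately show ?thesis using that C by auto
qed

lemma subspace_card_eq:
  fixes B :: "'a::real_vector set"
  assumes "finite B" "independent B" "finite C" "independent C" "span B = span C"
  shows "card B = card C"
proof -
  have "C \<subseteq> span B" "B \<subseteq> span C" using assms(5) span_superset by blast+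
  then show ?thesis
    using independent_span_bound[OF assms(1,4)] independent_span_bound[OF assms(3,2)] by force
qed

section \<open>Inner products and orthonormal bases\<close>

definition orthonormal :: "('a \<Rightarrow> 'a \<Rightarrow> real) \<Rightarrow> 'a set \<Rightarrow> bool" where
  "orthonormal ip E \<longleftrightarrow> finite E \<and> (\<forall>x\<in>E. \<forall>y\<in>E. ip x y = (if x = y then 1 else 0))"

locale euclid = inner_product_on V ip for V :: "'a::real_vector set" and ip +
  assumes findim: "findim V"
begin

lemma sub: "subspace V" using findim by (rule findim_subspace)

lemmas V_add = subspace_add[OF sub] and V_scale = subspace_scale[OF sub]
  and V_diff = subspace_diff[OF sub] and V_0 = subspace_0[OF sub] and V_neg = subspace_neg[OF sub]
  and V_sum = subspace_sum[OF sub]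

lemma ip_add_right: "x \<in> V \<Longrightarrow> y \<in> V \<Longrightarrow> z \<in> V \<Longrightarrow> ip z (x + y) = ip z x + ip z y"
  using ip_add_left[of x y z] ip_commute[of z] V_add by simp

lemma ip_scale_right: "x \<in> V \<Longrightarrow> y \<in> V \<Longrightarrow> ip y (c *\<^sub>R x) = c * ip y x"
  using ip_scale_left[of x y c] ip_commute[of y] V_scale by simp

lemma ip_lin_left: "z \<in> V \<Longrightarrow> lin_on V (\<lambda>x. ip x z)"
  by (rule lin_onI) (simp_all add: ip_add_left ip_scale_left)

lemma ip_lin_right: "z \<in> V \<Longrightarrow> lin_on V (ip z)"
  by (rule lin_onI) (simp_all add: ip_add_right ip_scale_right)

lemmas ip_0_left = lin_on_zero[OF ip_lin_left sub] and ip_0_right = lin_on_zero[OF ip_lin_right sub]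
  and ip_diff_left = lin_on_diff[OF ip_lin_left sub] and ip_diff_right = lin_on_diff[OF ip_lin_right sub]
  and ip_minus_left = lin_on_minus[OF ip_lin_left] and ip_minus_right = lin_on_minus[OF ip_lin_right]
  and ip_sum_left = lin_on_sum[OF ip_lin_left sub]
  and ip_sums_left = lin_on_sum_scale[OF ip_lin_left sub, simplified real_scaleR_def]
  and ip_sums_right = lin_on_sum_scale[OF ip_lin_right sub, simplified real_scaleR_def]

lemma ip_ge0: "x \<in> V \<Longrightarrow> ip x x \<ge> 0"
  using ip_pos[of x] ip_0_left[of 0] V_0 by (cases "x = 0") (auto simp: less_imp_le)

lemma ip_self_0: "x \<in> V \<Longrightarrow> ip x x = 0 \<longleftrightarrow> x = 0"
  using ip_pos[of x] ip_0_left[of 0] V_0 by (cases "x = 0") auto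

lemma ip_eqI:
  assumes "x \<in> V" "y \<in> V" "\<And>z. z \<in> V \<Longrightarrow> ip x z = ip y z" shows "x = y"
proof -
  have "ip (x - y) (x - y) = 0" using assms by (simp add: ip_diff_left V_diff)
  then show ?thesis using assms by (simp add: ip_self_0 V_diff)
qed

text \<open>
One Gram-Schmidt step. Nothing is added if \<open>x\<close> already lies in the span of \<open>E\<close>.
\<close>

lemma orthonormal_extend1:
  assumes "orthonormal ip E" "E \<subseteq> V" "x \<in> V"
  shows "\<exists>E'. E \<subseteq> E' \<and> E' \<subseteq> V \<and> orthonormal ip E' \<and> span E' = span (insert x E)"
proof -
  define y where "y = x - (\<Sum>e\<in>E. ip x e *\<^sub>R e)"
  have fin: "finite E" using assms by (simp add: orthonormal_def)
  have sV: "(\<Sum>e\<in>E. ip x e *\<^sub>R e) \<in> V" using assms by (intro V_sum V_scale) auto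
  have yV: "y \<in> V" using sV assms by (simp add: y_def V_diff)
  have sE: "(\<Sum>e\<in>E. ip x e *\<^sub>R e) \<in> span E" by (intro span_sum span_scale span_base)
  have orth: "ip y f = 0" if "f \<in> E" for f
  proof -
    have "ip (\<Sum>e\<in>E. ip x e *\<^sub>R e) f = (\<Sum>e\<in>E. ip x e * ip e f)"
      using assms that by (intro ip_sums_left) auto
    also have "\<dots> = (\<Sum>e\<in>E. if e = f then ip x e else 0)"
      using assms that by (intro sum.cong) (auto simp: orthonormal_def)
    also have "\<dots> = ip x f" using fin that by simp
    finally show ?thesis using assms that sV by (auto simp: y_def ip_diff_left)
  qed
  show ?thesis
  proof (cases "y = 0")
    case True
    then have "x \<in> span E" using sE by (simp add: y_def)
    then show ?thesis using assms by (intro exI[of _ E]) (simp add: span_redundant)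
  next
    case False
    define c where "c = 1 / sqrt (ip y y)"
    have pos: "ip y y > 0" using False yV by (simp add: ip_pos)
    have c: "c \<noteq> 0" "c * c * ip y y = 1" using pos by (auto simp: c_def)
    have zV: "c *\<^sub>R y \<in> V" using yV by (simp add: V_scale)
    have 1: "ip (c *\<^sub>R y) (c *\<^sub>R y) = 1"
      using c(2) yV zV by (simp add: ip_scale_left ip_scale_right mult.assoc)
    have 2: "ip (c *\<^sub>R y) f = 0" "ip f (c *\<^sub>R y) = 0" if "f \<in> E" for f
    proof -
      have fV: "f \<in> V" using that assms(2) by blast
      show "ip (c *\<^sub>R y) f = 0" using orth[OF that] yV fV by (simp add: ip_scale_left)
      then show "ip f (c *\<^sub>R y) = 0" using ip_commute[OF fV zV] by simp
    qed
    have on: "orthonormal ip (insert (c *\<^sub>R y) E)"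
      unfolding orthonormal_def
    proof (intro conjI ballI)
      fix u v assume uv: "u \<in> insert (c *\<^sub>R y) E" "v \<in> insert (c *\<^sub>R y) E"
      show "ip u v = (if u = v then 1 else 0)"
      proof (cases "u \<in> E \<and> v \<in> E")
        case True
        then show ?thesis using assms(1) by (simp add: orthonormal_def)
      next
        case False
        have "c *\<^sub>R y \<notin> E" using 1 2(1) by force
        with False uv 1 2 show ?thesis by (elim insertE) auto
      qed
    qed (use fin in simp)
    have "span (insert (c *\<^sub>R y) E) = span (insert x E)"
    proof
      have "x = (1/c) *\<^sub>R (c *\<^sub>R y) + (\<Sum>e\<in>E. ip x e *\<^sub>R e)" using c by (simp add: y_def)
      moreover have "(\<Sum>e\<in>E. ip x e *\<^sub>R e) \<in> span (insert (c *\<^sub>R y) E)"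
        using sE span_mono[of E "insert (c *\<^sub>R y) E"] by auto
      ultimately have "x \<in> span (insert (c *\<^sub>R y) E)"
        by (metis insertI1 span_add span_base span_scale)
      then show "span (insert x E) \<subseteq> span (insert (c *\<^sub>R y) E)"
        by (intro span_minimal) (auto simp: span_base)
      have "(\<Sum>e\<in>E. ip x e *\<^sub>R e) \<in> span (insert x E)" using sE span_mono[of E "insert x E"] by auto
      then have "c *\<^sub>R y \<in> span (insert x E)"
        unfolding y_def by (intro span_scale span_diff) (auto simp: span_base)
      then show "span (insert (c *\<^sub>R y) E) \<subseteq> span (insert x E)"
        by (intro span_minimal) (auto simp: span_base)
    qed
    then show ?thesis using on zV assms(2)
      by (intro exI[of _ "insert (c *\<^sub>R y) E"] conjI) (simp_all add: subset_insertI)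
  qed
qed

lemma orthonormal_extend:
  assumes "orthonormal ip E" "E \<subseteq> V" "finite S" "S \<subseteq> V"
  shows "\<exists>E'. E \<subseteq> E' \<and> E' \<subseteq> V \<and> orthonormal ip E' \<and> span E' = span (S \<union> E)"
  using assms(3,4)
proof (induction S)
  case empty
  then show ?case using assms by (intro exI[of _ E]) simp
next
  case (insert x S)
  then obtain E1 where E1: "E \<subseteq> E1" "E1 \<subseteq> V" "orthonormal ip E1" "span E1 = span (S \<union> E)"
    by (metis insert_subset)
  obtain E2 where E2: "E1 \<subseteq> E2" "E2 \<subseteq> V" "orthonormal ip E2" "span E2 = span (insert x E1)"
    using orthonormal_extend1[OF E1(3,2), of x] insert.prems by blast
  have "span (insert x E1) = span (insert x (S \<union> E))"
    using E1(4) by (simp add: span_insert)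
  then have "span E2 = span (insert x S \<union> E)" using E2(4) by simp
  with E1(1) E2(1-3) show ?case by blast
qed

lemma orthonormal_basis_iff:
  "orthonormal_basis V ip E \<longleftrightarrow> orthonormal ip E \<and> span E = V"
  by (auto simp: orthonormal_basis_def orthonormal_def)

lemma onb_extend:
  assumes "orthonormal ip E" "E \<subseteq> V"
  shows "\<exists>E'. E \<subseteq> E' \<and> orthonormal_basis V ip E'"
proof -
  obtain B where B: "finite B" "span B = V" using findim by (rule findimE)
  then have BV: "B \<subseteq> V" using span_superset by blast
  obtain E' where "E \<subseteq> E'" "E' \<subseteq> V" "orthonormal ip E'" "span E' = span (B \<union> E)"
    using orthonormal_extend[OF assms B(1) BV] by blast
  moreover have "span (B \<union> E) = V"
  proof
    show "span (B \<union> E) \<subseteq> V" using BV assms(2) sub by (intro span_minimal) simp_all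
    show "V \<subseteq> span (B \<union> E)" using span_mono[of B "B \<union> E"] unfolding B(2) by simp
  qed
  ultimately show ?thesis unfolding orthonormal_basis_iff by blast
qed

lemma onb_exists: "\<exists>E. orthonormal_basis V ip E"
proof -
  have "orthonormal ip {}" by (simp add: orthonormal_def)
  then show ?thesis using onb_extend[of "{}"] by blast
qed

lemma onb_subspace:
  assumes "subspace W" "W \<subseteq> V" shows "\<exists>E. E \<subseteq> W \<and> orthonormal_basis W ip E"
proof -
  obtain B where B: "finite B" "span B = W" using findim_sub[OF findim assms] by (rule findimE)
  then have BV: "B \<subseteq> V" using span_superset assms by blast
  have "orthonormal ip {}" by (simp add: orthonormal_def)
  then obtain E' where E: "orthonormal ip E'" "span E' = span (B \<union> {})"
    using orthonormal_extend[of "{}", OF _ _ B(1) BV] by blast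
  then have "span E' = W" using B by simp
  moreover from this have "E' \<subseteq> W" using span_superset[of E'] by simp
  ultimately show ?thesis using E(1) unfolding orthonormal_basis_def orthonormal_def by blast
qed

end

lemma euclid_subspace:
  assumes "euclid V ip" "subspace W" "W \<subseteq> V" shows "euclid W ip"
proof -
  interpret euclid V ip by fact
  show ?thesis
    using assms findim_sub[OF findim assms(2,3)]
    by unfold_locales (auto simp: subset_iff ip_commute ip_add_left ip_scale_left ip_pos)
qed

locale onb = euclid V ip for V :: "'a::real_vector set" and ip +
  fixes E assumes onb: "orthonormal_basis V ip E"
begin

lemma finE: "finite E" and spanE: "span E = V"
  and ip_E: "u \<in> E \<Longrightarrow> v \<in> E \<Longrightarrow> ip u v = (if u = v then 1 else 0)"
  using onb by (auto simp: orthonormal_basis_def)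

lemma EV: "u \<in> E \<Longrightarrow> u \<in> V" using spanE span_superset by auto

lemma ip_comb: 
  assumes "v \<in> E" shows "ip (\<Sum>u\<in>E. c u *\<^sub>R u) v = c v"
proof -
  have "ip (\<Sum>u\<in>E. c u *\<^sub>R u) v = (\<Sum>u\<in>E. c u * ip u v)" using assms EV by (intro ip_sums_left) auto
  also have "\<dots> = (\<Sum>u\<in>E. if u = v then c u else 0)" using assms by (intro sum.cong) (auto simp: ip_E)
  finally show ?thesis using assms finE by simp
qed

lemma expand: assumes "x \<in> V" shows "(\<Sum>u\<in>E. ip x u *\<^sub>R u) = x"
proof -
  obtain c where "(\<Sum>u\<in>E. c u *\<^sub>R u) = x"
    using assms spanE span_finite[OF finE] by auto
  then show ?thesis using ip_comb[of _ c] by (metis (no_types, lifting) sum.cong)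
qed

lemma lin_expand:
  assumes "lin_on V f" "x \<in> V" shows "f x = (\<Sum>u\<in>E. ip x u *\<^sub>R f u)"
  using lin_on_sum_scale[OF assms(1) sub, of E "\<lambda>u. u" "ip x"] expand[OF assms(2)] EV by simp

lemma parseval:
  assumes "x \<in> V" "y \<in> V" shows "ip x y = (\<Sum>u\<in>E. ip x u * ip y u)"
proof -
  have "ip x y = (\<Sum>u\<in>E. ip x u * ip u y)"
    using lin_expand[OF ip_lin_left[OF assms(2)] assms(1)] by simp
  also have "\<dots> = (\<Sum>u\<in>E. ip x u * ip y u)"
    by (intro sum.cong refl arg_cong2[where f = "(*)"] ip_commute EV assms)
  finally show ?thesis .
qed

lemma indep: "independent E"
proof -
  have "c v = 0" if "(\<Sum>u\<in>E. c u *\<^sub>R u) = 0" "v \<in> E" for c v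
    using ip_comb[OF that(2), of c] that ip_0_left EV by simp
  then show ?thesis by (auto simp: independent_explicit_finite_subsets finE dependent_finite)
qed

lemma ip_ext:
  assumes "x \<in> V" "y \<in> V" "\<And>u. u \<in> E \<Longrightarrow> ip x u = ip y u" shows "x = y"
proof -
  have "(\<Sum>u\<in>E. ip x u *\<^sub>R u) = (\<Sum>u\<in>E. ip y u *\<^sub>R u)"
    by (rule sum.cong[OF refl]) (simp only: assms(3))
  then show ?thesis unfolding expand[OF assms(1)] expand[OF assms(2)] .
qed

text \<open>
  The sum is the trace of \<open>\<beta>\<close> with respect to \<open>ip\<close>. Hence quantities defined by some orthonormal basis,
  such as \<open>M_form\<close>, can be computed in the most convenient one.
\<close>

lemma sum_onb_independent:
  assumes "bilin_on V \<beta>" "orthonormal_basis V ip F"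
  shows "(\<Sum>f\<in>F. \<beta> f f) = (\<Sum>e\<in>E. \<beta> e e)"
proof -
  interpret F: onb V ip F using assms(2) by unfold_locales
  have "(\<Sum>f\<in>F. \<beta> f f) = (\<Sum>f\<in>F. \<Sum>e\<in>E. \<Sum>e'\<in>E. (ip f e * ip f e') *\<^sub>R \<beta> e e')"
  proof (rule sum.cong[OF refl])
    fix f assume "f \<in> F"
    then have fV: "f \<in> V" by (rule F.EV)
    have "\<beta> f f = (\<Sum>e\<in>E. ip f e *\<^sub>R \<beta> e f)"
      using lin_expand[OF bilin_left[OF assms(1) fV] fV] .
    also have "\<dots> = (\<Sum>e\<in>E. ip f e *\<^sub>R (\<Sum>e'\<in>E. ip f e' *\<^sub>R \<beta> e e'))"
      using lin_expand[OF bilin_right[OF assms(1)] fV] EV by (intro sum.cong) auto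
    finally show "\<beta> f f = (\<Sum>e\<in>E. \<Sum>e'\<in>E. (ip f e * ip f e') *\<^sub>R \<beta> e e')"
      by (simp add: scaleR_sum_right)
  qed
  also have "\<dots> = (\<Sum>e\<in>E. \<Sum>e'\<in>E. \<Sum>f\<in>F. (ip f e * ip f e') *\<^sub>R \<beta> e e')"
    by (rule trans[OF sum.swap]) (rule sum.cong[OF refl], rule sum.swap)
  also have "\<dots> = (\<Sum>e\<in>E. \<Sum>e'\<in>E. ip e e' *\<^sub>R \<beta> e e')"
  proof (intro sum.cong refl)
    fix e e' assume "e \<in> E" "e' \<in> E"
    then have V: "e \<in> V" "e' \<in> V" by (auto intro: EV)
    have "(\<Sum>f\<in>F. ip f e * ip f e') = (\<Sum>f\<in>F. ip e f * ip e' f)"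
      using V by (intro sum.cong refl) (simp add: ip_commute F.EV)
    then have "(\<Sum>f\<in>F. ip f e * ip f e') = ip e e'" using F.parseval[OF V] by argo
    then show "(\<Sum>f\<in>F. (ip f e * ip f e') *\<^sub>R \<beta> e e') = ip e e' *\<^sub>R \<beta> e e'"
      by (simp flip: scaleR_sum_left)
  qed
  also have "\<dots> = (\<Sum>e\<in>E. \<beta> e e)"
  proof (rule sum.cong[OF refl])
    fix e assume e: "e \<in> E"
    have "(\<Sum>e'\<in>E. ip e e' *\<^sub>R \<beta> e e') = (\<Sum>e'\<in>E. if e' = e then \<beta> e e' else 0)"
      using e by (intro sum.cong) (auto simp: ip_E)
    then show "(\<Sum>e'\<in>E. ip e e' *\<^sub>R \<beta> e e') = \<beta> e e" using e finE by simp
  qed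
  finally show ?thesis .
qed

text \<open>
  The trace is defined by an arbitrary vector space basis \<open>B\<close>. Expanding \<open>f b\<close> in \<open>E\<close> and \<open>e \<in> E\<close> in \<open>B\<close> shows
  that \<open>B\<close> and \<open>E\<close> give the same number.
\<close>

lemma trace_eq:
  assumes "lin_on V f" "\<And>x. x \<in> V \<Longrightarrow> f x \<in> V"
  shows "trace_on V f = (\<Sum>e\<in>E. ip (f e) e)"
proof -
  define B where "B = (SOME B. independent B \<and> span B = V)"
  have "\<exists>B. independent B \<and> span B = V" using indep spanE by blast
  then have B: "independent B" "span B = V" unfolding B_def by (metis (mono_tags, lifting) someI_ex)+
  have finB: "finite B" using independent_span_bound[OF finE B(1)] B(2) spanE span_superset by blast
  have BV: "b \<in> V" if "b \<in> B" for b using that B span_superset by blast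
  let ?r = "representation B"
  have rlin: "lin_on V (\<lambda>x. ?r x b)" for b
    using B by (intro lin_onI) (simp_all add: representation_add representation_scale)
  have "trace_on V f = (\<Sum>b\<in>B. ?r (f b) b)" unfolding trace_on_def B_def[symmetric] by simp
  also have "\<dots> = (\<Sum>b\<in>B. \<Sum>e\<in>E. ip (f b) e * ?r e b)"
    using lin_expand[OF rlin] assms(2) BV by (intro sum.cong) auto
  also have "\<dots> = (\<Sum>e\<in>E. \<Sum>b\<in>B. ?r e b * ip (f b) e)"
    by (subst sum.swap) (simp add: mult.commute)
  also have "\<dots> = (\<Sum>e\<in>E. ip (f e) e)"
  proof (rule sum.cong[OF refl])
    fix e assume e: "e \<in> E"
    have "e = (\<Sum>b\<in>B. ?r e b *\<^sub>R b)"
      using sum_representation_eq[OF B(1) _ finB order_refl] e EV B by auto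
    then have "ip (f e) e = ip (f (\<Sum>b\<in>B. ?r e b *\<^sub>R b)) e" by simp
    also have "\<dots> = ip (\<Sum>b\<in>B. ?r e b *\<^sub>R f b) e"
      using lin_on_sum_scale[OF assms(1) sub, of B "\<lambda>b. b"] BV by simp
    also have "\<dots> = (\<Sum>b\<in>B. ?r e b * ip (f b) e)"
      using e EV BV assms(2) by (intro ip_sums_left) auto
    finally show "(\<Sum>b\<in>B. ?r e b * ip (f b) e) = ip (f e) e" by simp
  qed
  finally show ?thesis .
qed

lemma trace_endo: "endomorphism_on V f \<Longrightarrow> trace_on V f = (\<Sum>e\<in>E. ip (f e) e)"
  by (simp add: trace_eq endo_lin endo_in)

lemma trace_commute:
  assumes "endomorphism_on V f" "endomorphism_on V g"
  shows "trace_on V (\<lambda>x. f (g x)) = trace_on V (\<lambda>x. g (f x))"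
proof -
  have *: "trace_on V (\<lambda>x. f (g x)) = (\<Sum>e\<in>E. \<Sum>e'\<in>E. ip (g e) e' * ip (f e') e)"
    if f: "endomorphism_on V f" and g: "endomorphism_on V g" for f g
  proof -
    have "lin_on V (\<lambda>x. ip (f x) e)" if "e \<in> E" for e
      using EV[OF that] f by (intro lin_onI) (simp_all add: endomorphism_on_def ip_add_left ip_scale_left)
    then have "ip (f (g e)) e = (\<Sum>e'\<in>E. ip (g e) e' * ip (f e') e)" if "e \<in> E" for e
      using lin_expand[of "\<lambda>x. ip (f x) e" "g e"] that EV g by (simp add: endo_in)
    then show ?thesis by (simp add: trace_endo[OF endo_comp[OF f g]])
  qed
  show ?thesis unfolding *[OF assms] *[OF assms(2,1)]
    by (subst sum.swap) (simp add: mult.commute)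
qed

lemma cauchy_schwarz:
  assumes "x \<in> V" "y \<in> V" shows "(ip x y)\<^sup>2 \<le> ip x x * ip y y"
  using Cauchy_Schwarz_ineq_sum[of "ip x" "ip y" E]
  unfolding parseval[OF assms] parseval[OF assms(1,1)] parseval[OF assms(2,2)] power2_eq_square .

end

context euclid
begin

lemma adjoint_ex1:
  assumes f: "endomorphism_on V f" and x: "x \<in> V"
  shows "\<exists>!y. y \<in> V \<and> (\<forall>z\<in>V. ip (f z) x = ip z y)"
proof -
  obtain E where "orthonormal_basis V ip E" using onb_exists by blast
  then interpret onb V ip E by unfold_locales
  define y where "y = (\<Sum>e\<in>E. ip (f e) x *\<^sub>R e)"
  have yV: "y \<in> V" unfolding y_def by (intro V_sum V_scale EV)
  have "ip (f z) x = ip z y" if "z \<in> V" for z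
  proof -
    have "lin_on V (\<lambda>z. ip (f z) x)" using f x
      by (intro lin_onI) (simp_all add: endomorphism_on_def ip_add_left ip_scale_left)
    from lin_expand[OF this that]
    have "ip (f z) x = (\<Sum>e\<in>E. ip z e * ip (f e) x)" by simp
    also have "\<dots> = ip z y"
      unfolding parseval[OF that yV] by (intro sum.cong refl) (simp add: y_def ip_comb)
    finally show ?thesis .
  qed
  moreover have "y' = y" if "y' \<in> V" "\<forall>z\<in>V. ip (f z) x = ip z y'" for y'
    using that yV calculation ip_commute by (intro ip_eqI) auto
  ultimately show ?thesis using yV by blast
qed

abbreviation adj where "adj \<equiv> adjoint_on V ip"

lemma
  assumes "endomorphism_on V f" "x \<in> V"
  shows adj_in: "adj f x \<in> V"
    and adj_right: "z \<in> V \<Longrightarrow> ip z (adj f x) = ip (f z) x"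
proof -
  have "adj f x \<in> V \<and> (\<forall>z\<in>V. ip (f z) x = ip z (adj f x))"
    unfolding adjoint_on_def by (rule theI'[OF adjoint_ex1[OF assms]])
  then show "adj f x \<in> V" "z \<in> V \<Longrightarrow> ip z (adj f x) = ip (f z) x" by simp_all
qed

lemma adj_left: "endomorphism_on V f \<Longrightarrow> x \<in> V \<Longrightarrow> z \<in> V \<Longrightarrow> ip (adj f x) z = ip x (f z)"
  using adj_right[of f x z] ip_commute[of "adj f x" z] ip_commute[of x "f z"] adj_in[of f x] endo_in[of V f z]
  by simp

lemma adj_eqI:
  assumes "endomorphism_on V f" "x \<in> V" "y \<in> V" "\<And>z. z \<in> V \<Longrightarrow> ip (f z) x = ip z y"
  shows "adj f x = y"
  unfolding adjoint_on_def
  by (rule the1_equality[OF adjoint_ex1[OF assms(1,2)]]) (simp add: assms(3,4))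

lemma adj_endo: assumes f: "endomorphism_on V f" shows "endomorphism_on V (adj f)"
proof (rule endoI)
  show "lin_on V (adj f)"
    using f by (intro lin_onI adj_eqI)
      (simp_all add: V_add V_scale adj_in adj_right ip_add_right ip_scale_right endo_in)
qed (use f adj_in in auto)

lemma normal_onI:
  assumes f: "endomorphism_on V f" and "\<And>x. x \<in> V \<Longrightarrow> f' x \<in> V"
    and "\<And>x y. x \<in> V \<Longrightarrow> y \<in> V \<Longrightarrow> ip (f x) y = ip x (f' y)"
    and "\<And>x. x \<in> V \<Longrightarrow> f (f' x) = f' (f x)"
  shows "normal_on V ip f"
proof -
  have "adj f x = f' x" if "x \<in> V" for x using assms that by (intro adj_eqI) auto
  then show ?thesis using assms by (simp add: normal_on_def endo_in)
qed

end

section \<open>Minimisation and eigenvectors\<close>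

text \<open>
  Bolzano-Weierstrass for finitely many coordinates. The ambient vector space carries no topology, so
  all compactness arguments are made with coordinates.
\<close>

lemma convergent_subseq:
  fixes u :: "nat \<Rightarrow> 'i \<Rightarrow> real"
  assumes "finite S" "\<And>k s. s \<in> S \<Longrightarrow> \<bar>u k s\<bar> \<le> M"
  shows "\<exists>r l. strict_mono (r :: nat \<Rightarrow> nat) \<and> (\<forall>s\<in>S. (\<lambda>k. u (r k) s) \<longlonglongrightarrow> l s)"
  using assms
proof (induction S)
  case empty
  have "strict_mono (\<lambda>k::nat. k)" by (simp add: strict_mono_def)
  then show ?case by blast
next
  case (insert s S)
  then obtain r l where r: "strict_mono (r :: nat \<Rightarrow> nat)" "\<forall>s\<in>S. (\<lambda>k. u (r k) s) \<longlonglongrightarrow> l s"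
    by (metis insert_iff)
  have "bounded (range (\<lambda>k. u (r k) s))"
    using insert.prems[of s] by (auto intro!: boundedI[of _ M])
  then obtain l' r' where r': "strict_mono (r' :: nat \<Rightarrow> nat)" "((\<lambda>k. u (r k) s) \<circ> r') \<longlonglongrightarrow> l'"
    using bounded_imp_convergent_subsequence by blast
  have "(\<lambda>k. u ((r \<circ> r') k) t) \<longlonglongrightarrow> (l(s := l')) t" if "t \<in> insert s S" for t
  proof (cases "t = s")
    case True
    then show ?thesis using r'(2) by (simp add: o_def)
  next
    case False
    then have "(\<lambda>k. u (r k) t) \<longlonglongrightarrow> l t" using that r(2) by simp
    from LIMSEQ_subseq_LIMSEQ[OF this r'(1)] show ?thesis using False by (simp add: o_def)
  qed
  moreover have "strict_mono (r \<circ> r')" using r(1) r'(1) by (rule strict_mono_o)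
  ultimately show ?case by blast
qed

lemma linear_term_zero:
  fixes a b :: real
  assumes "\<And>t. a * t + b * t\<^sup>2 \<ge> 0" shows "a = 0"
proof (rule ccontr)
  assume a: "a \<noteq> 0"
  define c where "c = \<bar>b\<bar> + 1"
  have c: "c > 0" "b \<le> c - 1" by (auto simp: c_def)
  have "a * (- a / c) + b * (- a / c)\<^sup>2 = a\<^sup>2 / c\<^sup>2 * (b - c)"
    using c by (simp add: field_simps power2_eq_square)
  also have "\<dots> < 0" using a c by (intro mult_pos_neg) auto
  finally show False using assms[of "- a / c"] by simp
qed

context onb begin

lemma bilin_expand:
  fixes \<beta> :: "'a \<Rightarrow> 'a \<Rightarrow> real"
  assumes "bilin_on V \<beta>" "x \<in> V"
  shows "\<beta> x x = (\<Sum>u\<in>E. \<Sum>v\<in>E. ip x u * ip x v * \<beta> u v)"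
proof -
  have "\<beta> x x = (\<Sum>u\<in>E. ip x u * \<beta> u x)"
    using lin_expand[OF bilin_left[OF assms] assms(2)] by simp
  also have "\<dots> = (\<Sum>u\<in>E. ip x u * (\<Sum>v\<in>E. ip x v * \<beta> u v))"
    using lin_expand[OF bilin_right[OF assms(1)] assms(2)] EV by (intro sum.cong refl) simp
  finally show ?thesis by (simp add: sum_distrib_left mult.assoc)
qed

lemma abs_coord_le:
  assumes "x \<in> V" "ip x x = 1" "u \<in> E" shows "\<bar>ip x u\<bar> \<le> 1"
proof -
  have "(ip x u)\<^sup>2 \<le> 1" using cauchy_schwarz[OF assms(1) EV[OF assms(3)]] assms by (simp add: ip_E)
  then show ?thesis by (simp add: abs_square_le_1)
qed

text \<open>
  A minimum of the Rayleigh quotient \<open>\<beta> y y / ip y y\<close>, written without division to include \<open>y = 0\<close>. It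
  exists because the coordinates of unit vectors are bounded.
\<close>

lemma form_attains_min:
  fixes \<beta> :: "'a \<Rightarrow> 'a \<Rightarrow> real"
  assumes \<beta>: "bilin_on V \<beta>" and ne: "V \<noteq> {0}"
  shows "\<exists>x\<in>V. x \<noteq> 0 \<and> (\<forall>y\<in>V. \<beta> x x * ip y y \<le> \<beta> y y * ip x x)"
proof -
  define K where "K = {x \<in> V. ip x x = 1}"
  obtain e where e: "e \<in> E"
    using ne spanE by (metis all_not_in_conv span_empty)
  have "e \<in> K" using e by (simp add: K_def EV ip_E)
  have coord: "\<bar>ip x u\<bar> \<le> 1" if "x \<in> K" "u \<in> E" for x u
    using abs_coord_le that by (simp add: K_def)
  define m where "m = Inf ((\<lambda>x. \<beta> x x) ` K)"
  have bdd: "bdd_below ((\<lambda>x. \<beta> x x) ` K)"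
  proof (rule bdd_belowI2[where m = "- (\<Sum>u\<in>E. \<Sum>v\<in>E. \<bar>\<beta> u v\<bar>)"])
    fix x assume x: "x \<in> K"
    have "\<bar>\<beta> x x\<bar> \<le> (\<Sum>u\<in>E. \<Sum>v\<in>E. \<bar>ip x u * ip x v * \<beta> u v\<bar>)"
      using x unfolding K_def by (subst bilin_expand[OF \<beta>]) (auto intro!: order.trans[OF sum_abs] sum_mono)
    also have "\<dots> \<le> (\<Sum>u\<in>E. \<Sum>v\<in>E. \<bar>\<beta> u v\<bar>)"
      using coord[OF x] by (intro sum_mono) (simp add: abs_mult mult_left_le_one_le mult_le_one)
    finally show "- (\<Sum>u\<in>E. \<Sum>v\<in>E. \<bar>\<beta> u v\<bar>) \<le> \<beta> x x" by linarith
  qed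
  have "\<exists>x\<in>K. \<beta> x x < m + 1 / real (Suc k)" for k
  proof -
    have "m < m + 1 / real (Suc k)" by simp
    then show ?thesis unfolding m_def
      using cInf_lessD[of "(\<lambda>x. \<beta> x x) ` K" "Inf ((\<lambda>x. \<beta> x x) ` K) + 1 / real (Suc k)"] \<open>e \<in> K\<close> by blast
  qed
  then obtain x where x: "\<And>k. x k \<in> K" "\<And>k. \<beta> (x k) (x k) < m + 1 / real (Suc k)" by metis
  obtain r l where r: "strict_mono (r :: nat \<Rightarrow> nat)" "\<forall>u\<in>E. (\<lambda>k. ip (x (r k)) u) \<longlonglongrightarrow> l u"
    using convergent_subseq[OF finE, of "\<lambda>k. ip (x k)" 1] coord x(1) by blast
  define z where "z = (\<Sum>u\<in>E. l u *\<^sub>R u)"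
  have zV: "z \<in> V" unfolding z_def by (intro V_sum V_scale EV)
  have zu: "ip z u = l u" if "u \<in> E" for u unfolding z_def using that by (rule ip_comb)
  have lim: "(\<lambda>k. \<gamma> (x (r k)) (x (r k))) \<longlonglongrightarrow> \<gamma> z z" if "bilin_on V \<gamma>" for \<gamma> :: "'a \<Rightarrow> 'a \<Rightarrow> real"
  proof -
    have "(\<lambda>k. \<Sum>u\<in>E. \<Sum>v\<in>E. ip (x (r k)) u * ip (x (r k)) v * \<gamma> u v)
        \<longlonglongrightarrow> (\<Sum>u\<in>E. \<Sum>v\<in>E. l u * l v * \<gamma> u v)"
      using r(2) by (intro tendsto_sum tendsto_mult tendsto_const) auto
    moreover have "(\<Sum>u\<in>E. \<Sum>v\<in>E. l u * l v * \<gamma> u v) = \<gamma> z z"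
      unfolding bilin_expand[OF that zV] by (intro sum.cong refl) (simp add: zu)
    moreover have "(\<Sum>u\<in>E. \<Sum>v\<in>E. ip (x (r k)) u * ip (x (r k)) v * \<gamma> u v) = \<gamma> (x (r k)) (x (r k))" for k
      using bilin_expand[OF that, of "x (r k)"] x(1)[of "r k"] by (simp add: K_def)
    ultimately show ?thesis by simp
  qed
  have "(\<lambda>k. ip (x (r k)) (x (r k))) \<longlonglongrightarrow> ip z z"
    by (rule lim) (intro bilin_onI ip_lin_left ip_lin_right)
  moreover have "ip (x (r k)) (x (r k)) = 1" for k using x(1)[of "r k"] by (simp add: K_def)
  ultimately have z1: "ip z z = 1" by (simp add: LIMSEQ_const_iff)
  have "(\<lambda>k. m + 1 / real (Suc k)) \<longlonglongrightarrow> m + 0"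
    by (intro tendsto_add tendsto_const LIMSEQ_Suc[OF lim_1_over_n])
  then have "(\<lambda>k. m + 1 / real (Suc (r k))) \<longlonglongrightarrow> m"
    using LIMSEQ_subseq_LIMSEQ[OF _ r(1)] by (force simp: o_def)
  then have "\<beta> z z \<le> m"
    by (rule LIMSEQ_le[OF lim[OF \<beta>]]) (use x(2) in \<open>auto intro: less_imp_le\<close>)
  then have le: "\<beta> z z \<le> \<beta> y y" if "y \<in> K" for y
    using cInf_lower[OF imageI[OF that] bdd] by (simp add: m_def)
  have "\<beta> z z * ip y y \<le> \<beta> y y * ip z z" if y: "y \<in> V" for y
  proof (cases "y = 0")
    case True
    then show ?thesis using lin_on_zero[OF bilin_left[OF \<beta> V_0] sub] V_0 by (simp add: ip_0_left)
  next
    case False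
    define c where "c = 1 / sqrt (ip y y)"
    have pos: "ip y y > 0" using False y by (simp add: ip_pos)
    have c: "c * (c * ip y y) = 1" using pos by (simp add: c_def field_simps)
    have cy: "c *\<^sub>R y \<in> V" using y by (rule V_scale)
    have "c *\<^sub>R y \<in> K" using y cy c by (simp add: K_def ip_scale_left ip_scale_right)
    then have "\<beta> z z \<le> \<beta> (c *\<^sub>R y) (c *\<^sub>R y)" by (rule le)
    also have "\<dots> = c * (c * \<beta> y y)"
      using lin_on_scale[OF bilin_left[OF \<beta> cy] y, of c] lin_on_scale[OF bilin_right[OF \<beta> y] y, of c] by simp
    finally have "\<beta> z z * ip y y \<le> c * (c * \<beta> y y) * ip y y" using pos by (simp add: mult_right_mono)
    also have "\<dots> = \<beta> y y * (c * (c * ip y y))" by (simp add: mult_ac)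
    finally show ?thesis using c z1 by simp
  qed
  moreover have "z \<noteq> 0" using z1 ip_0_left[OF V_0] by auto
  ultimately show ?thesis using zV by blast
qed

text \<open>
  A minimiser \<open>x\<close> of the Rayleigh quotient is an eigenvector: the derivative at \<open>x\<close> vanishes in every
  direction \<open>y\<close>.
\<close>

lemma symmetric_min_eigenvector:
  assumes f: "endomorphism_on V f" and sym: "\<And>x y. x \<in> V \<Longrightarrow> y \<in> V \<Longrightarrow> ip (f x) y = ip x (f y)"
    and ne: "V \<noteq> {0}"
  shows "\<exists>\<mu>. \<exists>x\<in>V. x \<noteq> 0 \<and> f x = \<mu> *\<^sub>R x \<and> (\<forall>y\<in>V. \<mu> * ip y y \<le> ip (f y) y)"
proof -
  have \<beta>: "bilin_on V (\<lambda>x y. ip (f x) y)"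
    using f by (intro bilin_onI lin_onI)
      (simp_all add: endomorphism_on_def ip_add_left ip_scale_left ip_add_right ip_scale_right)
  obtain x where x: "x \<in> V" "x \<noteq> 0" "\<And>y. y \<in> V \<Longrightarrow> ip (f x) x * ip y y \<le> ip (f y) y * ip x x"
    using form_attains_min[OF \<beta> ne] by blast
  define \<mu> where "\<mu> = ip (f x) x / ip x x"
  have pos: "ip x x > 0" using x by (simp add: ip_pos)
  have min: "\<mu> * ip y y \<le> ip (f y) y" if "y \<in> V" for y
    using x(3)[OF that] pos by (simp add: \<mu>_def field_simps)
  have "f x = \<mu> *\<^sub>R x"
  proof (rule ip_eqI)
    fix y assume y: "y \<in> V"
    have fV: "f x \<in> V" "f y \<in> V" using f x y by (auto intro: endo_in)
    have "2 * (ip (f x) y - \<mu> * ip x y) * t + (ip (f y) y - \<mu> * ip y y) * t\<^sup>2 \<ge> 0" for t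
    proof -
      have ty: "t *\<^sub>R y \<in> V" "x + t *\<^sub>R y \<in> V" "t *\<^sub>R f y \<in> V" using x y fV by (auto intro: V_scale V_add)
      have feq: "f (x + t *\<^sub>R y) = f x + t *\<^sub>R f y"
        using f x y ty by (simp add: endomorphism_on_def)
      have "ip (f (x + t *\<^sub>R y)) (x + t *\<^sub>R y) = ip (f x) x + t * ip (f x) y + t * ip (f y) x + t\<^sup>2 * ip (f y) y"
        unfolding feq using x y ty fV
        by (simp add: ip_add_left ip_add_right ip_scale_left ip_scale_right power2_eq_square algebra_simps)
      moreover have "ip (f y) x = ip (f x) y" using sym[of y x] x y fV ip_commute by simp
      moreover have "ip (x + t *\<^sub>R y) (x + t *\<^sub>R y) = ip x x + 2 * t * ip x y + t\<^sup>2 * ip y y"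
        using x y ty ip_commute[of y x]
        by (simp add: ip_add_left ip_add_right ip_scale_left ip_scale_right power2_eq_square algebra_simps)
      moreover have "\<mu> * ip x x = ip (f x) x" using pos by (simp add: \<mu>_def)
      ultimately show ?thesis using min[OF ty(2)] by (simp add: algebra_simps)
    qed
    then have "2 * (ip (f x) y - \<mu> * ip x y) = 0" by (rule linear_term_zero)
    then show "ip (f x) y = ip (\<mu> *\<^sub>R x) y" using x y by (simp add: ip_scale_left)
  qed (use x f in \<open>auto intro: endo_in V_scale\<close>)
  then show ?thesis using x min by blast
qed

end

context euclid begin

lemma adj_adj: 
  assumes f: "endomorphism_on V f" and x: "x \<in> V" shows "adj (adj f) x = f x"
  using f x by (intro adj_eqI adj_endo) (simp_all add: endo_in adj_left)

lemma normal_norm_adj: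
  assumes f: "endomorphism_on V f" and n: "normal_on V ip f" and x: "x \<in> V"
  shows "ip (adj f x) (adj f x) = ip (f x) (f x)"
proof -
  have "ip (f x) (f x) = ip x (adj f (f x))" using f x by (simp add: adj_right endo_in)
  also have "\<dots> = ip x (f (adj f x))" using n x by (simp add: normal_on_def)
  also have "\<dots> = ip (adj f x) (adj f x)" using f x by (simp add: adj_left adj_in)
  finally show ?thesis ..
qed

text \<open>
  The least eigenvalue \<open>2\<mu>\<close> of \<open>S = f + f\<^sup>t\<close> has to be shown positive. By normality \<open>f\<close> commutes with \<open>S\<close> and
  preserves the eigenspace \<open>W\<close>, where \<open>T = f - \<mu>\<close> is skew. An eigenvector of the symmetric operator \<open>T\<^sup>2\<close>
  on \<open>W\<close> yields an eigenvalue of \<open>T\<close> of the form \<open>\<i>s\<close>, hence an eigenvalue of \<open>f\<close> with real part \<open>\<mu>\<close>.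
\<close>

lemma normal_coercive:
  assumes f: "endomorphism_on V f" and n: "normal_on V ip f"
    and ev: "\<And>c. complex_eigenvalue_on V f c \<Longrightarrow> Re c > 0"
  shows "\<exists>\<mu>>0. \<forall>x\<in>V. \<mu> * ip x x \<le> ip (f x) x"
proof (cases "V = {0}")
  case True
  then show ?thesis using lin_on_zero[OF endo_lin[OF f] sub] ip_0_left V_0 by (intro exI[of _ 1]) simp
next
  case False
  obtain E where "orthonormal_basis V ip E" using onb_exists by blast
  then interpret onb V ip E by unfold_locales
  define S where "S = (\<lambda>x. f x + adj f x)"
  have af: "endomorphism_on V (adj f)" using f by (rule adj_endo)
  have S: "endomorphism_on V S" unfolding S_def using f af sub by (rule endo_add)
  have symS: "ip (S x) y = ip x (S y)" if "x \<in> V" "y \<in> V" for x y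
    using that f af by (simp add: S_def ip_add_left ip_add_right endo_in adj_left adj_right)
  obtain \<nu> x where \<nu>: "x \<in> V" "x \<noteq> 0" "S x = \<nu> *\<^sub>R x" "\<And>y. y \<in> V \<Longrightarrow> \<nu> * ip y y \<le> ip (S y) y"
    using symmetric_min_eigenvector[OF S symS False] by blast
  define \<mu> where "\<mu> = \<nu> / 2"
  define W where "W = {x \<in> V. S x = \<nu> *\<^sub>R x}"
  have WV: "W \<subseteq> V" by (auto simp: W_def)
  have W: "subspace W"
    using S V_0 V_add V_scale lin_on_zero[OF endo_lin[OF S] sub]
    by (auto simp: W_def subspace_def endomorphism_on_def scaleR_add_right)
  interpret W: euclid W ip using euclid_axioms W WV by (rule euclid_subspace)
  obtain EW where "orthonormal_basis W ip EW" using W.onb_exists by blast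
  then interpret W: onb W ip EW by unfold_locales
  have fW: "f x \<in> W" if "x \<in> W" for x
  proof -
    have xV: "x \<in> V" and Sx: "S x = \<nu> *\<^sub>R x" using that by (auto simp: W_def)
    have "S (f x) = f (S x)"
      using n xV f endo_in[OF f xV] adj_in[OF f xV] by (simp add: S_def normal_on_def endomorphism_on_def)
    then show ?thesis using Sx xV f by (simp add: W_def endomorphism_on_def)
  qed
  define T where "T = (\<lambda>x. f x - \<mu> *\<^sub>R x)"
  have T: "endomorphism_on W T"
    unfolding T_def using f fW WV W
    by (intro endo_diff) (auto simp: endomorphism_on_def subset_iff subspace_scale scaleR_add_right)
  have skew: "ip (T x) y = - ip x (T y)" if "x \<in> W" "y \<in> W" for x y
  proof -
    have V: "x \<in> V" "y \<in> V" "f x \<in> V" "f y \<in> V" using that WV fW by auto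
    have "ip (T x) y = ip x (adj f y) - \<mu> * ip x y"
      using V f by (simp add: T_def ip_diff_left V_scale ip_scale_left adj_right)
    moreover have "adj f y = \<nu> *\<^sub>R y - f y" using that by (simp add: W_def S_def algebra_simps)
    ultimately show ?thesis using V
      by (simp add: T_def ip_diff_right V_scale ip_scale_right \<mu>_def)
  qed
  have TT: "endomorphism_on W (\<lambda>x. T (T x))" using T T by (rule endo_comp)
  have symTT: "ip (T (T x)) y = ip x (T (T y))" if "x \<in> W" "y \<in> W" for x y
    using skew[of "T x" y] skew[of x "T y"] that T by (simp add: endo_in)
  have "W \<noteq> {0}" using \<nu> by (auto simp: W_def)
  then obtain \<kappa> w where w: "w \<in> W" "w \<noteq> 0" "T (T w) = \<kappa> *\<^sub>R w"
    using W.symmetric_min_eigenvector[OF TT symTT] by blast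
  have TwW: "T w \<in> W" using T w by (rule_tac endo_in)
  have "\<kappa> * ip w w = - ip (T w) (T w)"
    using skew[OF TwW w(1)] w by (simp add: W.ip_scale_left)
  then have "\<kappa> * ip w w \<le> 0" using W.ip_ge0[OF TwW] by simp
  then have \<kappa>: "\<kappa> \<le> 0" using W.ip_pos[OF w(1,2)] by (simp add: mult_le_0_iff)
  have fT: "f x = T x + \<mu> *\<^sub>R x" for x by (simp add: T_def)
  have "\<mu> > 0"
  proof (cases "T w = 0")
    case True
    have f0: "f 0 = 0" using lin_on_zero[OF endo_lin[OF f] sub] .
    have "complex_eigenvalue_on V f (complex_of_real \<mu>)"
      unfolding complex_eigenvalue_on_def
      using w WV True V_0 f0
      by (intro bexI[of _ "(w, 0)"]) (auto simp: complex_scale_def fT[of w] zero_prod_def)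
    then show ?thesis using ev by fastforce
  next
    case False
    \<comment> \<open>With \<open>T\<^sup>2 w = - s\<^sup>2 w\<close>, the vector \<open>s w - \<i> T w\<close> satisfies \<open>T v = \<i> s v\<close>; it is nonzero as \<open>T w \<noteq> 0\<close>.\<close>
    define s where "s = sqrt (- \<kappa>)"
    have s: "s * s = - \<kappa>" using \<kappa> by (simp add: s_def)
    have TwV: "T w \<in> V" "w \<in> V" using TwW w WV by auto
    have "complex_eigenvalue_on V f (Complex \<mu> s)"
      unfolding complex_eigenvalue_on_def
    proof (intro bexI[of _ "(s *\<^sub>R w, - T w)"] conjI)
      have "f (s *\<^sub>R w) = \<mu> *\<^sub>R s *\<^sub>R w + s *\<^sub>R T w"
        using f TwV fT[of w] by (simp add: endomorphism_on_def scaleR_add_right)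
      moreover have "f (- T w) = s *\<^sub>R s *\<^sub>R w - \<mu> *\<^sub>R T w"
        using lin_on_minus[OF endo_lin[OF f] TwV(1)] fT[of "T w"] w(3) s by simp
      ultimately show "map_prod f f (s *\<^sub>R w, - T w) = complex_scale (Complex \<mu> s) (s *\<^sub>R w, - T w)"
        by (simp add: complex_scale_def)
    qed (use False TwV in \<open>auto intro: V_scale V_neg simp: zero_prod_def\<close>)
    then show ?thesis using ev by fastforce
  qed
  moreover have "\<mu> * ip y y \<le> ip (f y) y" if y: "y \<in> V" for y
  proof -
    have "ip (adj f y) y = ip (f y) y" using f y ip_commute[of y "f y"] by (simp add: adj_left endo_in)
    then have "ip (S y) y = 2 * ip (f y) y" using f y af by (simp add: S_def ip_add_left endo_in)
    then show ?thesis using \<nu>(4)[OF y] by (simp add: \<mu>_def)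
  qed
  ultimately show ?thesis by blast
qed

lemma skew_imaginary:
  assumes skew: "\<And>x. x \<in> V \<Longrightarrow> ip (f x) x = 0" 
    and sym: "\<And>x y. x \<in> V \<Longrightarrow> y \<in> V \<Longrightarrow> ip (f x) y = - ip x (f y)"
    and f: "endomorphism_on V f"
    and c: "complex_eigenvalue_on V f c"
  shows "Re c = 0"
proof -
  obtain u v where uv: "u \<in> V" "v \<in> V" "(u, v) \<noteq> 0" and
    eq: "f u = Re c *\<^sub>R u - Im c *\<^sub>R v" "f v = Im c *\<^sub>R u + Re c *\<^sub>R v"
    using c unfolding complex_eigenvalue_on_def complex_scale_def by auto
  have "0 = Re c * ip u u - Im c * ip v u"
    using skew[OF uv(1)] uv unfolding eq by (simp add: ip_diff_left ip_scale_left V_scale)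
  moreover have "0 = Im c * ip u v + Re c * ip v v"
    using skew[OF uv(2)] uv unfolding eq by (simp add: ip_add_left ip_scale_left V_scale)
  ultimately have "Re c * (ip u u + ip v v) = 0"
    using ip_commute[OF uv(1,2)] by (simp add: algebra_simps)
  moreover have "ip u u + ip v v > 0"
    using uv ip_pos[of u] ip_pos[of v] ip_ge0[of u] ip_ge0[of v] by (auto simp: zero_prod_def)
  ultimately show ?thesis by simp
qed

section \<open>Invariant subspaces and traces\<close>

lemma orthogonal_projection:
  assumes W: "subspace W" "W \<subseteq> V"
  obtains \<pi> where "lin_on V \<pi>" "\<And>x. x \<in> V \<Longrightarrow> \<pi> x \<in> W" "\<And>x. x \<in> W \<Longrightarrow> \<pi> x = x"
    "\<And>x w. x \<in> V \<Longrightarrow> w \<in> W \<Longrightarrow> ip (x - \<pi> x) w = 0"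
proof -
  interpret W: euclid W ip using euclid_axioms W by (rule euclid_subspace)
  obtain EW where EW: "orthonormal_basis W ip EW" using W.onb_exists by blast
  then interpret W: onb W ip EW by unfold_locales
  define \<pi> where "\<pi> x = (\<Sum>w\<in>EW. ip x w *\<^sub>R w)" for x
  have EV: "w \<in> V" if "w \<in> EW" for w using W.EV[OF that] W(2) by blast
  have \<pi>W: "\<pi> x \<in> W" for x unfolding \<pi>_def by (intro W.V_sum W.V_scale W.EV)
  show ?thesis
  proof
    show "lin_on V \<pi>"
      using EV by (intro lin_onI)
        (simp_all add: \<pi>_def ip_add_left ip_scale_left scaleR_add_left sum.distrib scaleR_sum_right)
    show "\<pi> x \<in> W" for x by (rule \<pi>W)
    show "\<pi> x = x" if "x \<in> W" for x unfolding \<pi>_def using that by (rule W.expand)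
    fix x w assume x: "x \<in> V" and w: "w \<in> W"
    have pV: "\<pi> x \<in> V" using \<pi>W W(2) by blast
    have "ip (x - \<pi> x) v = 0" if "v \<in> EW" for v
      using W.ip_comb[OF that, of "ip x"] x pV EV[OF that] unfolding \<pi>_def[symmetric]
      by (simp add: ip_diff_left)
    moreover have "lin_on W (ip (x - \<pi> x))"
      using ip_lin_right[OF V_diff[OF x pV]] W(2) by (auto simp: lin_on_def subset_iff)
    ultimately show "ip (x - \<pi> x) w = 0" using W.lin_expand[of "ip (x - \<pi> x)" w] w by simp
  qed
qed

text \<open>
  For a normal \<open>f\<close> the sums of \<open>|f u|\<^sup>2\<close> and of \<open>|f\<^sup>t u|\<^sup>2\<close> over an orthonormal basis of \<open>W\<close> agree. The components
  inside \<open>W\<close> contribute equally to both, since they form a matrix and its transpose. As \<open>f\<close> has no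
  component outside \<open>W\<close>, neither has \<open>f\<^sup>t\<close>.
\<close>

lemma normal_adj_invariant:
  assumes f: "endomorphism_on V f" and n: "normal_on V ip f"
    and W: "subspace W" "W \<subseteq> V" and inv: "\<And>w. w \<in> W \<Longrightarrow> f w \<in> W" and w: "w \<in> W"
  shows "adj f w \<in> W"
proof -
  interpret W: euclid W ip using euclid_axioms W by (rule euclid_subspace)
  obtain EW where EW: "orthonormal_basis W ip EW" using W.onb_exists by blast
  then interpret W: onb W ip EW by unfold_locales
  have EWV: "u \<in> V" if "u \<in> EW" for u using W.EV[OF that] W(2) by blast
  have "orthonormal ip EW" using EW by (simp add: W.orthonormal_basis_iff)
  then obtain E where E: "EW \<subseteq> E" "orthonormal_basis V ip E" using onb_extend EWV by blast
  then interpret onb V ip E by unfold_locales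
  have af: "endomorphism_on V (adj f)" using f by (rule adj_endo)
  have 1: "(\<Sum>u\<in>EW. ip (f u) (f u)) = (\<Sum>u\<in>EW. \<Sum>v\<in>EW. (ip (f u) v)\<^sup>2)"
    using W.parseval inv W.EV by (intro sum.cong refl) (simp only: power2_eq_square)
  have "(\<Sum>u\<in>EW. ip (adj f u) (adj f u)) = (\<Sum>u\<in>EW. \<Sum>v\<in>E. (ip (adj f u) v)\<^sup>2)"
    using parseval EWV endo_in[OF af] by (intro sum.cong refl) (simp only: power2_eq_square)
  also have "\<dots> = (\<Sum>u\<in>EW. (\<Sum>v\<in>EW. (ip (adj f u) v)\<^sup>2) + (\<Sum>v\<in>E-EW. (ip (adj f u) v)\<^sup>2))"
    using E(1) finE by (intro sum.cong refl) (simp add: sum.subset_diff[of EW E])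
  also have "\<dots> = (\<Sum>u\<in>EW. \<Sum>v\<in>EW. (ip (adj f u) v)\<^sup>2) + (\<Sum>u\<in>EW. \<Sum>v\<in>E-EW. (ip (adj f u) v)\<^sup>2)"
    by (simp add: sum.distrib)
  also have "(\<Sum>u\<in>EW. \<Sum>v\<in>EW. (ip (adj f u) v)\<^sup>2) = (\<Sum>u\<in>EW. \<Sum>v\<in>EW. (ip (f v) u)\<^sup>2)"
  proof (intro sum.cong refl)
    fix u v assume "u \<in> EW" "v \<in> EW"
    then have V: "u \<in> V" "v \<in> V" by (simp_all add: EWV)
    show "(ip (adj f u) v)\<^sup>2 = (ip (f v) u)\<^sup>2" 
      using adj_left[OF f V] ip_commute[OF V(1) endo_in[OF f V(2)]] by simp
  qed
  also have "\<dots> = (\<Sum>u\<in>EW. \<Sum>v\<in>EW. (ip (f u) v)\<^sup>2)" by (rule sum.swap)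
  finally have "(\<Sum>u\<in>EW. \<Sum>v\<in>E-EW. (ip (adj f u) v)\<^sup>2) = 0"
    using 1 normal_norm_adj[OF f n] EWV by simp
  then have "\<forall>u\<in>EW. (\<Sum>v\<in>E-EW. (ip (adj f u) v)\<^sup>2) = 0"
    using W.finE by (subst (asm) sum_nonneg_eq_0_iff) (auto intro: sum_nonneg)
  then have z: "ip (adj f u) v = 0" if "u \<in> EW" "v \<in> E - EW" for u v
    using that finE by (subst (asm) sum_nonneg_eq_0_iff) auto
  have "adj f u \<in> W" if u: "u \<in> EW" for u
  proof -
    have "(\<Sum>v\<in>E. ip (adj f u) v *\<^sub>R v) = (\<Sum>v\<in>EW. ip (adj f u) v *\<^sub>R v) + (\<Sum>v\<in>E-EW. ip (adj f u) v *\<^sub>R v)"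
      using E(1) finE by (simp add: sum.subset_diff[of EW E])
    also have "(\<Sum>v\<in>E-EW. ip (adj f u) v *\<^sub>R v) = 0" using z[OF u] by (intro sum.neutral) simp
    finally have "adj f u = (\<Sum>v\<in>EW. ip (adj f u) v *\<^sub>R v)"
      using expand[OF endo_in[OF af EWV[OF u]]] by simp
    moreover have "(\<Sum>v\<in>EW. ip (adj f u) v *\<^sub>R v) \<in> W" by (intro W.V_sum W.V_scale W.EV)
    ultimately show ?thesis by simp
  qed
  moreover have "lin_on W (adj f)" using endo_lin[OF af] W(2) by (auto simp: lin_on_def subset_iff)
  ultimately show ?thesis
    using W.lin_expand[of "adj f" w] w W.V_sum[of EW "\<lambda>u. ip w u *\<^sub>R adj f u"] W.V_scale by simp
qed

lemma trace_into_subspace: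
  assumes f: "endomorphism_on V f" and W: "subspace W" "W \<subseteq> V" and inv: "\<And>v. v \<in> V \<Longrightarrow> f v \<in> W"
  shows "trace_on V f = trace_on W f"
proof -
  interpret W: euclid W ip using euclid_axioms W by (rule euclid_subspace)
  obtain EW where EW: "orthonormal_basis W ip EW" using W.onb_exists by blast
  then interpret W: onb W ip EW by unfold_locales
  have EWV: "u \<in> V" if "u \<in> EW" for u using W.EV[OF that] W(2) by blast
  have "orthonormal ip EW" using EW by (simp add: W.orthonormal_basis_iff)
  then obtain E where E: "EW \<subseteq> E" "orthonormal_basis V ip E" using onb_extend EWV by blast
  then interpret onb V ip E by unfold_locales
  have fW: "endomorphism_on W f" using f inv W(2) by (auto simp: endomorphism_on_def subset_iff)
  have z: "ip (f e) e = 0" if e: "e \<in> E - EW" for e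
  proof -
    have eV: "e \<in> V" using e EV by blast
    have "lin_on W (\<lambda>x. ip x e)" using ip_lin_left[OF eV] W(2) by (auto simp: lin_on_def subset_iff)
    moreover have "ip u e = 0" if "u \<in> EW" for u using that e E(1) by (subst ip_E) auto
    ultimately show ?thesis using W.lin_expand[of "\<lambda>x. ip x e" "f e"] inv[OF eV] by simp
  qed
  have "trace_on V f = (\<Sum>e\<in>E. ip (f e) e)" using f by (rule trace_endo)
  also have "\<dots> = (\<Sum>e\<in>EW. ip (f e) e)" using z E(1) finE by (intro sum.mono_neutral_right) auto
  also have "\<dots> = trace_on W f" using fW by (simp add: W.trace_endo)
  finally show ?thesis .
qed

lemma trace_nilpotent:
  assumes f: "endomorphism_on V f"
    and C: "\<And>i. subspace (C i)" "C 0 = V" "\<And>i. C (Suc i) \<subseteq> C i" "C m = {0}"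
    and fC: "\<And>i x. x \<in> C i \<Longrightarrow> f x \<in> C (Suc i)"
  shows "trace_on V f = 0"
proof -
  have CV: "C i \<subseteq> V" for i using C(2,3) by (induction i) auto
  have *: "trace_on V f = trace_on (C i) f" for i
  proof (induction i)
    case 0
    then show ?case using C(2) by simp
  next
    case (Suc i)
    interpret Ci: euclid "C i" ip using euclid_axioms C(1) CV by (rule euclid_subspace)
    have "endomorphism_on (C i) f" using f CV[of i] fC[of _ i] C(3)[of i]
      by (auto simp: endomorphism_on_def subset_iff)
    then have "trace_on (C i) f = trace_on (C (Suc i)) f"
      using C fC by (intro Ci.trace_into_subspace) auto
    then show ?case using Suc by simp
  qed
  interpret C: euclid "{0}" ip using euclid_subspace[OF euclid_axioms C(1)[of m] CV[of m]] C(4) by simp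
  obtain E where "orthonormal_basis {0} ip E" using C.onb_exists by blast
  then interpret C: onb "{0}" ip E by unfold_locales
  have f0: "f 0 = 0" using lin_on_zero[OF endo_lin[OF f] sub] .
  then have "trace_on {0} f = (\<Sum>e\<in>E. ip (f e) e)"
    by (intro C.trace_endo) (auto simp: endomorphism_on_def)
  also have "\<dots> = 0"
  proof (intro sum.neutral ballI)
    fix e assume "e \<in> E"
    then show "ip (f e) e = 0" using C.EV[of e] f0 C.ip_0_left[of 0] by simp
  qed
  finally show ?thesis using *[of m] C(4) by simp
qed

end

section \<open>The Hilbert-Schmidt product\<close>

context onb begin

text \<open>
  The inner product \<open>tr (f\<^sup>t g)\<close> of operators.
\<close>

definition hs :: "('a \<Rightarrow> 'a) \<Rightarrow> ('a \<Rightarrow> 'a) \<Rightarrow> real" where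
  "hs f g = (\<Sum>u\<in>E. ip (f u) (g u))"

lemma hs_cong: "(\<And>x. x \<in> V \<Longrightarrow> f x = f' x) \<Longrightarrow> (\<And>x. x \<in> V \<Longrightarrow> g x = g' x) \<Longrightarrow> hs f g = hs f' g'"
  unfolding hs_def by (rule sum.cong[OF refl]) (simp add: EV)

lemma hs_commute: 
  assumes "endomorphism_on V f" "endomorphism_on V g" shows "hs f g = hs g f"
  unfolding hs_def by (intro sum.cong refl ip_commute endo_in[OF assms(1)] endo_in[OF assms(2)] EV)

lemma hs_diff_left:
  assumes "endomorphism_on V f" "endomorphism_on V g" "endomorphism_on V h"
  shows "hs (\<lambda>x. f x - g x) h = hs f h - hs g h"
  unfolding hs_def using assms EV by (simp add: ip_diff_left endo_in sum_subtractf)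

lemma hs_diff_right:
  assumes "endomorphism_on V f" "endomorphism_on V g" "endomorphism_on V h"
  shows "hs h (\<lambda>x. f x - g x) = hs h f - hs h g"
  unfolding hs_def using assms EV by (simp add: ip_diff_right endo_in sum_subtractf)

lemma hs_scale_left:
  assumes "endomorphism_on V f" "endomorphism_on V h" shows "hs (\<lambda>x. c *\<^sub>R f x) h = c * hs f h"
  unfolding hs_def using assms EV by (simp add: ip_scale_left endo_in sum_distrib_left)

lemma hs_scale_right:
  assumes "endomorphism_on V f" "endomorphism_on V h" shows "hs h (\<lambda>x. c *\<^sub>R f x) = c * hs h f"
  unfolding hs_def using assms EV by (simp add: ip_scale_right endo_in sum_distrib_left)

lemma hs_sums_left:
  assumes "\<And>i. i \<in> I \<Longrightarrow> endomorphism_on V (f i)" "endomorphism_on V h"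
  shows "hs (\<lambda>x. \<Sum>i\<in>I. c i *\<^sub>R f i x) h = (\<Sum>i\<in>I. c i * hs (f i) h)"
proof -
  have "ip (\<Sum>i\<in>I. c i *\<^sub>R f i u) (h u) = (\<Sum>i\<in>I. c i * ip (f i u) (h u))" if "u \<in> E" for u
    using assms EV[OF that] by (intro ip_sums_left) (auto simp: endo_in)
  then have "hs (\<lambda>x. \<Sum>i\<in>I. c i *\<^sub>R f i x) h = (\<Sum>u\<in>E. \<Sum>i\<in>I. c i * ip (f i u) (h u))"
    unfolding hs_def by (rule sum.cong[OF refl])
  also have "\<dots> = (\<Sum>i\<in>I. \<Sum>u\<in>E. c i * ip (f i u) (h u))" by (rule sum.swap)
  finally show ?thesis by (simp add: hs_def sum_distrib_left)
qed

lemma hs_sums_right: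
  assumes "\<And>i. i \<in> I \<Longrightarrow> endomorphism_on V (f i)" "endomorphism_on V h"
  shows "hs h (\<lambda>x. \<Sum>i\<in>I. c i *\<^sub>R f i x) = (\<Sum>i\<in>I. c i * hs h (f i))"
proof -
  have e: "endomorphism_on V (\<lambda>x. \<Sum>i\<in>I. c i *\<^sub>R f i x)"
    by (intro endo_sum endo_scale assms sub)
  have "hs h (\<lambda>x. \<Sum>i\<in>I. c i *\<^sub>R f i x) = (\<Sum>i\<in>I. c i * hs (f i) h)"
    unfolding hs_commute[OF assms(2) e] by (rule hs_sums_left[OF assms])
  also have "\<dots> = (\<Sum>i\<in>I. c i * hs h (f i))"
    by (intro sum.cong refl) (simp add: hs_commute[OF assms(1) assms(2)])
  finally show ?thesis .
qed

lemma hs_nonneg: "endomorphism_on V f \<Longrightarrow> hs f f \<ge> 0"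
  unfolding hs_def by (rule sum_nonneg) (simp add: ip_ge0 endo_in EV)

lemma hs_self_zero:
  assumes f: "endomorphism_on V f" and z: "hs f f = 0" and x: "x \<in> V" shows "f x = 0"
proof -
  have "\<forall>u\<in>E. ip (f u) (f u) = 0"
    using z finE unfolding hs_def by (subst (asm) sum_nonneg_eq_0_iff) (auto intro: ip_ge0 endo_in[OF f] EV)
  then have "f u = 0" if "u \<in> E" for u using ip_self_0[OF endo_in[OF f EV[OF that]]] that by simp
  then show ?thesis using lin_expand[OF endo_lin[OF f] x] by simp
qed

lemma hs_comp_left:
  assumes "endomorphism_on V A" "endomorphism_on V f" "endomorphism_on V g"
  shows "hs (\<lambda>x. A (f x)) g = hs f (\<lambda>x. adj A (g x))"
  unfolding hs_def using assms EV by (intro sum.cong refl) (simp add: adj_right endo_in)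

lemma hs_comp_right:
  assumes A: "endomorphism_on V A" and f: "endomorphism_on V f" and g: "endomorphism_on V g"
  shows "hs (\<lambda>x. f (A x)) g = hs f (\<lambda>x. g (adj A x))"
proof -
  have aA: "endomorphism_on V (adj A)" using A by (rule adj_endo)
  have "hs (\<lambda>x. f (A x)) g = (\<Sum>u\<in>E. \<Sum>w\<in>E. ip (A u) w * ip (f w) (g u))"
    unfolding hs_def
  proof (rule sum.cong[OF refl])
    fix u assume u: "u \<in> E"
    have "lin_on V (\<lambda>x. ip (f x) (g u))" using f endo_in[OF g EV[OF u]]
      by (intro lin_onI) (simp_all add: endomorphism_on_def ip_add_left ip_scale_left)
    from lin_expand[OF this endo_in[OF A EV[OF u]]]
    show "ip (f (A u)) (g u) = (\<Sum>w\<in>E. ip (A u) w * ip (f w) (g u))" by simp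
  qed
  also have "\<dots> = (\<Sum>w\<in>E. \<Sum>u\<in>E. ip (A u) w * ip (f w) (g u))" by (rule sum.swap)
  also have "\<dots> = (\<Sum>w\<in>E. \<Sum>u\<in>E. ip (adj A w) u * ip (f w) (g u))"
  proof (intro sum.cong refl)
    fix u w assume "w \<in> E" "u \<in> E"
    then have V: "u \<in> V" "w \<in> V" by (simp_all add: EV)
    show "ip (A u) w * ip (f w) (g u) = ip (adj A w) u * ip (f w) (g u)"
      using adj_right[OF A V(2,1)] ip_commute[OF V(1) adj_in[OF A V(2)]] by simp
  qed
  also have "\<dots> = hs f (\<lambda>x. g (adj A x))"
    unfolding hs_def
  proof (rule sum.cong[OF refl])
    fix w assume w: "w \<in> E"
    have "lin_on V (\<lambda>x. ip (f w) (g x))" using g endo_in[OF f EV[OF w]]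
      by (intro lin_onI) (simp_all add: endomorphism_on_def ip_add_right ip_scale_right)
    from lin_expand[OF this endo_in[OF aA EV[OF w]]]
    show "(\<Sum>u\<in>E. ip (adj A w) u * ip (f w) (g u)) = ip (f w) (g (adj A w))" by simp
  qed
  finally show ?thesis .
qed

lemma endo_id: "endomorphism_on V (\<lambda>x. x)" by (simp add: endomorphism_on_def)

lemma hs_adj:
  assumes f: "endomorphism_on V f" and g: "endomorphism_on V g"
  shows "hs (adj f) (adj g) = hs f g"
proof -
  have af: "endomorphism_on V (adj f)" "endomorphism_on V (adj g)" using f g by (auto intro: adj_endo)
  have "hs (adj f) (adj g) = hs (\<lambda>x. x) (\<lambda>x. adj (adj f) (adj g x))"
    using hs_comp_left[OF af(1) endo_id af(2)] .
  also have "\<dots> = hs (\<lambda>x. x) (\<lambda>x. f (adj g x))"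
    using f endo_in[OF af(2)] by (intro hs_cong) (simp_all add: adj_adj)
  also have "\<dots> = hs g f" using hs_comp_right[OF g endo_id f] by simp
  finally show ?thesis using hs_commute[OF f g] by simp
qed

definition commutator :: "('a \<Rightarrow> 'a) \<Rightarrow> ('a \<Rightarrow> 'a) \<Rightarrow> 'a \<Rightarrow> 'a" where
  "commutator A f = (\<lambda>x. A (f x) - f (A x))"

lemma commutator_endo:
  assumes "endomorphism_on V A" "endomorphism_on V f" shows "endomorphism_on V (commutator A f)"
  unfolding commutator_def by (rule endo_diff[OF endo_comp[OF assms] endo_comp[OF assms(2,1)] sub])

lemma hs_commutator:
  assumes A: "endomorphism_on V A" and f: "endomorphism_on V f" and g: "endomorphism_on V g"
  shows "hs (commutator A f) g = hs f (commutator (adj A) g)"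
proof -
  have aA: "endomorphism_on V (adj A)" using A by (rule adj_endo)
  show ?thesis unfolding commutator_def
    using hs_diff_left[OF endo_comp[OF A f] endo_comp[OF f A] g]
      hs_diff_right[OF endo_comp[OF aA g] endo_comp[OF g aA] f]
      hs_comp_left[OF A f g] hs_comp_right[OF A f g] by simp
qed

lemma hs_commutator_self:
  assumes A: "endomorphism_on V A" and f: "endomorphism_on V f"
  shows "hs (commutator A f) (commutator A f) = hs (\<lambda>x. A (f x)) (\<lambda>x. A (f x))
    - 2 * hs (\<lambda>x. A (f x)) (\<lambda>x. f (A x)) + hs (\<lambda>x. f (A x)) (\<lambda>x. f (A x))"
proof -
  note e = endo_comp[OF A f] endo_comp[OF f A]
  show ?thesis unfolding commutator_def
    using hs_diff_left[OF e endo_diff[OF e sub]] hs_diff_right[OF e e(1)] hs_diff_right[OF e e(2)]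
      hs_commute[OF e] by simp
qed

text \<open>
  The hypothesis says that \<open>\<Sum> [\<phi>\<^sub>g, \<phi>\<^sub>g\<^sup>t] = 0\<close>. Expand \<open>|[A, \<phi>]|\<^sup>2 = |A \<phi>|\<^sup>2 - 2 \<langle>A \<phi>, \<phi> A\<rangle> + |\<phi> A|\<^sup>2\<close>. The middle
  term is the same for \<open>A\<close> and \<open>A\<^sup>t\<close>. The hypothesis at \<open>z = A\<^sup>t w\<close>, summed over an orthonormal basis of
  vectors \<open>w\<close>, turns \<open>\<Sum> |A \<phi>|\<^sup>2\<close> into \<open>\<Sum> |\<phi> A\<^sup>t|\<^sup>2\<close>, so that the outer terms for \<open>A\<close> and \<open>A\<^sup>t\<close> are exchanged.
\<close>

lemma moment_zero_commutator:
  assumes \<phi>: "\<And>g. g \<in> G \<Longrightarrow> endomorphism_on V (\<phi> g)" and A: "endomorphism_on V A"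
    and mom: "\<And>z. z \<in> V \<Longrightarrow> (\<Sum>g\<in>G. ip (\<phi> g z) (\<phi> g z)) = (\<Sum>g\<in>G. ip (adj (\<phi> g) z) (adj (\<phi> g) z))"
  shows "(\<Sum>g\<in>G. hs (commutator A (\<phi> g)) (commutator A (\<phi> g))) = (\<Sum>g\<in>G. hs (commutator (adj A) (\<phi> g)) (commutator (adj A) (\<phi> g)))"
proof -
  have aA: "endomorphism_on V (adj A)" using A by (rule adj_endo)
  have cross: "hs (\<lambda>x. A (f x)) (\<lambda>x. f (A x)) = hs (\<lambda>x. adj A (f x)) (\<lambda>x. f (adj A x))"
    if f: "endomorphism_on V f" for f
  proof -
    have "hs (\<lambda>x. A (f x)) (\<lambda>x. f (A x)) = hs f (\<lambda>x. adj A (f (A x)))"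
      by (rule hs_comp_left[OF A f endo_comp[OF f A]])
    also have "\<dots> = hs f (\<lambda>x. adj A (f (adj (adj A) x)))"
      using A by (intro hs_cong) (simp_all add: adj_adj)
    also have "\<dots> = hs (\<lambda>x. f (adj A x)) (\<lambda>x. adj A (f x))"
      using hs_comp_right[OF aA f endo_comp[OF aA f]] by simp
    finally show ?thesis using hs_commute[OF endo_comp[OF f aA] endo_comp[OF aA f]] by simp
  qed
  have sq: "(\<Sum>g\<in>G. hs (\<lambda>x. B (\<phi> g x)) (\<lambda>x. B (\<phi> g x))) = (\<Sum>g\<in>G. hs (\<lambda>x. \<phi> g (adj B x)) (\<lambda>x. \<phi> g (adj B x)))"
    if B: "endomorphism_on V B" for B
  proof -
    have aB: "endomorphism_on V (adj B)" using B by (rule adj_endo)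
    have "(\<Sum>g\<in>G. hs (\<lambda>x. B (\<phi> g x)) (\<lambda>x. B (\<phi> g x)))
        = (\<Sum>g\<in>G. hs (\<lambda>x. adj (\<phi> g) (adj B x)) (\<lambda>x. adj (\<phi> g) (adj B x)))"
    proof (rule sum.cong[OF refl])
      fix g assume "g \<in> G"
      then have f: "endomorphism_on V (\<phi> g)" by (rule \<phi>)
      have "adj (\<lambda>x. B (\<phi> g x)) x = adj (\<phi> g) (adj B x)" if "x \<in> V" for x
        using that f B by (intro adj_eqI[OF endo_comp[OF B f]]) (simp_all add: adj_in adj_right endo_in)
      then show "hs (\<lambda>x. B (\<phi> g x)) (\<lambda>x. B (\<phi> g x))
          = hs (\<lambda>x. adj (\<phi> g) (adj B x)) (\<lambda>x. adj (\<phi> g) (adj B x))"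
        unfolding hs_adj[OF endo_comp[OF B f] endo_comp[OF B f], symmetric] by (intro hs_cong)
    qed
    also have "\<dots> = (\<Sum>u\<in>E. \<Sum>g\<in>G. ip (adj (\<phi> g) (adj B u)) (adj (\<phi> g) (adj B u)))"
      unfolding hs_def by (rule sum.swap)
    also have "\<dots> = (\<Sum>u\<in>E. \<Sum>g\<in>G. ip (\<phi> g (adj B u)) (\<phi> g (adj B u)))"
      by (intro sum.cong refl mom[symmetric] endo_in[OF aB] EV)
    also have "\<dots> = (\<Sum>g\<in>G. hs (\<lambda>x. \<phi> g (adj B x)) (\<lambda>x. \<phi> g (adj B x)))"
      unfolding hs_def by (rule sum.swap)
    finally show ?thesis .
  qed
  have sq': "(\<Sum>g\<in>G. hs (\<lambda>x. adj A (\<phi> g x)) (\<lambda>x. adj A (\<phi> g x))) = (\<Sum>g\<in>G. hs (\<lambda>x. \<phi> g (A x)) (\<lambda>x. \<phi> g (A x)))"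
    unfolding sq[OF aA] using A by (intro sum.cong refl hs_cong) (simp_all add: adj_adj)
  show ?thesis
    using sq[OF A] sq' cross[OF \<phi>] \<phi>
    by (simp add: hs_commutator_self A aA sum.distrib sum_subtractf)
qed

end

lemma basis_inner_product:
  fixes B :: "'a::real_vector set"
  assumes B: "finite B" "independent B" "span B = V"
  shows "onb V (\<lambda>x y. \<Sum>b\<in>B. representation B x b * representation B y b) B"
proof -
  have rep: "representation B (x + y) b = representation B x b + representation B y b"
    "representation B (c *\<^sub>R x) b = c * representation B x b" if "x \<in> V" "y \<in> V" for x y b c
    using that B by (simp_all add: representation_add representation_scale)
  interpret euclid V "\<lambda>x y. \<Sum>b\<in>B. representation B x b * representation B y b"
  proof
    fix x assume x: "x \<in> V" "x \<noteq> 0"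
    have "\<exists>b\<in>B. representation B x b \<noteq> 0"
    proof (rule ccontr)
      assume "\<not> ?thesis"
      then have "(\<Sum>b\<in>B. representation B x b *\<^sub>R b) = 0" by simp
      then show False using sum_representation_eq[OF B(2) _ B(1) order_refl, of x] x B(3) by simp
    qed
    then show "0 < (\<Sum>b\<in>B. representation B x b * representation B x b)"
      using B(1) by (auto intro!: sum_pos2 simp: zero_less_mult_iff)
  qed (use B in \<open>auto simp: rep sum.distrib sum_distrib_left algebra_simps intro: findimI\<close>)
  show ?thesis
  proof
    show "orthonormal_basis V (\<lambda>x y. \<Sum>b\<in>B. representation B x b * representation B y b) B"
      unfolding orthonormal_basis_def
    proof (intro conjI ballI B)
      fix x y assume "x \<in> B" "y \<in> B"
      then show "(\<Sum>b\<in>B. representation B x b * representation B y b) = (if x = y then 1 else 0)"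
        using B(1,2) by (simp add: representation_basis if_distrib[of "\<lambda>x. _ * x"] cong: if_cong)
    qed
  qed
qed

section \<open>Adapted inner products\<close>

lemma (in lie_algebra) lin_on_derived_zero:
  assumes f: "lin_on L f" and z: "\<And>y z. y \<in> K \<Longrightarrow> z \<in> K \<Longrightarrow> f (br y z) = 0" and K: "K \<subseteq> L"
    and x: "x \<in> span {br y z | y z. y \<in> K \<and> z \<in> K}"
  shows "f x = 0"
proof -
  have "x \<in> L \<and> f x = 0"
    using x
  proof (induction rule: span_induct_alt)
    case base
    then show ?case using lin_on_zero[OF f subspace_carrier] subspace_0[OF subspace_carrier] by simp
  next
    case (step c x y)
    then obtain p q where x: "x = br p q" "p \<in> K" "q \<in> K" by blast
    have xL: "x \<in> L" "c *\<^sub>R x \<in> L"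
      using br_closed[OF subsetD[OF K x(2)] subsetD[OF K x(3)]] subspace_scale[OF subspace_carrier]
      by (simp_all add: x(1))
    show ?case
      using lin_on_add[OF f xL(2), of y] lin_on_scale[OF f xL(1), of c] step xL z[OF x(2,3)]
      by (simp add: subspace_add[OF subspace_carrier] x(1))
  qed
  then show ?thesis by simp
qed

definition lie_module :: "'a::real_vector set \<Rightarrow> ('a \<Rightarrow> 'a \<Rightarrow> 'a) \<Rightarrow> 'b::real_vector set \<Rightarrow> ('a \<Rightarrow> 'b \<Rightarrow> 'b) \<Rightarrow> bool" where
  "lie_module h br V \<rho> \<longleftrightarrow> (\<forall>x\<in>h. endomorphism_on V (\<rho> x)) \<and> (\<forall>v\<in>V. lin_on h (\<lambda>x. \<rho> x v)) \<and>
     (\<forall>x\<in>h. \<forall>y\<in>h. \<forall>v\<in>V. \<rho> (br x y) v = \<rho> x (\<rho> y v) - \<rho> y (\<rho> x v))"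

text \<open>
  The situation of \<open>h = a + r\<close> with a Cartan decomposition \<open>r = k + p\<close>, in terms of signs and matrices.
  \<open>parity x e\<close> stands for \<open>x \<in> k\<close> if \<open>e = -1\<close> and for \<open>x \<in> p\<close> if \<open>e = 1\<close>; thus \<open>e\<close> is the sign with which \<open>x\<close>
  should act as a skew or symmetric operator. The model for \<open>G\<close> is an orthonormal basis of \<open>r\<close> for the
  Cartan inner product, made of vectors in \<open>k\<close> and \<open>p\<close>, together with a basis of \<open>a\<close>. In this basis
  \<open>ad x\<close> has a skew or symmetric matrix, which is \<open>parity_matrix\<close>.
\<close>

locale reductive = lie_algebra h br for h :: "'a::real_vector set" and br +
  fixes a :: "'a set" and parity :: "'a \<Rightarrow> real \<Rightarrow> bool" and G :: "'a set"
  assumes a_sub: "A \<in> a \<Longrightarrow> A \<in> h"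
    and a_central: "A \<in> a \<Longrightarrow> x \<in> h \<Longrightarrow> br A x = 0"
    and parity_carrier: "parity x e \<Longrightarrow> x \<in> h"
    and parity_sq: "parity x e \<Longrightarrow> e * e = 1"
    and parity_derived: "parity x e \<Longrightarrow> x \<in> span {br y z | y z. y \<in> h \<and> z \<in> h}"
    and finite_G: "finite G" and span_G: "span G = h"
    and G_cases: "g \<in> G \<Longrightarrow> g \<in> a \<or> (\<exists>e. parity g e)"
    and parity_matrix: "parity x e \<Longrightarrow> \<exists>s. (\<forall>g\<in>G. br x g = (\<Sum>g'\<in>G. s g g' *\<^sub>R g')) \<and>
          (\<forall>g\<in>G. \<forall>g'\<in>G. s g g' = e * s g' g)"
begin

lemma G_h: "g \<in> G \<Longrightarrow> g \<in> h" using span_G span_superset by auto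

definition adapted :: "'b::real_vector set \<Rightarrow> ('a \<Rightarrow> 'b \<Rightarrow> 'b) \<Rightarrow> ('b \<Rightarrow> 'b \<Rightarrow> real) \<Rightarrow> bool" where
  "adapted V \<rho> P \<longleftrightarrow> inner_product_on V P \<and>
     (\<forall>x e. parity x e \<longrightarrow> (\<forall>u\<in>V. \<forall>v\<in>V. P (\<rho> x u) v = e * P u (\<rho> x v))) \<and>
     (\<forall>A\<in>a. normal_on V P (\<rho> A))"

lemma lin_on_span_G_zero:
  assumes "lin_on h f" "\<And>g. g \<in> G \<Longrightarrow> f g = 0" "x \<in> h" shows "f x = 0"
proof -
  obtain c where "x = (\<Sum>g\<in>G. c g *\<^sub>R g)"
    using assms(3) span_finite[OF finite_G] span_G by auto
  then show ?thesis
    using lin_on_sum_scale[OF assms(1) subspace_carrier, of G "\<lambda>g. g" c] G_h assms(2) by simp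
qed

end

locale reductive_module = reductive h br a parity G for h :: "'a::real_vector set" and br a parity G +
  fixes V :: "'b::real_vector set" and \<rho> :: "'a \<Rightarrow> 'b \<Rightarrow> 'b"
  assumes module: "lie_module h br V \<rho>"
begin

lemma \<rho>_endo: "x \<in> h \<Longrightarrow> endomorphism_on V (\<rho> x)"
  and \<rho>_lin: "v \<in> V \<Longrightarrow> lin_on h (\<lambda>x. \<rho> x v)"
  and \<rho>_br: "x \<in> h \<Longrightarrow> y \<in> h \<Longrightarrow> v \<in> V \<Longrightarrow> \<rho> (br x y) v = \<rho> x (\<rho> y v) - \<rho> y (\<rho> x v)"
  using module by (simp_all add: lie_module_def)

lemma \<rho>_in: "x \<in> h \<Longrightarrow> v \<in> V \<Longrightarrow> \<rho> x v \<in> V"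
  using \<rho>_endo by (rule endo_in)

lemma \<rho>_sums: "v \<in> V \<Longrightarrow> \<rho> (\<Sum>g\<in>G. c g *\<^sub>R g) v = (\<Sum>g\<in>G. c g *\<^sub>R \<rho> g v)"
  using lin_on_sum_scale[OF \<rho>_lin subspace_carrier, of v G "\<lambda>g. g" c] G_h by simp

lemma invariant_span_G:
  assumes W: "subspace W" "W \<subseteq> V" and inv: "\<And>g w. g \<in> G \<Longrightarrow> w \<in> W \<Longrightarrow> \<rho> g w \<in> W"
    and x: "x \<in> h" and w: "w \<in> W"
  shows "\<rho> x w \<in> W"
proof -
  obtain c where c: "x = (\<Sum>g\<in>G. c g *\<^sub>R g)"
    using x span_finite[OF finite_G] span_G by auto
  have "w \<in> V" using w W(2) by blast
  from \<rho>_sums[OF this] show ?thesis unfolding c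
    using subspace_sum[OF W(1), of G "\<lambda>g. c g *\<^sub>R \<rho> g w"] subspace_scale[OF W(1)] inv[OF _ w] by simp
qed

text \<open>
  For \<open>x\<close> of parity \<open>e\<close> and \<open>A = \<rho> x\<close> the three sums of \<open>|[A, \<rho> g]|\<^sup>2\<close>, of \<open>|[A\<^sup>t, \<rho> g]|\<^sup>2\<close> and of
  \<open>e \<langle>[A, \<rho> g], [A\<^sup>t, \<rho> g]\<rangle>\<close> over \<open>g \<in> G\<close> agree: the first two because the moment map vanishes, and the last
  because \<open>\<langle>[A, \<rho> g], [A\<^sup>t, \<rho> g]\<rangle> = \<langle>[A, [A, \<rho> g]], \<rho> g\<rangle>\<close>, where \<open>[A, \<rho> g] = \<rho> [x, g]\<close> is governed by the skew or
  symmetric matrix of \<open>ad x\<close>. Therefore \<open>T = A - e A\<^sup>t\<close> commutes with the whole module. As \<open>A\<close> is a sum of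
  commutators, \<open>tr (A T) = 0\<close>, and \<open>|T|\<^sup>2\<close> is a multiple of this trace. For \<open>B \<in> a\<close> all commutators \<open>[\<rho> B, \<rho> g]\<close>
  vanish, hence so do all \<open>[(\<rho> B)\<^sup>t, \<rho> g]\<close>, and \<open>\<rho> B\<close> is normal.
\<close>

theorem moment_zero_adapted:
  assumes P: "onb V P E"
    and mom: "\<And>z. z \<in> V \<Longrightarrow>
      (\<Sum>g\<in>G. P (\<rho> g z) (\<rho> g z)) = (\<Sum>g\<in>G. P (adjoint_on V P (\<rho> g) z) (adjoint_on V P (\<rho> g) z))"
  shows "adapted V \<rho> P"
proof -
  interpret onb V P E by fact
  have eG: "endomorphism_on V (\<rho> g)" if "g \<in> G" for g using that by (intro \<rho>_endo G_h)
  note mz = moment_zero_commutator[of G \<rho>, OF eG _ mom]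
  have commute_all: "T (\<rho> y v) = \<rho> y (T v)"
    if T: "endomorphism_on V T" and z: "(\<Sum>g\<in>G. hs (commutator T (\<rho> g)) (commutator T (\<rho> g))) = 0"
      and y: "y \<in> h" and v: "v \<in> V" for T y v
  proof -
    have "\<forall>g\<in>G. hs (commutator T (\<rho> g)) (commutator T (\<rho> g)) = 0"
      using z finite_G by (subst (asm) sum_nonneg_eq_0_iff) (auto intro: hs_nonneg commutator_endo T eG)
    then have "commutator T (\<rho> g) v = 0" if "g \<in> G" for g
      using hs_self_zero[OF commutator_endo[OF T eG[OF that]] _ v] that by simp
    then have "T (\<rho> g v) - \<rho> g (T v) = 0" if "g \<in> G" for g using that by (simp add: commutator_def)
    moreover have "lin_on h (\<lambda>y. T (\<rho> y v) - \<rho> y (T v))"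
      using \<rho>_lin[OF v] \<rho>_lin[OF endo_in[OF T v]] T v \<rho>_in
      by (intro lin_onI) (simp_all add: lin_on_def endomorphism_on_def scaleR_diff_right)
    ultimately show ?thesis using lin_on_span_G_zero[of "\<lambda>y. T (\<rho> y v) - \<rho> y (T v)" y] y by simp
  qed
  have par: "P (\<rho> x u) v = e * P u (\<rho> x v)" if x: "parity x e" and u: "u \<in> V" and v: "v \<in> V" for x e u v
  proof -
    have xh: "x \<in> h" using x by (rule parity_carrier)
    have ee: "e * e = 1" using x by (rule parity_sq)
    define A where "A = \<rho> x"
    have A: "endomorphism_on V A" unfolding A_def using xh by (rule \<rho>_endo)
    have aA: "endomorphism_on V (adj A)" using A by (rule adj_endo)
    obtain s where s: "\<And>g. g \<in> G \<Longrightarrow> br x g = (\<Sum>g'\<in>G. s g g' *\<^sub>R g')"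
      "\<And>g g'. g \<in> G \<Longrightarrow> g' \<in> G \<Longrightarrow> s g g' = e * s g' g"
      using parity_matrix[OF x] by blast
    have cmA: "commutator A (\<rho> g) v = (\<Sum>g'\<in>G. s g g' *\<^sub>R \<rho> g' v)" if "g \<in> G" "v \<in> V" for g v
      using \<rho>_br[OF xh G_h[OF that(1)] that(2)] s(1)[OF that(1)] \<rho>_sums[OF that(2)]
      by (simp add: commutator_def A_def)
    have cmcmA: "commutator A (commutator A (\<rho> g)) v = (\<Sum>g'\<in>G. s g g' *\<^sub>R commutator A (\<rho> g') v)" if "g \<in> G" "v \<in> V" for g v
    proof -
      have Av: "A v \<in> V" using A that(2) by (rule endo_in)
      have "commutator A (commutator A (\<rho> g)) v = A (\<Sum>g'\<in>G. s g g' *\<^sub>R \<rho> g' v) - (\<Sum>g'\<in>G. s g g' *\<^sub>R \<rho> g' (A v))"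
        using cmA[OF that] cmA[OF that(1) Av] by (simp only: commutator_def[of A "commutator A (\<rho> g)"])
      also have "A (\<Sum>g'\<in>G. s g g' *\<^sub>R \<rho> g' v) = (\<Sum>g'\<in>G. s g g' *\<^sub>R A (\<rho> g' v))"
        by (rule lin_on_sum_scale[OF endo_lin[OF A] sub]) (intro \<rho>_in G_h that)
      finally show ?thesis by (simp add: commutator_def scaleR_diff_right sum_subtractf)
    qed
    define S where "S = (\<Sum>g\<in>G. hs (commutator A (\<rho> g)) (commutator A (\<rho> g)))"
    have S2: "(\<Sum>g\<in>G. hs (commutator (adj A) (\<rho> g)) (commutator (adj A) (\<rho> g))) = S"
      unfolding S_def by (rule mz[OF _ A, symmetric])
    note ec = commutator_endo[OF A eG] and eac = commutator_endo[OF aA eG]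
    \<comment> \<open>Moving \<open>[A\<^sup>t, _]\<close> to the left makes it \<open>[A, [A, \<rho> g]]\<close>; the sign \<open>e\<close> comes from transposing the matrix \<open>s\<close>.\<close>
    have X: "(\<Sum>g\<in>G. hs (commutator A (\<rho> g)) (commutator (adj A) (\<rho> g))) = e * S"
    proof -
      have "(\<Sum>g\<in>G. hs (commutator A (\<rho> g)) (commutator (adj A) (\<rho> g))) = (\<Sum>g\<in>G. hs (commutator A (commutator A (\<rho> g))) (\<rho> g))"
        by (intro sum.cong refl hs_commutator[symmetric] A ec eG)
      also have "\<dots> = (\<Sum>g\<in>G. \<Sum>g'\<in>G. s g g' * hs (commutator A (\<rho> g')) (\<rho> g))"
      proof (rule sum.cong[OF refl])
        fix g assume g: "g \<in> G"
        have "hs (commutator A (commutator A (\<rho> g))) (\<rho> g) = hs (\<lambda>v. \<Sum>g'\<in>G. s g g' *\<^sub>R commutator A (\<rho> g') v) (\<rho> g)"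
          by (intro hs_cong cmcmA g refl)
        also have "\<dots> = (\<Sum>g'\<in>G. s g g' * hs (commutator A (\<rho> g')) (\<rho> g))" by (intro hs_sums_left ec eG g)
        finally show "hs (commutator A (commutator A (\<rho> g))) (\<rho> g) = (\<Sum>g'\<in>G. s g g' * hs (commutator A (\<rho> g')) (\<rho> g))" .
      qed
      also have "\<dots> = (\<Sum>g'\<in>G. \<Sum>g\<in>G. s g g' * hs (commutator A (\<rho> g')) (\<rho> g))" by (rule sum.swap)
      also have "\<dots> = (\<Sum>g'\<in>G. e * (\<Sum>g\<in>G. s g' g * hs (commutator A (\<rho> g')) (\<rho> g)))"
        unfolding sum_distrib_left using s(2) by (intro sum.cong refl) (metis mult.assoc)
      also have "\<dots> = (\<Sum>g'\<in>G. e * hs (commutator A (\<rho> g')) (commutator A (\<rho> g')))"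
      proof (rule sum.cong[OF refl])
        fix g' assume g: "g' \<in> G"
        have "hs (commutator A (\<rho> g')) (commutator A (\<rho> g')) = hs (commutator A (\<rho> g')) (\<lambda>v. \<Sum>g\<in>G. s g' g *\<^sub>R \<rho> g v)"
          by (intro hs_cong cmA g refl)
        also have "\<dots> = (\<Sum>g\<in>G. s g' g * hs (commutator A (\<rho> g')) (\<rho> g))" by (intro hs_sums_right ec eG g)
        finally show "e * (\<Sum>g\<in>G. s g' g * hs (commutator A (\<rho> g')) (\<rho> g)) = e * hs (commutator A (\<rho> g')) (commutator A (\<rho> g'))"
          by simp
      qed
      finally show ?thesis by (simp add: S_def sum_distrib_left)
    qed
    define T where "T = (\<lambda>v. A v - e *\<^sub>R adj A v)"
    have eaA: "endomorphism_on V (\<lambda>v. e *\<^sub>R adj A v)" using aA sub by (rule endo_scale)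
    have T: "endomorphism_on V T" unfolding T_def using A eaA sub by (rule endo_diff)
    have "hs (commutator T (\<rho> g)) (commutator T (\<rho> g)) = hs (commutator A (\<rho> g)) (commutator A (\<rho> g))
        - 2 * e * hs (commutator A (\<rho> g)) (commutator (adj A) (\<rho> g)) + hs (commutator (adj A) (\<rho> g)) (commutator (adj A) (\<rho> g))"
      if g: "g \<in> G" for g
    proof -
      let ?p = "commutator A (\<rho> g)" and ?q = "\<lambda>v. e *\<^sub>R commutator (adj A) (\<rho> g) v"
      have p: "endomorphism_on V ?p" using g by (rule ec)
      have q0: "endomorphism_on V (commutator (adj A) (\<rho> g))" using g by (rule eac)
      have q: "endomorphism_on V ?q" using q0 sub by (rule endo_scale)
      have "commutator T (\<rho> g) v = ?p v - ?q v" if "v \<in> V" for v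
        using lin_on_diff[OF endo_lin[OF eG[OF g]] sub, of "A v" "e *\<^sub>R adj A v"] that
          lin_on_scale[OF endo_lin[OF eG[OF g]], of "adj A v" e] A aA
        by (simp add: commutator_def T_def endo_in V_scale scaleR_diff_right)
      then have "hs (commutator T (\<rho> g)) (commutator T (\<rho> g)) = hs (\<lambda>v. ?p v - ?q v) (\<lambda>v. ?p v - ?q v)"
        by (intro hs_cong)
      also have "\<dots> = hs ?p ?p - hs ?p ?q - (hs ?q ?p - hs ?q ?q)"
        by (simp only: hs_diff_left[OF p q endo_diff[OF p q sub]] hs_diff_right[OF p q p] hs_diff_right[OF p q q])
      also have "hs ?q ?p = e * hs ?p (commutator (adj A) (\<rho> g))"
        using hs_scale_left[OF q0 p] hs_commute[OF q0 p] by simp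
      also have "hs ?p ?q = e * hs ?p (commutator (adj A) (\<rho> g))" by (rule hs_scale_right[OF q0 p])
      also have "hs ?q ?q = hs (commutator (adj A) (\<rho> g)) (commutator (adj A) (\<rho> g))"
        using hs_scale_left[OF q0 q] hs_scale_right[OF q0 q0] ee by (simp flip: mult.assoc)
      finally show ?thesis by simp
    qed
    then have "(\<Sum>g\<in>G. hs (commutator T (\<rho> g)) (commutator T (\<rho> g))) = S - 2 * e * (e * S) + S"
      by (simp add: sum.distrib sum_subtractf S2 X mult.assoc flip: S_def sum_distrib_left)
    then have "(\<Sum>g\<in>G. hs (commutator T (\<rho> g)) (commutator T (\<rho> g))) = 0"
      using ee by (simp flip: mult.assoc)
    note Tcomm = commute_all[OF T this]
    \<comment> \<open>As \<open>T\<close> commutes with the module, \<open>tr ([\<rho> y, \<rho> z] T)\<close> is the trace of a commutator.\<close>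
    have tau0: "trace_on V (\<lambda>v. \<rho> y (T v)) = 0" if "y \<in> span {br y z | y z. y \<in> h \<and> z \<in> h}" for y
    proof -
      have te: "trace_on V (\<lambda>v. \<rho> y (T v)) = (\<Sum>u\<in>E. P (\<rho> y (T u)) u)" if "y \<in> h" for y
        by (rule trace_endo[OF endo_comp[OF \<rho>_endo[OF that] T]])
      have taulin: "lin_on h (\<lambda>y. trace_on V (\<lambda>v. \<rho> y (T v)))"
      proof (rule lin_onI)
        fix y z assume yz: "y \<in> h" "z \<in> h"
        then have "y + z \<in> h" using subspace_carrier by (intro subspace_add)
        then show "trace_on V (\<lambda>v. \<rho> (y + z) (T v)) = trace_on V (\<lambda>v. \<rho> y (T v)) + trace_on V (\<lambda>v. \<rho> z (T v))"
          using yz T EV by (simp add: te lin_on_add[OF \<rho>_lin] endo_in ip_add_left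
            \<rho>_in sum.distrib)
      next
        fix c y assume y: "y \<in> h"
        then have "c *\<^sub>R y \<in> h" using subspace_carrier by (intro subspace_scale)
        then show "trace_on V (\<lambda>v. \<rho> (c *\<^sub>R y) (T v)) = c *\<^sub>R trace_on V (\<lambda>v. \<rho> y (T v))"
          using y T EV by (simp add: te lin_on_scale[OF \<rho>_lin] endo_in ip_scale_left
            \<rho>_in sum_distrib_left)
      qed
      have "trace_on V (\<lambda>v. \<rho> (br y z) (T v)) = 0" if yz: "y \<in> h" "z \<in> h" for y z
      proof -
        have e: "endomorphism_on V (\<rho> y)" "endomorphism_on V (\<rho> z)" using yz by (auto intro: \<rho>_endo)
        have "trace_on V (\<lambda>v. \<rho> (br y z) (T v))
            = (\<Sum>u\<in>E. P (\<rho> y (\<rho> z (T u))) u) - (\<Sum>u\<in>E. P (\<rho> z (T (\<rho> y u))) u)"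
          using yz T EV by (simp add: te br_closed \<rho>_br endo_in ip_diff_left Tcomm
            \<rho>_in sum_subtractf)
        also have "(\<Sum>u\<in>E. P (\<rho> y (\<rho> z (T u))) u) = trace_on V (\<lambda>u. \<rho> y (\<rho> z (T u)))"
          by (rule trace_endo[symmetric, OF endo_comp[OF e(1) endo_comp[OF e(2) T]]])
        also have "\<dots> = trace_on V (\<lambda>u. \<rho> z (T (\<rho> y u)))"
          by (rule trace_commute[OF e(1) endo_comp[OF e(2) T]])
        also have "(\<Sum>u\<in>E. P (\<rho> z (T (\<rho> y u))) u) = trace_on V (\<lambda>u. \<rho> z (T (\<rho> y u)))"
          by (rule trace_endo[symmetric, OF endo_comp[OF e(2) endo_comp[OF T e(1)]]])
        finally show ?thesis by simp
      qed
      from lin_on_derived_zero[OF taulin this order_refl that] show ?thesis .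
    qed
    have hTA': "hs T (adj A) = 0"
    proof -
      have "hs T (adj A) = (\<Sum>u\<in>E. P (\<rho> x (T u)) u)"
        unfolding hs_def using T A EV by (intro sum.cong refl) (simp add: adj_right endo_in A_def[symmetric])
      also have "\<dots> = trace_on V (\<lambda>u. \<rho> x (T u))"
        by (rule trace_endo[symmetric, OF endo_comp[OF \<rho>_endo[OF xh] T]])
      finally show ?thesis using tau0[OF parity_derived[OF x]] by simp
    qed
    have hTA: "hs T A = 0"
    proof -
      have "adj T v = (- e) *\<^sub>R T v" if v: "v \<in> V" for v
      proof (rule adj_eqI[OF T v V_scale[OF endo_in[OF T v]]])
        fix z assume z: "z \<in> V"
        have "P (T z) v = P z (adj A v) - e * P z (A v)"
          using z v A aA by (simp add: T_def ip_diff_left ip_scale_left endo_in V_scale adj_left adj_right)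
        moreover have "P z ((- e) *\<^sub>R T v) = - e * P z (A v) + (e * e) * P z (adj A v)"
          using z v A aA by (simp add: T_def ip_diff_right ip_scale_right endo_in V_scale V_diff ip_minus_right
            algebra_simps)
        ultimately show "P (T z) v = P z ((- e) *\<^sub>R T v)" using ee by simp
      qed
      then have "hs (adj T) (adj A) = hs (\<lambda>v. (- e) *\<^sub>R T v) (adj A)" by (intro hs_cong) simp_all
      then show ?thesis using hs_adj[OF T A] hs_scale_left[OF T aA, of "- e"] hTA' by simp
    qed
    have "hs T T = hs T A - hs T (\<lambda>v. e *\<^sub>R adj A v)"
      using hs_diff_right[OF A eaA T] by (simp add: T_def)
    also have "\<dots> = 0" using hTA hTA' hs_scale_right[OF aA T, of e] by simp
    finally have "T w = 0" if "w \<in> V" for w using hs_self_zero[OF T _ that] by simp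
    from this[OF v] have "e *\<^sub>R A v = (e * e) *\<^sub>R adj A v" by (simp add: T_def)
    then have "adj A v = e *\<^sub>R A v" using ee by simp
    then show ?thesis using adj_right[OF A v u] u v A by (simp add: A_def ip_scale_right endo_in)
  qed
  have nor: "normal_on V P (\<rho> B)" if B: "B \<in> a" for B
  proof -
    have Bh: "B \<in> h" using B by (rule a_sub)
    have A: "endomorphism_on V (\<rho> B)" using Bh by (rule \<rho>_endo)
    have "commutator (\<rho> B) (\<rho> g) v = 0" if g: "g \<in> G" and v: "v \<in> V" for g v
      using \<rho>_br[OF Bh G_h[OF g] v] a_central[OF B G_h[OF g]] lin_on_zero[OF \<rho>_lin[OF v] subspace_carrier]
      by (simp add: commutator_def)
    then have "(\<Sum>g\<in>G. hs (commutator (\<rho> B) (\<rho> g)) (commutator (\<rho> B) (\<rho> g))) = 0"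
      unfolding hs_def using EV V_0 by (intro sum.neutral ballI) (simp add: ip_0_left)
    then have "(\<Sum>g\<in>G. hs (commutator (adj (\<rho> B)) (\<rho> g)) (commutator (adj (\<rho> B)) (\<rho> g))) = 0"
      using mz[OF _ A] by simp
    from commute_all[OF adj_endo[OF A] this Bh]
    show ?thesis by (simp add: normal_on_def)
  qed
  show ?thesis unfolding adapted_def using par nor inner_product_on_axioms by blast
qed

end

section \<open>Minimal energy on an irreducible module\<close>

lemma card_eq_basis:
  fixes B :: "'a::real_vector set"
  assumes "finite B" "independent B" "finite S" "span S = span B" "card S \<le> card B"
  shows "independent S \<and> card S = card B"
proof -
  obtain C where C: "C \<subseteq> S" "independent C" "S \<subseteq> span C" by (rule maximal_independent_subset[of S])
  have finC: "finite C" using C(1) assms(3) by (rule finite_subset)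
  have "span C = span S"
    using C(1,3) span_mono[of C S] span_minimal[of S "span C"] by blast
  then have "card B = card C"
    using subspace_card_eq[OF assms(1,2) finC C(2)] assms(4) by simp
  then have "C = S" using C(1) assms(3,5) card_mono[OF assms(3) C(1)] by (intro card_subset_eq) auto
  then show ?thesis using C(2) \<open>card B = card C\<close> by simp
qed

text \<open>
  The product is the change of the energy when the squared length in one direction is multiplied by \<open>t\<close>;
  a minimum at \<open>t = 1\<close> balances the two terms.
\<close>

lemma critical_point_of_scaling:
  fixes \<alpha> \<beta> :: real
  assumes "\<alpha> \<ge> 0" "\<beta> \<ge> 0" and *: "\<And>t. t > 0 \<Longrightarrow> (t - 1) * (\<alpha> - \<beta> / t) \<ge> 0"
  shows "\<alpha> = \<beta>"
proof (cases "\<alpha> = 0")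
  case True
  then show ?thesis using *[of 2] assms(2) by simp
next
  case False
  \<comment> \<open>Halfway between \<open>1\<close> and the other zero \<open>\<beta> / \<alpha>\<close> the product is negative unless the zeros coincide.\<close>
  define t where "t = (1 + \<beta> / \<alpha>) / 2"
  have t: "t > 0" using assms(1,2) False by (simp add: t_def add_pos_nonneg)
  have a: "\<alpha> > 0" using assms(1) False by simp
  have "(t - 1) * (\<alpha> - \<beta> / t) * (t * \<alpha>) = - ((\<alpha> - \<beta>) / 2)\<^sup>2"
  proof -
    have "(t - 1) * (\<alpha> - \<beta> / t) * (t * \<alpha>) = ((t - 1) * \<alpha>) * ((\<alpha> - \<beta> / t) * t)"
      by (simp only: mult_ac)
    also have "(\<alpha> - \<beta> / t) * t = (\<alpha> - \<beta>) / 2"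
      using a t by (simp add: left_diff_distrib) (simp add: t_def field_simps)
    also have "(t - 1) * \<alpha> = - ((\<alpha> - \<beta>) / 2)" using a by (simp add: t_def field_simps)
    finally show ?thesis by (simp add: power2_eq_square)
  qed
  moreover have "0 \<le> t * \<alpha>" using t a by simp
  then have "(t - 1) * (\<alpha> - \<beta> / t) * (t * \<alpha>) \<ge> 0" by (rule mult_nonneg_nonneg[OF *[OF t]])
  ultimately show ?thesis by simp
qed

context onb begin

text \<open>
  The variation of the inner product used at a minimum of the energy: it has an explicit orthonormal
  basis, and the energy becomes a rational function of \<open>t\<close>.
\<close>

lemma stretched_inner_product:
  assumes z: "z \<in> E" and t: "t > 0"
  shows "onb V (\<lambda>x y. ip x y + (t - 1) * ip x z * ip y z) (insert ((1 / sqrt t) *\<^sub>R z) (E - {z}))"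
proof -
  define Q where "Q = (\<lambda>x y. ip x y + (t - 1) * ip x z * ip y z)"
  define w where "w = (1 / sqrt t) *\<^sub>R z"
  have zV: "z \<in> V" and zz: "ip z z = 1" using z by (simp_all add: EV ip_E)
  interpret Q: euclid V Q
  proof
    fix x assume x: "x \<in> V" "x \<noteq> 0"
    have xx: "ip x x > 0" using x by (rule ip_pos)
    have cs: "ip x z * ip x z \<le> ip x x" using cauchy_schwarz[OF x(1) zV] zz by (simp add: power2_eq_square)
    show "Q x x > 0"
    proof (cases "t \<ge> 1")
      case True
      then have "(t - 1) * (ip x z * ip x z) \<ge> 0" by simp
      then show ?thesis using xx by (simp add: Q_def mult.assoc)
    next
      case False
      then have "(1 - t) * (ip x z * ip x z) \<le> (1 - t) * ip x x" using cs by (intro mult_left_mono) auto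
      moreover have "t * ip x x > 0" using t xx by simp
      ultimately show ?thesis by (simp add: Q_def algebra_simps)
    qed
  qed (use zV findim in \<open>simp_all add: Q_def ip_commute ip_add_left ip_scale_left algebra_simps\<close>)
  have wV: "w \<in> V" unfolding w_def using zV by (rule V_scale)
  have st: "(1 / sqrt t) * (1 / sqrt t) = 1 / t" using t by simp
  have ww: "Q w w = 1"
  proof -
    have "ip w w = 1 / t" "ip w z = 1 / sqrt t"
      unfolding w_def using zV V_scale[OF zV] zz st by (simp_all add: ip_scale_left ip_scale_right)
    then have "Q w w = 1 / t + (t - 1) * (1 / t)" using st by (simp add: Q_def mult.assoc)
    then show ?thesis using t by (simp add: field_simps)
  qed
  have uz: "ip u z = 0" if "u \<in> E - {z}" for u using that z by (simp add: ip_E)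
  have uw: "Q u w = 0" if "u \<in> E - {z}" for u
    using that uz[OF that] zV EV by (simp add: Q_def w_def ip_scale_right)
  have uu: "Q u v = (if u = v then 1 else 0)" if "u \<in> E - {z}" "v \<in> E - {z}" for u v
    using that uz[OF that(1)] by (simp add: Q_def ip_E)
  have "w \<notin> E - {z}" using uw[of w] ww by auto
  have on: "\<forall>u\<in>insert w (E - {z}). \<forall>v\<in>insert w (E - {z}). Q u v = (if u = v then 1 else 0)"
  proof (intro ballI)
    fix u v assume uv: "u \<in> insert w (E - {z})" "v \<in> insert w (E - {z})"
    have wu: "Q w u = 0" if "u \<in> E - {z}" for u
      using uw[OF that] Q.ip_commute[OF wV, of u] that EV by simp
    show "Q u v = (if u = v then 1 else 0)"
      using uv ww uw uu wu \<open>w \<notin> E - {z}\<close> by (elim insertE) auto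
  qed
  have "span (insert w (E - {z})) = V"
  proof
    show "span (insert w (E - {z})) \<subseteq> V" using wV EV sub by (intro span_minimal) auto
    have "z = sqrt t *\<^sub>R w" using t by (simp add: w_def)
    moreover have "sqrt t *\<^sub>R w \<in> span (insert w (E - {z}))" by (intro span_scale span_base) simp
    ultimately have "z \<in> span (insert w (E - {z}))" by simp
    moreover have "u \<in> span (insert w (E - {z}))" if "u \<in> E - {z}" for u using that by (intro span_base) simp
    ultimately have "E \<subseteq> span (insert w (E - {z}))" by blast
    then show "V \<subseteq> span (insert w (E - {z}))" using span_minimal[OF _ subspace_span] spanE by metis
  qed
  then have "orthonormal_basis V Q (insert w (E - {z}))"
    unfolding orthonormal_basis_def using on finE by blast
  then have "onb V Q (insert w (E - {z}))" by unfold_locales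
  then show ?thesis unfolding Q_def w_def .
qed

end

context reductive_module begin

definition energy :: "('b \<Rightarrow> 'b \<Rightarrow> real) \<Rightarrow> 'b set \<Rightarrow> real" where
  "energy P E = (\<Sum>g\<in>G. \<Sum>u\<in>E. P (\<rho> g u) (\<rho> g u))"

text \<open>
  For a unit vector \<open>z\<close>, stretching the inner product along \<open>z\<close> multiplies the row of \<open>z\<close> in each matrix
  \<open>\<rho> g\<close> by a factor and divides the column of \<open>z\<close> by it. At a minimum the off-diagonal parts of the row
  and of the column have the same total norm; adding the diagonal entry gives the claim, as the row is
  \<open>(\<rho> g)\<^sup>t z\<close> and the column is \<open>(\<rho> g) z\<close>.
\<close>

lemma minimal_energy_moment_zero:
  assumes P: "onb V P E" and min: "\<And>P' E'. onb V P' E' \<Longrightarrow> energy P E \<le> energy P' E'"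
    and z: "z \<in> V"
  shows "(\<Sum>g\<in>G. P (\<rho> g z) (\<rho> g z)) = (\<Sum>g\<in>G. P (adjoint_on V P (\<rho> g) z) (adjoint_on V P (\<rho> g) z))"
proof -
  interpret onb V P E by fact
  have eG: "endomorphism_on V (\<rho> g)" if "g \<in> G" for g using that by (intro \<rho>_endo G_h)
  have inG: "\<rho> g x \<in> V" if "g \<in> G" "x \<in> V" for g x using eG[OF that(1)] that(2) by (rule endo_in)
  have unit: "(\<Sum>g\<in>G. P (\<rho> g z) (\<rho> g z)) = (\<Sum>g\<in>G. P (adj (\<rho> g) z) (adj (\<rho> g) z))"
    if zV: "z \<in> V" and zz: "P z z = 1" for z
  proof -
    have "orthonormal P {z}" using zz by (simp add: orthonormal_def)
    then obtain F where F: "z \<in> F" "orthonormal_basis V P F" using onb_extend[of "{z}"] zV by blast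
    interpret F: onb V P F using F(2) by unfold_locales
    have EF: "energy P F = energy P E"
    proof -
      have "(\<Sum>u\<in>F. P (\<rho> g u) (\<rho> g u)) = (\<Sum>u\<in>E. P (\<rho> g u) (\<rho> g u))" if "g \<in> G" for g
      proof (rule sum_onb_independent[OF _ F(2), of "\<lambda>x y. P (\<rho> g x) (\<rho> g y)"])
        show "bilin_on V (\<lambda>x y. P (\<rho> g x) (\<rho> g y))"
          using eG[OF that] inG[OF that] by (intro bilin_onI lin_onI)
            (simp_all add: endomorphism_on_def ip_add_left ip_scale_left ip_add_right ip_scale_right)
      qed
      then show ?thesis unfolding energy_def by (rule sum.cong[OF refl])
    qed
    define R where "R = (\<Sum>g\<in>G. \<Sum>u\<in>F-{z}. (P (\<rho> g u) z)\<^sup>2)"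
    define N where "N = (\<Sum>g\<in>G. P (\<rho> g z) (\<rho> g z))"
    define Q where "Q = (\<Sum>g\<in>G. (P (\<rho> g z) z)\<^sup>2)"
    \<comment> \<open>\<open>R\<close> and \<open>N - Q\<close> are the squared norms of row and column without the diagonal entry.\<close>
    have "R = N - Q"
    proof (rule critical_point_of_scaling)
      show "R \<ge> 0" unfolding R_def by (intro sum_nonneg) simp
      have "(P (\<rho> g z) z)\<^sup>2 \<le> P (\<rho> g z) (\<rho> g z)" if "g \<in> G" for g
        using cauchy_schwarz[OF inG[OF that zV] zV] zz by simp
      then show "N - Q \<ge> 0" unfolding N_def Q_def by (simp add: sum_mono)
      fix t :: real assume t: "t > 0"
      define P' where "P' = (\<lambda>x y. P x y + (t - 1) * P x z * P y z)"
      define w where "w = (1 / sqrt t) *\<^sub>R z"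
      have st: "(1 / sqrt t) * (1 / sqrt t) = 1 / t" using t by simp
      have onb': "onb V P' (insert w (F - {z}))"
        unfolding P'_def w_def by (rule F.stretched_inner_product[OF F(1) t])
      have wF: "w \<notin> F - {z}"
      proof
        assume w: "w \<in> F - {z}"
        then have "P w z = 0" using F(1) by (simp add: F.ip_E)
        moreover have "P w z = 1 / sqrt t" unfolding w_def using zV zz by (simp add: ip_scale_left)
        ultimately show False using t by simp
      qed
      have Pg: "P' (\<rho> g u) (\<rho> g u) = P (\<rho> g u) (\<rho> g u) + (t - 1) * (P (\<rho> g u) z)\<^sup>2" for g u
        by (simp add: P'_def power2_eq_square mult.assoc)
      have Pw: "P' (\<rho> g w) (\<rho> g w) = 1 / t * (P (\<rho> g z) (\<rho> g z) + (t - 1) * (P (\<rho> g z) z)\<^sup>2)"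
        if g: "g \<in> G" for g
      proof -
        interpret P': onb V P' "insert w (F - {z})" by (rule onb')
        have gz: "\<rho> g z \<in> V" by (rule inG[OF g zV])
        have "\<rho> g w = (1 / sqrt t) *\<^sub>R \<rho> g z"
          unfolding w_def by (rule lin_on_scale[OF endo_lin[OF eG[OF g]] zV])
        then have "P' (\<rho> g w) (\<rho> g w) = (1 / sqrt t) * ((1 / sqrt t) * P' (\<rho> g z) (\<rho> g z))"
          using P'.ip_scale_left[OF gz V_scale[OF gz]] P'.ip_scale_right[OF gz gz] by simp
        also have "\<dots> = 1 / t * P' (\<rho> g z) (\<rho> g z)" using st by (simp flip: mult.assoc)
        finally show ?thesis by (simp only: Pg)
      qed
      have fin: "finite (F - {z})" using F.finE by simp
      have "energy P' (insert w (F - {z})) = (\<Sum>g\<in>G. 1 / t * (P (\<rho> g z) (\<rho> g z) + (t - 1) * (P (\<rho> g z) z)\<^sup>2)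
          + (\<Sum>u\<in>F-{z}. P (\<rho> g u) (\<rho> g u) + (t - 1) * (P (\<rho> g u) z)\<^sup>2))"
        unfolding energy_def
      proof (rule sum.cong[OF refl])
        fix g assume g: "g \<in> G"
        show "(\<Sum>u\<in>insert w (F - {z}). P' (\<rho> g u) (\<rho> g u))
          = 1 / t * (P (\<rho> g z) (\<rho> g z) + (t - 1) * (P (\<rho> g z) z)\<^sup>2)
            + (\<Sum>u\<in>F-{z}. P (\<rho> g u) (\<rho> g u) + (t - 1) * (P (\<rho> g u) z)\<^sup>2)"
          unfolding sum.insert[OF fin wF] Pw[OF g] unfolding Pg ..
      qed
      also have "\<dots> = 1 / t * (N + (t - 1) * Q) + ((\<Sum>g\<in>G. \<Sum>u\<in>F-{z}. P (\<rho> g u) (\<rho> g u)) + (t - 1) * R)"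
        by (simp only: sum.distrib sum_distrib_left[symmetric] N_def Q_def R_def)
      finally have e': "energy P' (insert w (F - {z})) = \<dots>" .
      have "energy P F = (\<Sum>g\<in>G. P (\<rho> g z) (\<rho> g z) + (\<Sum>u\<in>F-{z}. P (\<rho> g u) (\<rho> g u)))"
        unfolding energy_def using F.finE F(1) by (intro sum.cong refl) (simp add: sum.remove)
      then have "energy P F = N + (\<Sum>g\<in>G. \<Sum>u\<in>F-{z}. P (\<rho> g u) (\<rho> g u))"
        by (simp add: sum.distrib N_def)
      then have "0 \<le> 1 / t * (N + (t - 1) * Q) + (t - 1) * R - N"
        using min[OF onb'] e' EF by simp
      also have "\<dots> = (t - 1) * (R - (N - Q) / t)" using t by (simp add: field_simps)
      finally show "(t - 1) * (R - (N - Q) / t) \<ge> 0" .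
    qed
    then have "N = (\<Sum>g\<in>G. (P (\<rho> g z) z)\<^sup>2 + (\<Sum>u\<in>F-{z}. (P (\<rho> g u) z)\<^sup>2))"
      by (simp add: R_def Q_def sum.distrib)
    also have "\<dots> = (\<Sum>g\<in>G. P (adj (\<rho> g) z) (adj (\<rho> g) z))"
    proof (rule sum.cong[OF refl])
      fix g assume g: "g \<in> G"
      have "P (adj (\<rho> g) z) (adj (\<rho> g) z) = (\<Sum>u\<in>F. P (adj (\<rho> g) z) u * P (adj (\<rho> g) z) u)"
        by (rule F.parseval) (intro adj_in eG g zV)+
      also have "\<dots> = (\<Sum>u\<in>F. (P (\<rho> g u) z)\<^sup>2)"
        using adj_left[OF eG[OF g] zV] ip_commute[OF zV] inG[OF g] F.EV
        by (intro sum.cong refl) (simp add: power2_eq_square)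
      also have "\<dots> = (P (\<rho> g z) z)\<^sup>2 + (\<Sum>u\<in>F-{z}. (P (\<rho> g u) z)\<^sup>2)"
        using F.finE F(1) by (rule sum.remove)
      finally show "(P (\<rho> g z) z)\<^sup>2 + (\<Sum>u\<in>F-{z}. (P (\<rho> g u) z)\<^sup>2) = P (adj (\<rho> g) z) (adj (\<rho> g) z)" ..
    qed
    finally show ?thesis by (simp add: N_def)
  qed
  show ?thesis
  proof (cases "z = 0")
    case True
    have "\<rho> g 0 = 0" "adj (\<rho> g) 0 = 0" if "g \<in> G" for g
      using lin_on_zero[OF endo_lin[OF eG[OF that]] sub] lin_on_zero[OF endo_lin[OF adj_endo[OF eG[OF that]]] sub]
      by simp_all
    then show ?thesis using True by simp
  next
    case False
    define c where "c = 1 / sqrt (P z z)"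
    have pos: "P z z > 0" using False z by (rule_tac ip_pos)
    have c0: "c \<noteq> 0" using pos by (simp add: c_def)
    have c: "c * (c * P z z) = 1" using pos by (simp add: c_def)
    have cV: "c *\<^sub>R z \<in> V" using z by (rule V_scale)
    have "P (c *\<^sub>R z) (c *\<^sub>R z) = 1" using c z cV by (simp add: ip_scale_left ip_scale_right)
    note u = unit[OF cV this]
    have sc: "P (f (c *\<^sub>R z)) (f (c *\<^sub>R z)) = (c * c) * P (f z) (f z)" if "endomorphism_on V f" for f
      using that z endo_in[OF that z] V_scale[OF endo_in[OF that z]]
      by (simp add: lin_on_scale[OF endo_lin[OF that]] ip_scale_left ip_scale_right)
    have "(c * c) * (\<Sum>g\<in>G. P (\<rho> g z) (\<rho> g z)) = (\<Sum>g\<in>G. P (\<rho> g (c *\<^sub>R z)) (\<rho> g (c *\<^sub>R z)))"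
      unfolding sum_distrib_left by (intro sum.cong refl) (simp add: sc eG)
    also have "\<dots> = (\<Sum>g\<in>G. P (adj (\<rho> g) (c *\<^sub>R z)) (adj (\<rho> g) (c *\<^sub>R z)))" by (rule u)
    also have "\<dots> = (c * c) * (\<Sum>g\<in>G. P (adj (\<rho> g) z) (adj (\<rho> g) z))"
      unfolding sum_distrib_left by (intro sum.cong refl) (simp add: sc adj_endo eG)
    finally show ?thesis using c0 by simp
  qed
qed

definition irreducible_module where
  "irreducible_module \<longleftrightarrow> (\<forall>W. subspace W \<and> W \<subseteq> V \<and> (\<forall>x\<in>h. \<forall>w\<in>W. \<rho> x w \<in> W) \<longrightarrow> W = {0} \<or> W = V)"

text \<open>
  Take orthonormal frames \<open>e\<^sub>k\<close> of a minimising sequence of inner products, scaled such that their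
  coordinates in a fixed basis have norm \<open>1\<close>, and the matrices \<open>\<sigma>\<^sub>k\<close> of the operators \<open>\<rho> g\<close> in these frames.
  The entries of \<open>\<sigma>\<^sub>k\<close> are bounded by the energy, and scaling a frame does not change them. A
  subsequence converges, and the relation \<open>\<rho> g (e b) = \<Sum> \<sigma> b b' e b'\<close> survives in the limit. So the limit
  frame spans a submodule, nonzero by the normalisation, hence all of \<open>V\<close> by irreducibility. It is
  therefore a basis, and the inner product for which it is orthonormal has the minimal energy.
\<close>

lemma minimal_energy_exists:
  assumes fd: "findim V" and ne: "V \<noteq> {0}" and irr: irreducible_module
  shows "\<exists>P E. onb V P E \<and> (\<forall>P' E'. onb V P' E' \<longrightarrow> energy P E \<le> energy P' E')"
proof -
  obtain B where B: "finite B" "independent B" "span B = V" using fd by (rule findim_basis)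
  define Q where "Q = (\<lambda>x y. \<Sum>b\<in>B. representation B x b * representation B y b)"
  interpret Q: onb V Q B unfolding Q_def using B by (rule basis_inner_product)
  have eG: "endomorphism_on V (\<rho> g)" if "g \<in> G" for g using that by (intro \<rho>_endo G_h)
  have inG: "\<rho> g x \<in> V" if "g \<in> G" "x \<in> V" for g x using eG[OF that(1)] that(2) by (rule endo_in)
  have e0: "energy P E \<ge> 0" if "onb V P E" for P E
  proof -
    interpret onb V P E by fact
    show ?thesis unfolding energy_def by (intro sum_nonneg ip_ge0 inG EV)
  qed
  define m where "m = Inf {energy P E | P E. onb V P E}"
  have bdd: "bdd_below {energy P E | P E. onb V P E}" using e0 by (intro bdd_belowI[of _ 0]) auto
  have "onb V Q B" by unfold_locales
  then have nonempty: "{energy P E | P E. onb V P E} \<noteq> {}" by blast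
  have "\<exists>P E. onb V P E \<and> energy P E < m + 1 / real (Suc k)" for k
  proof -
    have "m < m + 1 / real (Suc k)" by simp
    from cInf_lessD[OF nonempty this[unfolded m_def]] show ?thesis unfolding m_def by blast
  qed
  then obtain P E where PE: "\<And>k::nat. onb V (P k) (E k)" "\<And>k. energy (P k) (E k) < m + 1 / real (Suc k)"
    by metis
  have "\<exists>f. bij_betw f B (E k)" for k
  proof -
    interpret onb V "P k" "E k" by (rule PE(1))
    have "card B = card (E k)"
      using subspace_card_eq[OF B(1,2) finE indep] B(3) spanE by simp
    then show ?thesis using finite_same_card_bij[OF B(1) finE] by simp
  qed
  then obtain \<phi> where \<phi>: "\<And>k. bij_betw (\<phi> k) B (E k)" by metis
  have \<phi>E: "\<phi> k b \<in> E k" if "b \<in> B" for k b using \<phi>[of k] that by (auto simp: bij_betw_def)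
  have \<phi>V: "\<phi> k b \<in> V" if "b \<in> B" for k b
  proof -
    interpret onb V "P k" "E k" by (rule PE(1))
    show ?thesis using \<phi>E[OF that] by (rule EV)
  qed
  define N where "N k = sqrt (\<Sum>(b,b')\<in>B\<times>B. (Q (\<phi> k b) b')\<^sup>2)" for k
  obtain b0 where b0: "b0 \<in> B" using ne B(3) by (metis all_not_in_conv span_empty)
  have Npos: "N k > 0" for k
  proof -
    interpret onb V "P k" "E k" by (rule PE(1))
    have "\<phi> k b0 \<noteq> 0" using ip_E[OF \<phi>E[OF b0] \<phi>E[OF b0]] ip_0_left[OF V_0] by auto
    have "0 < Q (\<phi> k b0) (\<phi> k b0)" using \<phi>V[OF b0] \<open>\<phi> k b0 \<noteq> 0\<close> by (rule Q.ip_pos)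
    also have "\<dots> = (\<Sum>b'\<in>B. (Q (\<phi> k b0) b')\<^sup>2)"
      unfolding power2_eq_square by (rule Q.parseval[OF \<phi>V[OF b0] \<phi>V[OF b0]])
    also have "\<dots> \<le> (\<Sum>b\<in>B. \<Sum>b'\<in>B. (Q (\<phi> k b) b')\<^sup>2)"
      by (rule member_le_sum[OF b0 _ B(1), of "\<lambda>b. \<Sum>b'\<in>B. (Q (\<phi> k b) b')\<^sup>2"]) (simp add: sum_nonneg)
    finally show ?thesis by (simp add: N_def sum.cartesian_product)
  qed
  define e where "e k b = (1 / N k) *\<^sub>R \<phi> k b" for k b
  have eV: "e k b \<in> V" if "b \<in> B" for k b unfolding e_def using \<phi>V[OF that] by (rule Q.V_scale)
  define c where "c k b b' = Q (e k b) b'" for k b b'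
  define \<sigma> where "\<sigma> k g b b' = P k (\<rho> g (\<phi> k b)) (\<phi> k b')" for k g b b'
  have csum: "(\<Sum>(b,b')\<in>B\<times>B. (c k b b')\<^sup>2) = 1" for k
  proof -
    have "(\<Sum>(b,b')\<in>B\<times>B. (c k b b')\<^sup>2) = (\<Sum>(b,b')\<in>B\<times>B. (1 / N k)\<^sup>2 * (Q (\<phi> k b) b')\<^sup>2)"
      unfolding c_def e_def by (intro sum.cong refl) (auto simp: Q.ip_scale_left \<phi>V Q.EV power_mult_distrib power_divide)
    also have "\<dots> = (1 / N k)\<^sup>2 * (N k)\<^sup>2"
      by (simp add: case_prod_beta N_def sum_nonneg flip: sum_distrib_left)
    finally show ?thesis using Npos[of k] by (simp add: power_divide)
  qed
  have energy\<sigma>: "energy (P k) (E k) = (\<Sum>g\<in>G. \<Sum>b\<in>B. \<Sum>b'\<in>B. (\<sigma> k g b b')\<^sup>2)" for k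
  proof -
    interpret onb V "P k" "E k" by (rule PE(1))
    have "(\<Sum>u\<in>E k. P k (\<rho> g u) (\<rho> g u)) = (\<Sum>b\<in>B. \<Sum>b'\<in>B. (\<sigma> k g b b')\<^sup>2)" if g: "g \<in> G" for g
    proof -
      have "(\<Sum>u\<in>E k. P k (\<rho> g u) (\<rho> g u)) = (\<Sum>u\<in>E k. \<Sum>v\<in>E k. (P k (\<rho> g u) v)\<^sup>2)"
        unfolding power2_eq_square by (intro sum.cong refl parseval inG g EV)
      also have "\<dots> = (\<Sum>b\<in>B. \<Sum>v\<in>E k. (P k (\<rho> g (\<phi> k b)) v)\<^sup>2)"
        by (rule sum.reindex_bij_betw[OF \<phi>, symmetric])
      also have "\<dots> = (\<Sum>b\<in>B. \<Sum>b'\<in>B. (P k (\<rho> g (\<phi> k b)) (\<phi> k b'))\<^sup>2)"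
        by (intro sum.cong refl sum.reindex_bij_betw[OF \<phi>, symmetric])
      finally show ?thesis by (simp add: \<sigma>_def)
    qed
    then show ?thesis unfolding energy_def by (rule sum.cong[OF refl])
  qed
  have rel: "(\<Sum>b'\<in>B. \<sigma> k g b b' * c k b' d) = (\<Sum>b'\<in>B. c k b b' * Q (\<rho> g b') d)"
    if g: "g \<in> G" and b: "b \<in> B" and d: "d \<in> B" for k g b d
  proof -
    interpret onb V "P k" "E k" by (rule PE(1))
    have "\<rho> g (\<phi> k b) = (\<Sum>v\<in>E k. P k (\<rho> g (\<phi> k b)) v *\<^sub>R v)"
      by (rule expand[symmetric]) (rule inG[OF g \<phi>V[OF b]])
    also have "\<dots> = (\<Sum>b'\<in>B. \<sigma> k g b b' *\<^sub>R \<phi> k b')"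
      unfolding \<sigma>_def by (rule sum.reindex_bij_betw[OF \<phi>, symmetric])
    finally have "\<rho> g (e k b) = (\<Sum>b'\<in>B. \<sigma> k g b b' *\<^sub>R e k b')"
      unfolding e_def lin_on_scale[OF endo_lin[OF eG[OF g]] \<phi>V[OF b]]
      by (simp add: scaleR_sum_right mult.commute)
    then have "Q (\<rho> g (e k b)) d = (\<Sum>b'\<in>B. \<sigma> k g b b' * c k b' d)"
      unfolding c_def using eV Q.EV[OF d] by (simp only:) (rule Q.ip_sums_left)
    moreover have "Q (\<rho> g (e k b)) d = (\<Sum>b'\<in>B. c k b b' * Q (\<rho> g b') d)"
    proof -
      have "lin_on V (\<lambda>x. Q (\<rho> g x) d)" using eG[OF g] Q.EV[OF d]
        by (intro lin_onI) (simp_all add: endomorphism_on_def Q.ip_add_left Q.ip_scale_left)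
      from Q.lin_expand[OF this eV[OF b]] show ?thesis by (simp add: c_def)
    qed
    ultimately show ?thesis by simp
  qed
  \<comment> \<open>Frame coordinates (tag \<open>None\<close>) and matrix entries (tag \<open>Some g\<close>) as one bounded family.\<close>
  define u where "u k i = (case i of (None, b, b') \<Rightarrow> c k b b' | (Some g, b, b') \<Rightarrow> \<sigma> k g b b')" for k i
  define I where "I = (insert None (Some ` G)) \<times> (B \<times> B)"
  have finI: "finite I" using finite_G B(1) by (simp add: I_def)
  have bound: "\<bar>u k i\<bar> \<le> m + 2" if i: "i \<in> I" for k i
  proof -
    have m0: "m \<ge> 0" unfolding m_def using e0 nonempty by (intro cInf_greatest) auto
    have sq: "\<bar>x\<bar> \<le> m + 2" if "x\<^sup>2 \<le> m + 1" for x
    proof -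
      have "(m + 1) * 1 \<le> (m + 1) * (m + 1)" using m0 by (intro mult_left_mono) auto
      then have "x\<^sup>2 \<le> (m + 1)\<^sup>2" using that unfolding power2_eq_square by simp
      then have "\<bar>x\<bar> \<le> m + 1" using m0 by (metis abs_le_square_iff abs_of_nonneg add_nonneg_nonneg zero_le_one)
      then show ?thesis by simp
    qed
    obtain j b b' where i_eq: "i = (j, b, b')" and jb: "j \<in> insert None (Some ` G)" "b \<in> B" "b' \<in> B"
      using i by (auto simp: I_def)
    show ?thesis
    proof (cases j)
      case None
      have "(c k b b')\<^sup>2 \<le> (\<Sum>(b,b')\<in>B\<times>B. (c k b b')\<^sup>2)"
        using member_le_sum[of "(b,b')" "B \<times> B" "\<lambda>(b,b'). (c k b b')\<^sup>2"] jb B(1) by auto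
      then show ?thesis using csum[of k] m0 by (intro sq) (simp add: u_def i_eq None)
    next
      case (Some g)
      have g: "g \<in> G" using jb(1) Some by auto
      have "(\<sigma> k g b b')\<^sup>2 \<le> (\<Sum>b'\<in>B. (\<sigma> k g b b')\<^sup>2)"
        by (rule member_le_sum[OF jb(3) _ B(1), of "\<lambda>b'. (\<sigma> k g b b')\<^sup>2"]) simp
      also have "\<dots> \<le> (\<Sum>b\<in>B. \<Sum>b'\<in>B. (\<sigma> k g b b')\<^sup>2)"
        by (rule member_le_sum[OF jb(2) _ B(1), of "\<lambda>b. \<Sum>b'\<in>B. (\<sigma> k g b b')\<^sup>2"]) (simp add: sum_nonneg)
      also have "\<dots> \<le> (\<Sum>g\<in>G. \<Sum>b\<in>B. \<Sum>b'\<in>B. (\<sigma> k g b b')\<^sup>2)"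
        by (rule member_le_sum[OF g _ finite_G, of "\<lambda>g. \<Sum>b\<in>B. \<Sum>b'\<in>B. (\<sigma> k g b b')\<^sup>2"]) (simp add: sum_nonneg)
      also have "\<dots> \<le> m + 1 / real (Suc k)" using PE(2)[of k] energy\<sigma>[of k] by simp
      also have "\<dots> \<le> m + 1" by simp
      finally show ?thesis by (intro sq) (simp add: u_def i_eq Some)
    qed
  qed
  obtain r l where r: "strict_mono (r :: nat \<Rightarrow> nat)" "\<forall>i\<in>I. (\<lambda>k. u (r k) i) \<longlonglongrightarrow> l i"
    using convergent_subseq[OF finI, of u "m + 2"] bound by blast
  define c' where "c' b b' = l (None, b, b')" for b b'
  define \<sigma>' where "\<sigma>' g b b' = l (Some g, b, b')" for g b b'
  have limc: "(\<lambda>k. c (r k) b b') \<longlonglongrightarrow> c' b b'" if "b \<in> B" "b' \<in> B" for b b'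
    using r(2)[rule_format, of "(None, b, b')"] that by (simp add: I_def u_def c'_def)
  have lim\<sigma>: "(\<lambda>k. \<sigma> (r k) g b b') \<longlonglongrightarrow> \<sigma>' g b b'" if "g \<in> G" "b \<in> B" "b' \<in> B" for g b b'
    using r(2)[rule_format, of "(Some g, b, b')"] that by (simp add: I_def u_def \<sigma>'_def)
  define e' where "e' b = (\<Sum>b'\<in>B. c' b b' *\<^sub>R b')" for b
  have e'V: "e' b \<in> V" for b unfolding e'_def by (intro Q.V_sum Q.V_scale Q.EV)
  have Qe': "Q (e' b) d = c' b d" if "d \<in> B" for b d unfolding e'_def using that by (rule Q.ip_comb)
  have rel': "\<rho> g (e' b) = (\<Sum>b'\<in>B. \<sigma>' g b b' *\<^sub>R e' b')" if g: "g \<in> G" and b: "b \<in> B" for g b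
  proof (rule Q.ip_ext)
    fix d assume d: "d \<in> B"
    have "(\<lambda>k. \<Sum>b'\<in>B. \<sigma> (r k) g b b' * c (r k) b' d) \<longlonglongrightarrow> (\<Sum>b'\<in>B. \<sigma>' g b b' * c' b' d)"
      by (intro tendsto_sum tendsto_mult limc lim\<sigma> g b d)
    moreover have "(\<lambda>k. \<Sum>b'\<in>B. c (r k) b b' * Q (\<rho> g b') d) \<longlonglongrightarrow> (\<Sum>b'\<in>B. c' b b' * Q (\<rho> g b') d)"
      by (intro tendsto_sum tendsto_mult limc tendsto_const b)
    ultimately have eq: "(\<Sum>b'\<in>B. \<sigma>' g b b' * c' b' d) = (\<Sum>b'\<in>B. c' b b' * Q (\<rho> g b') d)"
      unfolding rel[OF g b d] by (rule LIMSEQ_unique)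
    have "lin_on V (\<lambda>x. Q (\<rho> g x) d)" using eG[OF g] Q.EV[OF d]
      by (intro lin_onI) (simp_all add: endomorphism_on_def Q.ip_add_left Q.ip_scale_left)
    from Q.lin_expand[OF this e'V[of b]]
    have "Q (\<rho> g (e' b)) d = (\<Sum>b'\<in>B. c' b b' * Q (\<rho> g b') d)" by (simp add: Qe')
    also have "\<dots> = (\<Sum>b'\<in>B. \<sigma>' g b b' * Q (e' b') d)" using eq d by (simp add: Qe')
    also have "\<dots> = Q (\<Sum>b'\<in>B. \<sigma>' g b b' *\<^sub>R e' b') d"
      by (rule Q.ip_sums_left[symmetric]) (use e'V Q.EV[OF d] in auto)
    finally show "Q (\<rho> g (e' b)) d = Q (\<Sum>b'\<in>B. \<sigma>' g b b' *\<^sub>R e' b') d" .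
  qed (use inG[OF g e'V] e'V in \<open>auto intro!: Q.V_sum Q.V_scale\<close>)
  have "(\<lambda>k. \<Sum>(b,b')\<in>B\<times>B. (c (r k) b b')\<^sup>2) \<longlonglongrightarrow> (\<Sum>(b,b')\<in>B\<times>B. (c' b b')\<^sup>2)"
    unfolding case_prod_beta by (intro tendsto_sum tendsto_power limc) auto
  then have c'sum: "(\<Sum>(b,b')\<in>B\<times>B. (c' b b')\<^sup>2) = 1" unfolding csum by (simp add: LIMSEQ_const_iff)
  define W where "W = span (e' ` B)"
  have WV: "W \<subseteq> V" unfolding W_def using e'V Q.sub by (intro span_minimal) auto
  have invG: "\<rho> g w \<in> W" if g: "g \<in> G" and w: "w \<in> W" for g w
  proof -
    have "w \<in> V \<and> \<rho> g w \<in> W" using w unfolding W_def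
    proof (induction rule: span_induct_alt)
      case base
      then show ?case using lin_on_zero[OF endo_lin[OF eG[OF g]] Q.sub] Q.V_0 by (simp add: span_zero)
    next
      case (step s x y)
      then obtain b where b: "x = e' b" "b \<in> B" by blast
      have "\<rho> g x \<in> span (e' ` B)"
        unfolding b(1) rel'[OF g b(2)] by (intro span_sum span_scale span_base imageI)
      moreover have "\<rho> g (s *\<^sub>R x + y) = s *\<^sub>R \<rho> g x + \<rho> g y"
        using eG[OF g] step e'V[of b] b Q.V_scale by (simp add: endomorphism_on_def)
      ultimately show ?case using step b e'V[of b]
        by (auto intro!: span_add span_scale Q.V_add Q.V_scale)
    qed
    then show ?thesis by simp
  qed
  have "\<rho> x w \<in> W" if "x \<in> h" "w \<in> W" for x w
    by (rule invariant_span_G[OF _ WV invG that]) (simp_all add: W_def)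
  moreover have "W \<noteq> {0}"
  proof
    assume "W = {0}"
    then have "e' b = 0" if "b \<in> B" for b using that span_base[of "e' b" "e' ` B"] by (auto simp: W_def)
    then have "c' b d = 0" if "b \<in> B" "d \<in> B" for b d
      using Qe'[OF that(2), of b] that Q.ip_0_left[OF Q.EV[OF that(2)]] by simp
    then have "(\<Sum>(b,b')\<in>B\<times>B. (c' b b')\<^sup>2) = 0" by (intro sum.neutral) auto
    then show False using c'sum by simp
  qed
  moreover have "subspace W" by (simp add: W_def)
  ultimately have "W = V" using irr WV unfolding irreducible_module_def by blast
  then have spanV: "span (e' ` B) = V" by (simp add: W_def)
  have ind: "independent (e' ` B)" and cardB: "card (e' ` B) = card B"
    using card_eq_basis[OF B(1,2), of "e' ` B"] B(1,3) spanV card_image_le[OF B(1)] by auto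
  have inj: "inj_on e' B" using cardB B(1) by (simp add: eq_card_imp_inj_on)
  have finE': "finite (e' ` B)" using B(1) by simp
  define P' where "P' = (\<lambda>x y. \<Sum>b\<in>e' ` B. representation (e' ` B) x b * representation (e' ` B) y b)"
  interpret P': onb V P' "e' ` B" unfolding P'_def using finE' ind spanV by (rule basis_inner_product)
  have "energy P' (e' ` B) = (\<Sum>g\<in>G. \<Sum>b\<in>B. \<Sum>b'\<in>B. (\<sigma>' g b b')\<^sup>2)"
    unfolding energy_def
  proof (rule sum.cong[OF refl])
    fix g assume g: "g \<in> G"
    have co: "P' (\<rho> g (e' b)) (e' d) = \<sigma>' g b d" if b: "b \<in> B" and d: "d \<in> B" for b d
    proof -
      have "(\<Sum>b'\<in>B. \<sigma>' g b b' *\<^sub>R e' b') = (\<Sum>v\<in>e' ` B. \<sigma>' g b (the_inv_into B e' v) *\<^sub>R v)"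
        by (subst sum.reindex[OF inj]) (simp add: the_inv_into_f_f[OF inj])
      then show ?thesis unfolding rel'[OF g b]
        using P'.ip_comb[OF imageI[OF d], of "\<lambda>v. \<sigma>' g b (the_inv_into B e' v)"]
        by (simp add: the_inv_into_f_f[OF inj d])
    qed
    have "(\<Sum>u\<in>e' ` B. P' (\<rho> g u) (\<rho> g u)) = (\<Sum>b\<in>B. P' (\<rho> g (e' b)) (\<rho> g (e' b)))"
      by (simp add: sum.reindex[OF inj])
    also have "\<dots> = (\<Sum>b\<in>B. \<Sum>v\<in>e' ` B. (P' (\<rho> g (e' b)) v)\<^sup>2)"
      unfolding power2_eq_square by (intro sum.cong refl P'.parseval inG[OF g e'V])
    also have "\<dots> = (\<Sum>b\<in>B. \<Sum>d\<in>B. (P' (\<rho> g (e' b)) (e' d))\<^sup>2)"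
      by (simp add: sum.reindex[OF inj])
    also have "\<dots> = (\<Sum>b\<in>B. \<Sum>d\<in>B. (\<sigma>' g b d)\<^sup>2)"
      by (intro sum.cong refl) (simp add: co)
    finally show "(\<Sum>u\<in>e' ` B. P' (\<rho> g u) (\<rho> g u)) = (\<Sum>b\<in>B. \<Sum>d\<in>B. (\<sigma>' g b d)\<^sup>2)" .
  qed
  moreover have "(\<lambda>k. energy (P (r k)) (E (r k))) \<longlonglongrightarrow> (\<Sum>g\<in>G. \<Sum>b\<in>B. \<Sum>b'\<in>B. (\<sigma>' g b b')\<^sup>2)"
    unfolding energy\<sigma> by (intro tendsto_sum tendsto_power lim\<sigma>)
  ultimately have lim: "(\<lambda>k. energy (P (r k)) (E (r k))) \<longlonglongrightarrow> energy P' (e' ` B)" by simp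
  have "(\<lambda>k. m + 1 / real (Suc k)) \<longlonglongrightarrow> m + 0"
    by (intro tendsto_add tendsto_const LIMSEQ_Suc[OF lim_1_over_n])
  then have "(\<lambda>k. m + 1 / real (Suc (r k))) \<longlonglongrightarrow> m"
    using LIMSEQ_subseq_LIMSEQ[OF _ r(1)] by (force simp: o_def)
  then have "energy P' (e' ` B) \<le> m"
    by (rule LIMSEQ_le[OF lim]) (use PE(2) in \<open>auto intro: less_imp_le\<close>)
  moreover have "m \<le> energy P'' E''" if "onb V P'' E''" for P'' E''
    unfolding m_def using bdd that by (intro cInf_lower) auto
  moreover have "onb V P' (e' ` B)" by unfold_locales
  ultimately show ?thesis by (meson order.trans)
qed

theorem irreducible_adapted:
  assumes fd: "findim V" and ne: "V \<noteq> {0}" and irr: irreducible_module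
  shows "\<exists>P. adapted V \<rho> P"
proof -
  obtain P E where P: "onb V P E" and min: "\<And>P' E'. onb V P' E' \<Longrightarrow> energy P E \<le> energy P' E'"
    using minimal_energy_exists[OF assms] by blast
  have "adapted V \<rho> P" by (rule moment_zero_adapted[OF P minimal_energy_moment_zero[OF P min]])
  then show ?thesis by blast
qed

end

section \<open>Splitting of extensions\<close>

text \<open>
  Homomorphisms between modules form a subspace of a function space, which makes them a module to
  which the results above apply.
\<close>

instantiation "fun" :: (type, real_vector) real_vector
begin
definition scaleR_fun :: "real \<Rightarrow> ('a \<Rightarrow> 'b) \<Rightarrow> 'a \<Rightarrow> 'b" where
  "scaleR_fun c f = (\<lambda>x. c *\<^sub>R f x)"
instance
  by standard (simp_all add: scaleR_fun_def fun_eq_iff algebra_simps)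
end

lemma scaleR_fun_apply [simp]: "(c *\<^sub>R f) x = c *\<^sub>R f x"
  by (simp add: scaleR_fun_def)

lemma sum_fun_apply: "(\<Sum>i\<in>I. f i) x = (\<Sum>i\<in>I. f i x)"
  by (induction I rule: infinite_finite_induct) simp_all

lemma (in euclid) symmetric_image:
  assumes C: "endomorphism_on V C" and sym: "\<And>x y. x \<in> V \<Longrightarrow> y \<in> V \<Longrightarrow> ip (C x) y = ip x (C y)"
    and b: "b \<in> V" and ker: "\<And>v. v \<in> V \<Longrightarrow> C v = 0 \<Longrightarrow> ip b v = 0"
  shows "\<exists>w\<in>V. C w = b"
proof -
  have WV: "C ` V \<subseteq> V" using C by (auto intro: endo_in)
  have W: "subspace (C ` V)"
    unfolding subspace_def
  proof (intro conjI ballI allI)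
    show "0 \<in> C ` V" using lin_on_zero[OF endo_lin[OF C] sub] V_0 by (metis imageI)
    show "x + y \<in> C ` V" if "x \<in> C ` V" "y \<in> C ` V" for x y
      using that lin_on_add[OF endo_lin[OF C]] V_add by (force simp: image_iff)
    show "c *\<^sub>R x \<in> C ` V" if "x \<in> C ` V" for c x
    proof -
      obtain y where "x = C y" "y \<in> V" using \<open>x \<in> C ` V\<close> by blast
      then have "c *\<^sub>R x = C (c *\<^sub>R y)" by (simp add: lin_on_scale[OF endo_lin[OF C]])
      then show ?thesis using V_scale[OF \<open>y \<in> V\<close>] by (simp only: imageI)
    qed
  qed
  obtain \<pi> where \<pi>: "\<And>x. x \<in> V \<Longrightarrow> \<pi> x \<in> C ` V" "\<And>x w. x \<in> V \<Longrightarrow> w \<in> C ` V \<Longrightarrow> ip (x - \<pi> x) w = 0"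
    using orthogonal_projection[OF W WV] by metis
  define v where "v = b - \<pi> b"
  have pV: "\<pi> b \<in> V" using \<pi>(1)[OF b] WV by blast
  have vV: "v \<in> V" unfolding v_def using b pV by (rule V_diff)
  have "C v = 0"
  proof (rule ip_eqI)
    fix z assume z: "z \<in> V"
    have "ip (C v) z = ip v (C z)" using vV z by (rule sym)
    also have "\<dots> = 0" unfolding v_def using \<pi>(2)[OF b] z by blast
    finally show "ip (C v) z = ip 0 z" using z by (simp add: ip_0_left)
  qed (use C vV V_0 in \<open>auto intro: endo_in\<close>)
  then have "ip b v = 0" using vV by (rule_tac ker)
  moreover have "ip v (\<pi> b) = 0" unfolding v_def using \<pi>(2)[OF b \<pi>(1)[OF b]] .
  ultimately have "ip v v = 0"
    using ip_diff_right[OF vV b pV] ip_commute[OF vV b] by (simp add: v_def[symmetric])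
  then have "v = 0" using ip_self_0[OF vV] by simp
  then show ?thesis using \<pi>(1)[OF b] by (auto simp: v_def)
qed

context reductive_module begin

text \<open>
  Whitehead's lemma for \<open>H\<^sup>1\<close>. The Casimir operator \<open>C = \<Sum> (\<rho> g)\<^sup>t \<rho> g\<close> is positive semidefinite and its kernel
  consists of invariant vectors. The vector \<open>b = \<Sum> (\<rho> g)\<^sup>t (c g)\<close> is orthogonal to the kernel, so \<open>b = C w\<close>.
  Subtracting the coboundary of \<open>w\<close> gives a cocycle \<open>d\<close> with \<open>\<Sum> (\<rho> g)\<^sup>t (d g) = 0\<close>. By the cocycle identity
  and the parity of \<open>ad x\<close> one gets \<open>C (d x) = 0\<close>; so the values of \<open>d\<close> are invariant, \<open>d\<close> vanishes on
  brackets, and thus on all of \<open>h\<close>.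
\<close>

lemma cocycle_is_coboundary:
  assumes P: "euclid V P"
    and par: "\<And>x e u v. parity x e \<Longrightarrow> u \<in> V \<Longrightarrow> v \<in> V \<Longrightarrow> P (\<rho> x u) v = e * P u (\<rho> x v)"
    and triv: "\<And>A v. A \<in> a \<Longrightarrow> v \<in> V \<Longrightarrow> \<rho> A v = 0"
    and c: "lin_on h c" "\<And>x. x \<in> h \<Longrightarrow> c x \<in> V"
    and cocycle: "\<And>x y. x \<in> h \<Longrightarrow> y \<in> h \<Longrightarrow> c (br x y) = \<rho> x (c y) - \<rho> y (c x)"
    and ca: "\<And>A. A \<in> a \<Longrightarrow> c A = 0"
  shows "\<exists>w\<in>V. \<forall>x\<in>h. c x = \<rho> x w"
proof -
  interpret euclid V P by fact
  have eG: "endomorphism_on V (\<rho> g)" if "g \<in> G" for g using that by (intro \<rho>_endo G_h)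
  have inG: "\<rho> g x \<in> V" if "g \<in> G" "x \<in> V" for g x using eG[OF that(1)] that(2) by (rule endo_in)
  define C where "C v = (\<Sum>g\<in>G. adj (\<rho> g) (\<rho> g v))" for v
  have C: "endomorphism_on V C"
    unfolding C_def by (rule endo_sum[OF _ sub]) (rule endo_comp[OF adj_endo eG], rule eG)
  have CP: "P (C x) y = (\<Sum>g\<in>G. P (\<rho> g x) (\<rho> g y))" if "x \<in> V" "y \<in> V" for x y
  proof -
    have "P (C x) y = (\<Sum>g\<in>G. P (adj (\<rho> g) (\<rho> g x)) y)"
      unfolding C_def using that by (intro ip_sum_left) (auto intro: adj_in eG inG)
    also have "\<dots> = (\<Sum>g\<in>G. P (\<rho> g x) (\<rho> g y))"
      using that by (intro sum.cong refl adj_left eG inG)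
    finally show ?thesis .
  qed
  have sym: "P (C x) y = P x (C y)" if "x \<in> V" "y \<in> V" for x y
  proof -
    have "P (C x) y = (\<Sum>g\<in>G. P (\<rho> g y) (\<rho> g x))"
      unfolding CP[OF that] using that by (intro sum.cong refl ip_commute inG)
    also have "\<dots> = P x (C y)" using CP[OF that(2,1)] ip_commute[OF that(1) endo_in[OF C that(2)]] by simp
    finally show ?thesis .
  qed
  have kerC: "\<rho> g v = 0" if v: "v \<in> V" and z: "(\<Sum>g\<in>G. P (\<rho> g v) (\<rho> g v)) = 0" and g: "g \<in> G" for v g
  proof -
    have "\<forall>g\<in>G. P (\<rho> g v) (\<rho> g v) = 0"
      using z finite_G by (subst (asm) sum_nonneg_eq_0_iff) (auto intro: ip_ge0 inG v)
    then show ?thesis using ip_self_0[OF inG[OF g v]] g by simp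
  qed
  define b where "b = (\<Sum>g\<in>G. adj (\<rho> g) (c g))"
  have bV: "b \<in> V" unfolding b_def by (intro V_sum adj_in eG c(2) G_h)
  have bP: "P b v = (\<Sum>g\<in>G. P (c g) (\<rho> g v))" if v: "v \<in> V" for v
  proof -
    have "P b v = (\<Sum>g\<in>G. P (adj (\<rho> g) (c g)) v)"
      unfolding b_def using v by (intro ip_sum_left) (auto intro: adj_in eG c(2) G_h)
    also have "\<dots> = (\<Sum>g\<in>G. P (c g) (\<rho> g v))"
      using v by (intro sum.cong refl adj_left eG c(2) G_h)
    finally show ?thesis .
  qed
  have "\<exists>w\<in>V. C w = b"
  proof (rule symmetric_image[OF C sym bV])
    fix v assume v: "v \<in> V" "C v = 0"
    then have "\<rho> g v = 0" if "g \<in> G" for g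
      using kerC[OF v(1) _ that] CP[OF v(1) v(1)] ip_0_left[OF v(1)] by simp
    then show "P b v = 0" unfolding bP[OF v(1)] using ip_0_right c(2) G_h by (intro sum.neutral) simp
  qed
  then obtain w where w: "w \<in> V" "C w = b" by blast
  define d where "d x = c x - \<rho> x w" for x
  have dV: "d x \<in> V" if "x \<in> h" for x unfolding d_def using c(2)[OF that] \<rho>_in[OF that w(1)] by (rule V_diff)
  have dlin: "lin_on h d"
    using c(1) \<rho>_lin[OF w(1)] by (simp add: d_def lin_on_def scaleR_diff_right)
  have dc: "d (br x y) = \<rho> x (d y) - \<rho> y (d x)" if "x \<in> h" "y \<in> h" for x y
    using that cocycle[OF that] \<rho>_br[OF that w(1)] lin_on_diff[OF endo_lin[OF \<rho>_endo] sub] c(2) \<rho>_in w(1)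
    by (simp add: d_def)
  have D: "(\<Sum>g\<in>G. P (d g) (\<rho> g v)) = 0" if v: "v \<in> V" for v
  proof -
    have "(\<Sum>g\<in>G. P (d g) (\<rho> g v)) = P b v - P (C w) v"
      unfolding bP[OF v] CP[OF w(1) v] d_def sum_subtractf[symmetric]
      using v w(1) by (intro sum.cong refl ip_diff_left c(2) inG G_h)
    then show ?thesis using w(2) by simp
  qed
  have dpar: "\<rho> g (d x) = 0" if x: "parity x e" and g: "g \<in> G" for x e g
  proof -
    have xh: "x \<in> h" using x by (rule parity_carrier)
    obtain s where s: "\<And>g. g \<in> G \<Longrightarrow> br x g = (\<Sum>g'\<in>G. s g g' *\<^sub>R g')"
      "\<And>g g'. g \<in> G \<Longrightarrow> g' \<in> G \<Longrightarrow> s g g' = e * s g' g"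
      using parity_matrix[OF x] by blast
    have "(\<Sum>g\<in>G. P (\<rho> g (d x)) (\<rho> g v)) = 0" if v: "v \<in> V" for v
    proof -
      have xv: "\<rho> x v \<in> V" using xh v by (rule \<rho>_in)
      have 1: "P (\<rho> g (d x)) (\<rho> g v) = e * P (d g) (\<rho> g (\<rho> x v))
          + (\<Sum>g'\<in>G. e * s g g' * P (d g) (\<rho> g' v)) - (\<Sum>g'\<in>G. s g g' * P (d g') (\<rho> g v))"
        if g: "g \<in> G" for g
      proof -
        have gh: "g \<in> h" using g by (rule G_h)
        have V: "d g \<in> V" "\<rho> g v \<in> V" "\<rho> x (d g) \<in> V" "\<rho> g (\<rho> x v) \<in> V" "\<rho> (br x g) v \<in> V" "d (br x g) \<in> V"
          using dV gh xh v xv by (auto intro!: \<rho>_in dV br_closed)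
        have "\<rho> g (d x) = \<rho> x (d g) - d (br x g)" using dc[OF xh gh] by simp
        then have "P (\<rho> g (d x)) (\<rho> g v) = P (\<rho> x (d g)) (\<rho> g v) - P (d (br x g)) (\<rho> g v)"
          using V by (simp add: ip_diff_left)
        also have "P (\<rho> x (d g)) (\<rho> g v) = e * P (d g) (\<rho> x (\<rho> g v))" using x V by (intro par)
        also have "\<rho> x (\<rho> g v) = \<rho> g (\<rho> x v) + \<rho> (br x g) v" using \<rho>_br[OF xh gh v] by simp
        also have "P (d g) (\<rho> g (\<rho> x v) + \<rho> (br x g) v) = P (d g) (\<rho> g (\<rho> x v)) + P (d g) (\<rho> (br x g) v)"
          using V by (intro ip_add_right)
        also have "P (d g) (\<rho> (br x g) v) = (\<Sum>g'\<in>G. s g g' * P (d g) (\<rho> g' v))"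
          unfolding s(1)[OF g] \<rho>_sums[OF v] using V v by (intro ip_sums_right) (auto intro: inG)
        also have "P (d (br x g)) (\<rho> g v) = (\<Sum>g'\<in>G. s g g' * P (d g') (\<rho> g v))"
        proof -
          have "d (br x g) = (\<Sum>g'\<in>G. s g g' *\<^sub>R d g')"
            unfolding s(1)[OF g] using lin_on_sum_scale[OF dlin subspace_carrier, of G "\<lambda>g. g"] G_h by simp
          then show ?thesis using V by (simp only:) (intro ip_sums_left dV G_h, auto)
        qed
        finally show ?thesis by (simp add: distrib_left sum_distrib_left mult.assoc)
      qed
      have 2: "(\<Sum>g\<in>G. \<Sum>g'\<in>G. e * s g g' * P (d g) (\<rho> g' v)) = (\<Sum>g\<in>G. \<Sum>g'\<in>G. s g g' * P (d g') (\<rho> g v))"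
      proof -
        have "(\<Sum>g\<in>G. \<Sum>g'\<in>G. s g g' * P (d g') (\<rho> g v)) = (\<Sum>g'\<in>G. \<Sum>g\<in>G. s g g' * P (d g') (\<rho> g v))"
          by (rule sum.swap)
        also have "\<dots> = (\<Sum>g'\<in>G. \<Sum>g\<in>G. e * s g' g * P (d g') (\<rho> g v))"
        proof (intro sum.cong refl)
          fix g g' assume "g' \<in> G" "g \<in> G"
          then show "s g g' * P (d g') (\<rho> g v) = e * s g' g * P (d g') (\<rho> g v)"
            by (subst s(2)) simp_all
        qed
        finally show ?thesis ..
      qed
      have "(\<Sum>g\<in>G. P (\<rho> g (d x)) (\<rho> g v)) = e * (\<Sum>g\<in>G. P (d g) (\<rho> g (\<rho> x v)))
          + (\<Sum>g\<in>G. \<Sum>g'\<in>G. e * s g g' * P (d g) (\<rho> g' v)) - (\<Sum>g\<in>G. \<Sum>g'\<in>G. s g g' * P (d g') (\<rho> g v))"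
        by (simp add: 1 sum.distrib sum_subtractf sum_distrib_left)
      then show ?thesis using 2 D[OF xv] by simp
    qed
    from this[OF dV[OF xh]] show ?thesis by (rule kerC[OF dV[OF xh] _ g])
  qed
  have da: "d A = 0" if "A \<in> a" for A using ca triv w(1) that by (simp add: d_def)
  have \<rho>d: "\<rho> y (d x) = 0" if x: "x \<in> h" and y: "y \<in> h" for x y
  proof -
    have 1: "\<rho> g (d g') = 0" if "g \<in> G" "g' \<in> G" for g g'
      using G_cases[OF that(2)] da dpar that(1) lin_on_zero[OF endo_lin[OF eG[OF that(1)]] sub] by auto
    have 2: "\<rho> y (d g') = 0" if g': "g' \<in> G" for g'
      using lin_on_span_G_zero[OF \<rho>_lin[OF dV[OF G_h[OF g']]] 1[OF _ g'] y] .
    have "lin_on h (\<lambda>x. \<rho> y (d x))"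
      using dlin dV \<rho>_endo[OF y] by (simp add: lin_on_def endomorphism_on_def)
    from lin_on_span_G_zero[OF this 2 x] show ?thesis .
  qed
  have dbr: "d (br x y) = 0" if "x \<in> h" "y \<in> h" for x y using dc[OF that] \<rho>d that by simp
  have d0: "d x = 0" if "parity x e" for x e
    by (rule lin_on_derived_zero[OF dlin dbr order_refl parity_derived[OF that]])
  have "d x = 0" if "x \<in> h" for x
    using lin_on_span_G_zero[OF dlin _ that] G_cases da d0 by blast
  then show ?thesis using w(1) by (auto simp: d_def)
qed

end

context reductive begin

text \<open>
  The previous lemma for the module \<open>M\<close> of \<open>a\<close>-equivariant maps from \<open>U\<close> to \<open>W\<close> with
  the Hilbert-Schmidt product \<open>H\<close>, on which \<open>a\<close> acts trivially. Functions are set to \<open>0\<close> outside \<open>U\<close>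
  in order that equality of maps on \<open>U\<close> is equality of functions.
\<close>

lemma hom_cocycle_splits:
  fixes U W :: "'b::real_vector set"
  assumes W: "euclid W PW" "lie_module h br W \<rho>1"
    and parW: "\<And>x e u v. parity x e \<Longrightarrow> u \<in> W \<Longrightarrow> v \<in> W \<Longrightarrow> PW (\<rho>1 x u) v = e * PW u (\<rho>1 x v)"
    and U: "euclid U PU" "lie_module h br U \<rho>2"
    and parU: "\<And>x e u v. parity x e \<Longrightarrow> u \<in> U \<Longrightarrow> v \<in> U \<Longrightarrow> PU (\<rho>2 x u) v = e * PU u (\<rho>2 x v)"
    and c: "\<And>x. x \<in> h \<Longrightarrow> lin_on U (c x)" "\<And>x u. x \<in> h \<Longrightarrow> u \<in> U \<Longrightarrow> c x u \<in> W"
      "\<And>u. u \<in> U \<Longrightarrow> lin_on h (\<lambda>x. c x u)"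
    and equiv: "\<And>A x u. A \<in> a \<Longrightarrow> x \<in> h \<Longrightarrow> u \<in> U \<Longrightarrow> c x (\<rho>2 A u) = \<rho>1 A (c x u)"
    and ca: "\<And>A u. A \<in> a \<Longrightarrow> u \<in> U \<Longrightarrow> c A u = 0"
    and cocycle: "\<And>x y u. x \<in> h \<Longrightarrow> y \<in> h \<Longrightarrow> u \<in> U \<Longrightarrow>
      c (br x y) u = (\<rho>1 x (c y u) - c y (\<rho>2 x u)) - (\<rho>1 y (c x u) - c x (\<rho>2 y u))"
  shows "\<exists>m. lin_on U m \<and> (\<forall>u\<in>U. m u \<in> W) \<and> (\<forall>x\<in>h. \<forall>u\<in>U. c x u = \<rho>1 x (m u) - m (\<rho>2 x u))"
proof -
  interpret W: euclid W PW by fact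
  interpret U: euclid U PU by fact
  interpret W: reductive_module h br a parity G W \<rho>1 using W(2) by unfold_locales
  interpret U: reductive_module h br a parity G U \<rho>2 using U(2) by unfold_locales
  obtain EW where "orthonormal_basis W PW EW" using W.onb_exists by blast
  then interpret W: onb W PW EW by unfold_locales
  obtain EU where "orthonormal_basis U PU EU" using U.onb_exists by blast
  then interpret U: onb U PU EU by unfold_locales
  define M where "M = {m. lin_on U m \<and> (\<forall>u\<in>U. m u \<in> W) \<and> (\<forall>u. u \<notin> U \<longrightarrow> m u = 0) \<and>
      (\<forall>A\<in>a. \<forall>u\<in>U. m (\<rho>2 A u) = \<rho>1 A (m u))}"
  define H where "H m m' = (\<Sum>u\<in>EU. PW (m u) (m' u))" for m m'
  define act where "act x m = (\<lambda>u. if u \<in> U then \<rho>1 x (m u) - m (\<rho>2 x u) else 0)" for x m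
  have MD: "lin_on U m" "u \<in> U \<Longrightarrow> m u \<in> W" "u \<notin> U \<Longrightarrow> m u = 0"
    "A \<in> a \<Longrightarrow> u \<in> U \<Longrightarrow> m (\<rho>2 A u) = \<rho>1 A (m u)" if "m \<in> M" for m u A
    using that by (simp_all add: M_def)
  have M_lin: "m + m' \<in> M" "s *\<^sub>R m \<in> M" if "m \<in> M" "m' \<in> M" for m m' s
    using MD[OF that(1)] MD[OF that(2)] W.\<rho>_endo[OF a_sub] W.V_add W.V_scale
    by (simp_all add: M_def lin_on_def endomorphism_on_def scaleR_add_right algebra_simps)
  have M0: "0 \<in> M"
    using W.V_0 lin_on_zero[OF endo_lin[OF W.\<rho>_endo[OF a_sub]] W.sub] by (simp add: M_def lin_on_def)
  have subM: "subspace M" using M0 M_lin by (simp add: subspace_def)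
  have finM: "findim M"
  proof -
    define el where "el p = (\<lambda>x. if x \<in> U then PU x (fst p) *\<^sub>R snd p else (0::'b))" for p :: "'b \<times> 'b"
    have "M \<subseteq> span (el ` (EU \<times> EW))"
    proof
      fix m assume m: "m \<in> M"
      have "m = (\<Sum>p\<in>EU\<times>EW. PW (m (fst p)) (snd p) *\<^sub>R el p)"
      proof
        fix x
        show "m x = (\<Sum>p\<in>EU\<times>EW. PW (m (fst p)) (snd p) *\<^sub>R el p) x"
        proof (cases "x \<in> U")
          case True
          have "m x = (\<Sum>u\<in>EU. PU x u *\<^sub>R m u)" using U.lin_expand[OF MD(1)[OF m] True] .
          also have "\<dots> = (\<Sum>u\<in>EU. PU x u *\<^sub>R (\<Sum>w\<in>EW. PW (m u) w *\<^sub>R w))"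
            by (intro sum.cong refl) (simp add: W.expand MD(2)[OF m] U.EV)
          also have "\<dots> = (\<Sum>u\<in>EU. \<Sum>w\<in>EW. PW (m u) w *\<^sub>R el (u, w) x)"
            using True by (simp add: el_def scaleR_sum_right mult.commute)
          finally show ?thesis by (simp add: sum_fun_apply sum.cartesian_product case_prod_beta)
        next
          case False
          then show ?thesis using MD(3)[OF m] by (simp add: sum_fun_apply el_def)
        qed
      qed
      also have "\<dots> \<in> span (el ` (EU \<times> EW))"
        by (intro span_sum span_scale span_base imageI)
      finally show "m \<in> span (el ` (EU \<times> EW))" .
    qed
    moreover have "findim (span (el ` (EU \<times> EW)))"
      using U.finE W.finE by (intro findimI[of "el ` (EU \<times> EW)"]) auto
    ultimately show ?thesis using subM by (rule_tac findim_sub)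
  qed
  have H: "euclid M H"
  proof
    fix m assume m: "m \<in> M" "m \<noteq> 0"
    have "\<exists>u\<in>EU. m u \<noteq> 0"
    proof (rule ccontr)
      assume *: "\<not> ?thesis"
      have "m x = 0" for x
      proof (cases "x \<in> U")
        case True
        then show ?thesis using U.lin_expand[OF MD(1)[OF m(1)] True] * by simp
      qed (rule MD(3)[OF m(1)])
      then show False using m(2) by auto
    qed
    then obtain u where u: "u \<in> EU" "m u \<noteq> 0" by blast
    have "PW (m u) (m u) > 0" using u MD(2)[OF m(1)] U.EV by (simp add: W.ip_pos)
    then show "H m m > 0" unfolding H_def using u U.finE MD(2)[OF m(1)] U.EV
      by (intro sum_pos2[of _ u]) (simp_all add: W.ip_ge0)
  next
    fix x y assume "x \<in> M" "y \<in> M"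
    then show "H x y = H y x" unfolding H_def by (intro sum.cong refl W.ip_commute MD(2) U.EV)
  qed (use MD(2) U.EV finM in \<open>simp_all add: H_def W.ip_add_left W.ip_scale_left sum.distrib sum_distrib_left\<close>)
  have comm1: "\<rho>1 x (\<rho>1 A w) = \<rho>1 A (\<rho>1 x w)" if "A \<in> a" "x \<in> h" "w \<in> W" for A x w
    using W.\<rho>_br[OF a_sub[OF that(1)] that(2,3)] a_central[OF that(1,2)] lin_on_zero[OF W.\<rho>_lin[OF that(3)] subspace_carrier]
    by simp
  have comm2: "\<rho>2 x (\<rho>2 A w) = \<rho>2 A (\<rho>2 x w)" if "A \<in> a" "x \<in> h" "w \<in> U" for A x w
    using U.\<rho>_br[OF a_sub[OF that(1)] that(2,3)] a_central[OF that(1,2)] lin_on_zero[OF U.\<rho>_lin[OF that(3)] subspace_carrier]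
    by simp
  have actM: "act x m \<in> M" if x: "x \<in> h" and m: "m \<in> M" for x m
    unfolding M_def
  proof (intro CollectI conjI ballI allI impI)
    show "lin_on U (act x m)"
      using MD(1,2)[OF m] W.\<rho>_endo[OF x] U.\<rho>_endo[OF x] U.V_add U.V_scale
      by (simp add: act_def lin_on_def endomorphism_on_def scaleR_diff_right)
    show "act x m u \<in> W" if "u \<in> U" for u
      using that MD(2)[OF m] x by (simp add: act_def W.V_diff W.\<rho>_in U.\<rho>_in)
    show "act x m u = 0" if "u \<notin> U" for u using that by (simp add: act_def)
    fix A u assume A: "A \<in> a" and u: "u \<in> U"
    show "act x m (\<rho>2 A u) = \<rho>1 A (act x m u)"
      using lin_on_diff[OF endo_lin[OF W.\<rho>_endo[OF a_sub[OF A]]] W.sub, of "\<rho>1 x (m u)" "m (\<rho>2 x u)"]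
      by (simp add: act_def u x A a_sub U.\<rho>_in W.\<rho>_in MD(2)[OF m] MD(4)[OF m] comm1 comm2)
  qed
  interpret Hom: reductive_module h br a parity G M act
  proof
    show "lie_module h br M act"
      unfolding lie_module_def
    proof (intro conjI ballI)
      fix x assume x: "x \<in> h"
      show "endomorphism_on M (act x)"
        using W.\<rho>_endo[OF x] actM[OF x] MD(2)
        by (auto simp: endomorphism_on_def act_def fun_eq_iff algebra_simps)
    next
      fix m assume m: "m \<in> M"
      show "lin_on h (\<lambda>x. act x m)"
      proof (rule lin_onI)
        fix x y assume "x \<in> h" "y \<in> h"
        then show "act (x + y) m = act x m + act y m"
          using W.\<rho>_lin U.\<rho>_lin MD[OF m] U.\<rho>_in by (auto simp: act_def fun_eq_iff lin_on_def)
      next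
        fix s x assume "x \<in> h"
        then show "act (s *\<^sub>R x) m = s *\<^sub>R act x m"
          using W.\<rho>_lin U.\<rho>_lin MD[OF m] U.\<rho>_in by (auto simp: act_def fun_eq_iff lin_on_def scaleR_diff_right)
      qed
    next
      fix x y m assume x: "x \<in> h" and y: "y \<in> h" and m: "m \<in> M"
      show "act (br x y) m = act x (act y m) - act y (act x m)"
      proof
        fix u
        show "act (br x y) m u = (act x (act y m) - act y (act x m)) u"
        proof (cases "u \<in> U")
          case True
          note V = MD(2)[OF m] U.\<rho>_in W.\<rho>_in x y True
          have "m (\<rho>2 (br x y) u) = m (\<rho>2 x (\<rho>2 y u)) - m (\<rho>2 y (\<rho>2 x u))"
            unfolding U.\<rho>_br[OF x y True] by (rule lin_on_diff[OF MD(1)[OF m] U.sub]) (simp_all add: V)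
          then show ?thesis
            by (simp add: act_def V W.\<rho>_br lin_on_diff[OF endo_lin[OF W.\<rho>_endo] W.sub])
        qed (simp add: act_def)
      qed
    qed
  qed
  have parH: "H (act x m) m' = e * H m (act x m')" if x: "parity x e" and m: "m \<in> M" "m' \<in> M" for x e m m'
  proof -
    have xh: "x \<in> h" using x by (rule parity_carrier)
    note V = MD(2)[OF m(1)] MD(2)[OF m(2)] U.EV U.\<rho>_in[OF xh] W.\<rho>_in[OF xh]
    have "(\<Sum>u\<in>EU. PW (m (\<rho>2 x u)) (m' u)) = (\<Sum>u\<in>EU. \<Sum>v\<in>EU. PU (\<rho>2 x u) v * PW (m v) (m' u))"
    proof (rule sum.cong[OF refl])
      fix u assume u: "u \<in> EU"
      have "lin_on U (\<lambda>x. PW (m x) (m' u))" using MD(1,2)[OF m(1)] V u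
        by (simp add: lin_on_def W.ip_add_left W.ip_scale_left)
      from U.lin_expand[OF this U.\<rho>_in[OF xh U.EV[OF u]]]
      show "PW (m (\<rho>2 x u)) (m' u) = (\<Sum>v\<in>EU. PU (\<rho>2 x u) v * PW (m v) (m' u))" by simp
    qed
    also have "\<dots> = (\<Sum>v\<in>EU. \<Sum>u\<in>EU. PU (\<rho>2 x u) v * PW (m v) (m' u))" by (rule sum.swap)
    also have "\<dots> = (\<Sum>v\<in>EU. e * (\<Sum>u\<in>EU. PU (\<rho>2 x v) u * PW (m v) (m' u)))"
      unfolding sum_distrib_left
    proof (intro sum.cong refl)
      fix u v assume "v \<in> EU" "u \<in> EU"
      then have "PU (\<rho>2 x u) v = e * PU (\<rho>2 x v) u"
        using parU[OF x, of u v] U.ip_commute[of u "\<rho>2 x v"] V by simp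
      then show "PU (\<rho>2 x u) v * PW (m v) (m' u) = e * (PU (\<rho>2 x v) u * PW (m v) (m' u))" by simp
    qed
    also have "\<dots> = (\<Sum>v\<in>EU. e * PW (m v) (m' (\<rho>2 x v)))"
    proof (rule sum.cong[OF refl])
      fix u assume u: "u \<in> EU"
      have "lin_on U (\<lambda>x. PW (m u) (m' x))" using MD(1,2)[OF m(2)] V u
        by (simp add: lin_on_def W.ip_add_right W.ip_scale_right)
      from U.lin_expand[OF this U.\<rho>_in[OF xh U.EV[OF u]]]
      show "e * (\<Sum>v\<in>EU. PU (\<rho>2 x u) v * PW (m u) (m' v)) = e * PW (m u) (m' (\<rho>2 x u))" by simp
    qed
    finally have A: "(\<Sum>u\<in>EU. PW (m (\<rho>2 x u)) (m' u)) = (\<Sum>v\<in>EU. e * PW (m v) (m' (\<rho>2 x v)))" .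
    have "H (act x m) m' = (\<Sum>u\<in>EU. PW (\<rho>1 x (m u)) (m' u)) - (\<Sum>u\<in>EU. PW (m (\<rho>2 x u)) (m' u))"
      unfolding H_def sum_subtractf[symmetric] by (intro sum.cong refl) (simp add: act_def V W.ip_diff_left)
    also have "\<dots> = (\<Sum>u\<in>EU. e * PW (m u) (\<rho>1 x (m' u))) - (\<Sum>v\<in>EU. e * PW (m v) (m' (\<rho>2 x v)))"
      unfolding A using V by (simp add: parW[OF x])
    also have "\<dots> = e * H m (act x m')"
      unfolding H_def sum_subtractf[symmetric] sum_distrib_left
      by (intro sum.cong refl) (simp add: act_def V W.ip_diff_right right_diff_distrib)
    finally show ?thesis .
  qed
  define C where "C x = (\<lambda>u. if u \<in> U then c x u else 0)" for x
  have "\<exists>m\<in>M. \<forall>x\<in>h. C x = act x m"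
  proof (rule Hom.cocycle_is_coboundary[OF H parH])
    show "act A m = 0" if "A \<in> a" "m \<in> M" for A m
      using MD(4)[OF that(2,1)] by (auto simp: act_def)
    show "lin_on h C" using c(3) by (auto simp: lin_on_def C_def fun_eq_iff)
    show "C x \<in> M" if x: "x \<in> h" for x
      using c(1,2)[OF x] equiv[OF _ x] U.V_add U.V_scale U.\<rho>_in[OF a_sub]
      by (simp add: M_def C_def lin_on_def)
    show "C A = 0" if "A \<in> a" for A using ca[OF that] by (auto simp: C_def)
    show "C (br x y) = act x (C y) - act y (C x)" if "x \<in> h" "y \<in> h" for x y
      using cocycle[OF that] U.\<rho>_in that by (auto simp: C_def act_def fun_eq_iff)
  qed
  then obtain m where m: "m \<in> M" "\<And>x. x \<in> h \<Longrightarrow> C x = act x m" by blast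
  have "c x u = \<rho>1 x (m u) - m (\<rho>2 x u)" if "x \<in> h" "u \<in> U" for x u
    using fun_cong[OF m(2)[OF that(1)], of u] that(2) by (simp add: C_def act_def)
  then show ?thesis using MD(1,2)[OF m(1)] by blast
qed

end

section \<open>Existence of adapted inner products\<close>

lemma card_basis_less:
  fixes W V :: "'a::real_vector set"
  assumes "finite C" "independent C" "span C = W" "finite B" "independent B" "span B = V" "W \<subset> V"
  shows "card C < card B"
proof -
  obtain v where v: "v \<in> V" "v \<notin> W" using assms(7) by blast
  have vC: "v \<notin> C" using v(2) assms(3) span_base[of v C] by auto
  have "independent (insert v C)" using independent_insert[of v C] assms(2,3) v(2) vC by simp
  moreover have "insert v C \<subseteq> span B" using v(1) assms(3,6,7) span_superset[of C] by auto
  ultimately have "card (insert v C) \<le> card B" using independent_span_bound[OF assms(4)] by blast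
  then show ?thesis using vC assms(1) by simp
qed

context reductive begin

text \<open>
  Let \<open>U\<close> be the orthogonal complement of the submodule \<open>W\<close>. Normality makes it invariant under \<open>a\<close>. It
  carries the quotient module \<open>V / W\<close> as \<open>\<rho>2 x = \<tau> \<rho> x\<close> with the projection \<open>\<tau>\<close> onto \<open>U\<close>. The component of
  \<open>\<rho> x\<close> from \<open>U\<close> to \<open>W\<close> is an \<open>a\<close>-equivariant cocycle \<open>c\<close>, zero on \<open>a\<close>. If \<open>m\<close> splits it, then
  \<open>q = \<pi> + m \<tau>\<close> is a module map onto \<open>W\<close>, and \<open>V\<close> is the direct sum of \<open>W\<close> and \<open>U\<close> by means of \<open>q\<close> and \<open>\<tau>\<close>.
\<close>

lemma adapted_extension:
  assumes V: "euclid V ip" and mod: "lie_module h br V \<rho>"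
    and nor: "\<And>A. A \<in> a \<Longrightarrow> normal_on V ip (\<rho> A)"
    and W: "subspace W" "W \<subset> V" "W \<noteq> {0}" "\<And>x w. x \<in> h \<Longrightarrow> w \<in> W \<Longrightarrow> \<rho> x w \<in> W"
    and IH: "\<And>V' \<rho>'. subspace V' \<Longrightarrow> V' \<subset> V \<Longrightarrow> lie_module h br V' \<rho>' \<Longrightarrow>
      (\<And>A. A \<in> a \<Longrightarrow> normal_on V' ip (\<rho>' A)) \<Longrightarrow> \<exists>P. adapted V' \<rho>' P"
  shows "\<exists>P. adapted V \<rho> P"
proof -
  interpret euclid V ip by fact
  interpret V: reductive_module h br a parity G V \<rho> using mod by unfold_locales
  have WV: "W \<subseteq> V" using W(2) by blast
  obtain \<pi> where \<pi>: "lin_on V \<pi>" "\<And>x. x \<in> V \<Longrightarrow> \<pi> x \<in> W" "\<And>x. x \<in> W \<Longrightarrow> \<pi> x = x"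
    "\<And>x w. x \<in> V \<Longrightarrow> w \<in> W \<Longrightarrow> ip (x - \<pi> x) w = 0"
    using orthogonal_projection[OF W(1) WV] by blast
  have \<pi>V: "\<pi> x \<in> V" if "x \<in> V" for x using \<pi>(2)[OF that] WV by blast
  define U where "U = {x \<in> V. \<forall>w\<in>W. ip x w = 0}"
  define \<tau> where "\<tau> x = x - \<pi> x" for x
  have UV: "U \<subseteq> V" by (auto simp: U_def)
  have U: "subspace U"
    using V_0 V_add V_scale WV ip_0_left ip_add_left ip_scale_left by (auto simp: U_def subspace_def subset_iff)
  have \<tau>U: "\<tau> x \<in> U" if "x \<in> V" for x
    using that \<pi>(4)[OF that] V_diff[OF that \<pi>V[OF that]] by (simp add: U_def \<tau>_def)
  have \<pi>U: "\<pi> u = 0" if "u \<in> U" for u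
  proof -
    have u: "u \<in> V" using that UV by blast
    have p: "\<pi> u \<in> W" "\<pi> u \<in> V" using \<pi>(2)[OF u] \<pi>V[OF u] .
    have "ip (u - \<pi> u) (\<pi> u) = 0" "ip u (\<pi> u) = 0" using \<pi>(4)[OF u p(1)] that p(1) by (auto simp: U_def)
    then have "ip (\<pi> u) (\<pi> u) = 0" using u p(2) by (simp add: ip_diff_left)
    then show ?thesis using ip_self_0[OF p(2)] by simp
  qed
  have \<tau>W: "\<tau> w = 0" if "w \<in> W" for w using \<pi>(3)[OF that] by (simp add: \<tau>_def)
  have \<tau>id: "\<tau> u = u" if "u \<in> U" for u using \<pi>U[OF that] by (simp add: \<tau>_def)
  have \<tau>lin: "lin_on V \<tau>" using \<pi>(1) by (simp add: \<tau>_def lin_on_def scaleR_diff_right)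
  note \<rho>lin = lin_on_add[OF endo_lin[OF V.\<rho>_endo]] lin_on_diff[OF endo_lin[OF V.\<rho>_endo] sub]
    lin_on_scale[OF endo_lin[OF V.\<rho>_endo]]
  note \<pi>diff = lin_on_diff[OF \<pi>(1) sub] and \<pi>add = lin_on_add[OF \<pi>(1)]
  have split: "x = \<pi> x + \<tau> x" for x by (simp add: \<tau>_def)
  have "U \<subset> V"
  proof -
    obtain w where w: "w \<in> W" "w \<noteq> 0" using W(1,3) subspace_0 by blast
    then have "w \<notin> U" using \<pi>U[of w] \<pi>(3)[of w] by auto
    then show ?thesis using UV w WV by blast
  qed
  have aE: "endomorphism_on V (\<rho> A)" if "A \<in> a" for A using that by (intro V.\<rho>_endo a_sub)
  have aU: "\<rho> A u \<in> U" and aU': "adj (\<rho> A) u \<in> U" if A: "A \<in> a" and u: "u \<in> U" for A u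
  proof -
    have uV: "u \<in> V" using u UV by blast
    have 1: "adj (\<rho> A) w \<in> W" if "w \<in> W" for w
      using normal_adj_invariant[OF aE[OF A] nor[OF A] W(1) WV W(4)[OF a_sub[OF A]] that] .
    have wV: "w \<in> V" if "w \<in> W" for w using that WV by blast
    show "\<rho> A u \<in> U" unfolding U_def
      using endo_in[OF aE[OF A] uV] adj_right[OF aE[OF A] wV uV] 1 u by (simp add: U_def)
    show "adj (\<rho> A) u \<in> U" unfolding U_def
      using adj_in[OF aE[OF A] uV] adj_left[OF aE[OF A] uV wV] W(4)[OF a_sub[OF A]] u by (simp add: U_def)
  qed
  define \<rho>2 where "\<rho>2 x u = \<tau> (\<rho> x u)" for x u
  have \<rho>2in: "\<rho>2 x u \<in> U" if "x \<in> h" "u \<in> V" for x u unfolding \<rho>2_def by (intro \<tau>U V.\<rho>_in that)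
  have \<rho>2a: "\<rho>2 A u = \<rho> A u" if "A \<in> a" "u \<in> U" for A u unfolding \<rho>2_def using aU[OF that] by (rule \<tau>id)
  have \<tau>\<rho>: "\<tau> (\<rho> x v) = \<rho>2 x (\<tau> v)" if x: "x \<in> h" and v: "v \<in> V" for x v
  proof -
    have V: "\<pi> v \<in> V" "\<tau> v \<in> V" using \<pi>V[OF v] \<tau>U[OF v] UV by auto
    have "\<tau> (\<rho> x v) = \<tau> (\<rho> x (\<pi> v) + \<rho> x (\<tau> v))"
      using split[of v] \<rho>lin(1)[OF x V] by simp
    also have "\<dots> = \<tau> (\<rho> x (\<pi> v)) + \<tau> (\<rho> x (\<tau> v))"
      by (intro lin_on_add[OF \<tau>lin] V.\<rho>_in x V)
    also have "\<tau> (\<rho> x (\<pi> v)) = 0" by (intro \<tau>W W(4) x \<pi>(2) v)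
    finally show ?thesis by (simp add: \<rho>2_def)
  qed
  have modW: "lie_module h br W \<rho>"
    using mod W(4) WV by (auto simp: lie_module_def endomorphism_on_def subset_iff)
  have modU: "lie_module h br U \<rho>2"
    unfolding lie_module_def
  proof (intro conjI ballI)
    fix x assume x: "x \<in> h"
    show "endomorphism_on U (\<rho>2 x)"
      using V.\<rho>_endo[OF x] \<tau>lin UV \<rho>2in[OF x]
      by (simp add: endomorphism_on_def \<rho>2_def lin_on_def subset_iff)
  next
    fix u assume "u \<in> U"
    then have u: "u \<in> V" using UV by blast
    show "lin_on h (\<lambda>x. \<rho>2 x u)"
      using V.\<rho>_lin[OF u] \<tau>lin V.\<rho>_in[OF _ u] by (simp add: \<rho>2_def lin_on_def)
  next
    fix x y u assume x: "x \<in> h" and y: "y \<in> h" and "u \<in> U"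
    then have u: "u \<in> V" using UV by blast
    have "\<rho>2 (br x y) u = \<tau> (\<rho> x (\<rho> y u)) - \<tau> (\<rho> y (\<rho> x u))"
      unfolding \<rho>2_def V.\<rho>_br[OF x y u] by (intro lin_on_diff[OF \<tau>lin sub] V.\<rho>_in x y u)
    also have "\<dots> = \<rho>2 x (\<rho>2 y u) - \<rho>2 y (\<rho>2 x u)"
      using \<tau>\<rho>[OF x V.\<rho>_in[OF y u]] \<tau>\<rho>[OF y V.\<rho>_in[OF x u]] by (simp add: \<rho>2_def)
    finally show "\<rho>2 (br x y) u = \<rho>2 x (\<rho>2 y u) - \<rho>2 y (\<rho>2 x u)" .
  qed
  have norW: "normal_on W ip (\<rho> A)" if A: "A \<in> a" for A
  proof -
    interpret W: euclid W ip using euclid_axioms W(1) WV by (rule euclid_subspace)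
    show ?thesis
    proof (rule W.normal_onI[of _ "adj (\<rho> A)"])
      show "endomorphism_on W (\<rho> A)" using modW a_sub[OF A] by (simp add: lie_module_def)
      show "adj (\<rho> A) x \<in> W" if "x \<in> W" for x
        using normal_adj_invariant[OF aE[OF A] nor[OF A] W(1) WV W(4)[OF a_sub[OF A]] that] .
      show "ip (\<rho> A x) y = ip x (adj (\<rho> A) y)" if "x \<in> W" "y \<in> W" for x y
        using adj_right[OF aE[OF A] subsetD[OF WV that(2)] subsetD[OF WV that(1)]] by simp
      show "\<rho> A (adj (\<rho> A) x) = adj (\<rho> A) (\<rho> A x)" if "x \<in> W" for x
        using nor[OF A] that WV by (auto simp: normal_on_def)
    qed
  qed
  have norU: "normal_on U ip (\<rho>2 A)" if A: "A \<in> a" for A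
  proof -
    interpret U: euclid U ip using euclid_axioms U UV by (rule euclid_subspace)
    show ?thesis
    proof (rule U.normal_onI[of _ "adj (\<rho> A)"])
      show "endomorphism_on U (\<rho>2 A)" using modU a_sub[OF A] by (simp add: lie_module_def)
      show "adj (\<rho> A) x \<in> U" if "x \<in> U" for x using aU'[OF A that] .
      show "ip (\<rho>2 A x) y = ip x (adj (\<rho> A) y)" if "x \<in> U" "y \<in> U" for x y
        using adj_right[OF aE[OF A] subsetD[OF UV that(2)] subsetD[OF UV that(1)]] \<rho>2a[OF A that(1)] by simp
      show "\<rho>2 A (adj (\<rho> A) x) = adj (\<rho> A) (\<rho>2 A x)" if "x \<in> U" for x
        using nor[OF A] that UV \<rho>2a[OF A] aU'[OF A that] by (auto simp: normal_on_def)
    qed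
  qed
  obtain PW where PW: "adapted W \<rho> PW" using IH[OF W(1,2) modW norW] by blast
  obtain PU where PU: "adapted U \<rho>2 PU" using IH[OF U \<open>U \<subset> V\<close> modU norU] by blast
  have fW: "findim W" using findim_sub[OF findim W(1) WV] .
  have fU: "findim U" using findim_sub[OF findim U UV] .
  interpret W: euclid W PW using PW fW by (simp add: adapted_def euclid_def euclid_axioms_def)
  interpret U: euclid U PU using PU fU by (simp add: adapted_def euclid_def euclid_axioms_def)
  have parW: "PW (\<rho> x u) v = e * PW u (\<rho> x v)" if "parity x e" "u \<in> W" "v \<in> W" for x e u v
    using PW that by (simp add: adapted_def)
  have parU: "PU (\<rho>2 x u) v = e * PU u (\<rho>2 x v)" if "parity x e" "u \<in> U" "v \<in> U" for x e u v
    using PU that by (simp add: adapted_def)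
  define c where "c x u = \<pi> (\<rho> x u)" for x u
  have uV: "u \<in> V" if "u \<in> U" for u using that UV by blast
  have "\<exists>m. lin_on U m \<and> (\<forall>u\<in>U. m u \<in> W) \<and> (\<forall>x\<in>h. \<forall>u\<in>U. c x u = \<rho> x (m u) - m (\<rho>2 x u))"
  proof (rule hom_cocycle_splits[where c = c and U = U and W = W and PU = PU and PW = PW and ?\<rho>1.0 = \<rho> and ?\<rho>2.0 = \<rho>2])
    show "euclid W PW" "euclid U PU" by unfold_locales
    show "lie_module h br W \<rho>" "lie_module h br U \<rho>2" by (fact modW modU)+
    show "PW (\<rho> x u) v = e * PW u (\<rho> x v)" if "parity x e" "u \<in> W" "v \<in> W" for x e u v
      using parW that .
    show "PU (\<rho>2 x u) v = e * PU u (\<rho>2 x v)" if "parity x e" "u \<in> U" "v \<in> U" for x e u v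
      using parU that .
    show "lin_on U (c x)" if x: "x \<in> h" for x
      using V.\<rho>_endo[OF x] \<pi>(1) UV by (simp add: endomorphism_on_def c_def lin_on_def subset_iff)
    show "c x u \<in> W" if "x \<in> h" "u \<in> U" for x u
      unfolding c_def by (intro \<pi>(2) V.\<rho>_in that uV)
    show "lin_on h (\<lambda>x. c x u)" if "u \<in> U" for u
      using V.\<rho>_lin[OF uV[OF that]] \<pi>(1) V.\<rho>_in[OF _ uV[OF that]] by (simp add: c_def lin_on_def)
    show "c x (\<rho>2 A u) = \<rho> A (c x u)" if A: "A \<in> a" and x: "x \<in> h" and u: "u \<in> U" for A x u
    proof -
      have xu: "\<rho> x u \<in> V" by (intro V.\<rho>_in x uV u)
      have V: "\<pi> (\<rho> x u) \<in> V" "\<tau> (\<rho> x u) \<in> U" by (intro \<pi>V \<tau>U xu)+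
      have "\<rho> x (\<rho> A u) = \<rho> A (\<rho> x u)"
        using V.\<rho>_br[OF a_sub[OF A] x uV[OF u]] a_central[OF A x] lin_on_zero[OF V.\<rho>_lin[OF uV[OF u]] subspace_carrier]
        by simp
      then have "c x (\<rho>2 A u) = \<pi> (\<rho> A (\<rho> x u))" by (simp add: c_def \<rho>2a[OF A u])
      also have "\<rho> A (\<rho> x u) = \<rho> A (\<pi> (\<rho> x u)) + \<rho> A (\<tau> (\<rho> x u))"
        using split[of "\<rho> x u"] \<rho>lin(1)[OF a_sub[OF A] V(1) uV[OF V(2)]] by simp
      also have "\<pi> (\<rho> A (\<pi> (\<rho> x u)) + \<rho> A (\<tau> (\<rho> x u))) = \<pi> (\<rho> A (\<pi> (\<rho> x u))) + \<pi> (\<rho> A (\<tau> (\<rho> x u)))"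
        by (intro \<pi>add V.\<rho>_in a_sub A V uV)
      also have "\<pi> (\<rho> A (\<pi> (\<rho> x u))) = \<rho> A (\<pi> (\<rho> x u))" by (intro \<pi>(3) W(4) a_sub A \<pi>(2) xu)
      also have "\<pi> (\<rho> A (\<tau> (\<rho> x u))) = 0" by (intro \<pi>U aU A V)
      finally show ?thesis by (simp add: c_def)
    qed
    show "c A u = 0" if "A \<in> a" "u \<in> U" for A u unfolding c_def by (intro \<pi>U aU that)
    show "c (br x y) u = \<rho> x (c y u) - c y (\<rho>2 x u) - (\<rho> y (c x u) - c x (\<rho>2 y u))"
      if x: "x \<in> h" and y: "y \<in> h" and u: "u \<in> U" for x y u
    proof -
      have *: "\<pi> (\<rho> x (\<rho> y u)) = c x (\<rho>2 y u) + \<rho> x (c y u)" if x: "x \<in> h" and y: "y \<in> h" for x y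
      proof -
        have yu: "\<rho> y u \<in> V" by (intro V.\<rho>_in y uV u)
        have V: "\<pi> (\<rho> y u) \<in> V" "\<tau> (\<rho> y u) \<in> V" using \<pi>V[OF yu] uV[OF \<tau>U[OF yu]] .
        have "\<rho> x (\<rho> y u) = \<rho> x (\<pi> (\<rho> y u)) + \<rho> x (\<tau> (\<rho> y u))"
          using split[of "\<rho> y u"] \<rho>lin(1)[OF x V] by simp
        then have "\<pi> (\<rho> x (\<rho> y u)) = \<pi> (\<rho> x (\<pi> (\<rho> y u))) + \<pi> (\<rho> x (\<tau> (\<rho> y u)))"
          using \<pi>add[OF V.\<rho>_in[OF x V(1)] V.\<rho>_in[OF x V(2)]] by simp
        also have "\<pi> (\<rho> x (\<pi> (\<rho> y u))) = \<rho> x (\<pi> (\<rho> y u))" by (intro \<pi>(3) W(4) x \<pi>(2) yu)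
        finally show ?thesis by (simp add: c_def \<rho>2_def)
      qed
      have "c (br x y) u = \<pi> (\<rho> x (\<rho> y u)) - \<pi> (\<rho> y (\<rho> x u))"
        unfolding c_def V.\<rho>_br[OF x y uV[OF u]] by (intro \<pi>diff V.\<rho>_in x y uV u)
      then show ?thesis using *[OF x y] *[OF y x] by simp
    qed
  qed
  then obtain m where m: "lin_on U m" "\<And>u. u \<in> U \<Longrightarrow> m u \<in> W"
    "\<And>x u. x \<in> h \<Longrightarrow> u \<in> U \<Longrightarrow> \<pi> (\<rho> x u) = \<rho> x (m u) - m (\<rho>2 x u)"
    unfolding c_def by blast
  define q where "q v = \<pi> v + m (\<tau> v)" for v
  have qW: "q v \<in> W" if "v \<in> V" for v
    unfolding q_def using \<pi>(2)[OF that] m(2)[OF \<tau>U[OF that]] W(1) by (simp add: subspace_add)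
  have qlin: "lin_on V q"
    using \<pi>(1) \<tau>lin m(1) \<tau>U by (simp add: q_def lin_on_def scaleR_add_right)
  have q\<rho>: "q (\<rho> x v) = \<rho> x (q v)" if x: "x \<in> h" and v: "v \<in> V" for x v
  proof -
    have V: "\<pi> v \<in> V" "\<tau> v \<in> V" "\<tau> v \<in> U" "m (\<tau> v) \<in> V" 
      using \<pi>V[OF v] \<tau>U[OF v] UV m(2)[OF \<tau>U[OF v]] WV by auto
    have "\<pi> (\<rho> x v) = \<pi> (\<rho> x (\<pi> v) + \<rho> x (\<tau> v))"
      using split[of v] \<rho>lin(1)[OF x V(1,2)] by simp
    also have "\<dots> = \<pi> (\<rho> x (\<pi> v)) + \<pi> (\<rho> x (\<tau> v))" by (intro \<pi>add V.\<rho>_in x V)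
    also have "\<pi> (\<rho> x (\<pi> v)) = \<rho> x (\<pi> v)" by (intro \<pi>(3) W(4) x \<pi>(2) v)
    also have "\<pi> (\<rho> x (\<tau> v)) = \<rho> x (m (\<tau> v)) - m (\<rho>2 x (\<tau> v))" by (rule m(3)[OF x V(3)])
    finally have "q (\<rho> x v) = \<rho> x (\<pi> v) + \<rho> x (m (\<tau> v))"
      unfolding q_def \<tau>\<rho>[OF x v] by simp
    then show ?thesis using \<rho>lin(1)[OF x V(1,4)] by (simp add: q_def)
  qed
  define P where "P v v' = PW (q v) (q v') + PU (\<tau> v) (\<tau> v')" for v v'
  have ipP: "inner_product_on V P"
  proof
    fix v assume v: "v \<in> V" "v \<noteq> 0"
    show "P v v > 0"
    proof (cases "\<tau> v = 0")
      case True
      have "m 0 = 0" using lin_on_zero[OF m(1) U] .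
      then have "q v = v" using True by (simp add: q_def \<tau>_def)
      then have "PW (q v) (q v) > 0" using v qW[OF v(1)] by (simp add: W.ip_pos)
      then show ?thesis using U.ip_ge0[OF \<tau>U[OF v(1)]] by (simp add: P_def)
    next
      case False
      then have "PU (\<tau> v) (\<tau> v) > 0" using U.ip_pos[OF \<tau>U[OF v(1)]] by simp
      then show ?thesis using W.ip_ge0[OF qW[OF v(1)]] by (simp add: P_def)
    qed
  next
    fix x y assume "x \<in> V" "y \<in> V"
    then show "P x y = P y x" using W.ip_commute[OF qW qW] U.ip_commute[OF \<tau>U \<tau>U] by (simp add: P_def)
  qed (use qW \<tau>U qlin \<tau>lin in \<open>simp_all add: P_def lin_on_def W.ip_add_left U.ip_add_left W.ip_scale_left U.ip_scale_left algebra_simps\<close>)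
  interpret P: euclid V P using ipP findim by (simp add: euclid_def euclid_axioms_def)
  have "P (\<rho> x u) v = e * P u (\<rho> x v)" if x: "parity x e" and u: "u \<in> V" and v: "v \<in> V" for x e u v
  proof -
    have xh: "x \<in> h" using x by (rule parity_carrier)
    show ?thesis
      unfolding P_def q\<rho>[OF xh u] q\<rho>[OF xh v] \<tau>\<rho>[OF xh u] \<tau>\<rho>[OF xh v]
        parW[OF x qW[OF u] qW[OF v]] parU[OF x \<tau>U[OF u] \<tau>U[OF v]] by (simp add: distrib_left)
  qed
  moreover have "normal_on V P (\<rho> A)" if A: "A \<in> a" for A
  proof -
    have Ah: "A \<in> h" using A by (rule a_sub)
    have eW: "endomorphism_on W (\<rho> A)" using modW Ah by (simp add: lie_module_def)
    have eU: "endomorphism_on U (\<rho>2 A)" using modU Ah by (simp add: lie_module_def)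
    have nW: "normal_on W PW (\<rho> A)" and nU: "normal_on U PU (\<rho>2 A)"
      using PW PU A by (simp_all add: adapted_def)
    \<comment> \<open>The inverse of \<open>v \<mapsto> (q v, \<tau> v)\<close>, used to transport the adjoints from \<open>W\<close> and \<open>U\<close> to \<open>V\<close>.\<close>
    define mk where "mk y u = y - m u + u" for y u
    have mkV: "mk y u \<in> V" if "y \<in> W" "u \<in> U" for y u
      unfolding mk_def using that m(2)[OF that(2)] WV UV by (intro V_add V_diff) auto
    have \<tau>mk: "\<tau> (mk y u) = u" and qmk: "q (mk y u) = y" if y: "y \<in> W" and u: "u \<in> U" for y u
    proof -
      have V: "y - m u \<in> W" "y - m u \<in> V" "u \<in> V"
        using y u m(2)[OF u] W(1) WV UV by (auto intro: subspace_diff)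
      have 1: "\<pi> (mk y u) = y - m u"
        unfolding mk_def using \<pi>add[OF V(2,3)] \<pi>(3)[OF V(1)] \<pi>U[OF u] by simp
      then show 2: "\<tau> (mk y u) = u" by (simp add: \<tau>_def mk_def)
      then show "q (mk y u) = y" using 1 by (simp add: q_def)
    qed
    have inj: "v = v'" if "q v = q v'" "\<tau> v = \<tau> v'" for v v'
    proof -
      have "\<pi> v = \<pi> v'" using that by (simp add: q_def)
      then show ?thesis using split[of v] split[of v'] that(2) by simp
    qed
    define f' where "f' v = mk (W.adj (\<rho> A) (q v)) (U.adj (\<rho>2 A) (\<tau> v))" for v
    have aW: "W.adj (\<rho> A) (q v) \<in> W" and aU: "U.adj (\<rho>2 A) (\<tau> v) \<in> U" if "v \<in> V" for v
      using W.adj_in[OF eW qW[OF that]] U.adj_in[OF eU \<tau>U[OF that]] .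
    have f'V: "f' v \<in> V" if "v \<in> V" for v unfolding f'_def by (intro mkV aW aU that)
    have qf': "q (f' v) = W.adj (\<rho> A) (q v)" and \<tau>f': "\<tau> (f' v) = U.adj (\<rho>2 A) (\<tau> v)" if "v \<in> V" for v
      unfolding f'_def by (intro qmk \<tau>mk aW aU that)+
    show ?thesis
    proof (rule P.normal_onI[of _ f'])
      show "endomorphism_on V (\<rho> A)" by (rule V.\<rho>_endo[OF Ah])
      show "f' v \<in> V" if "v \<in> V" for v using f'V[OF that] .
      show "P (\<rho> A x) y = P x (f' y)" if x: "x \<in> V" and y: "y \<in> V" for x y
        unfolding P_def q\<rho>[OF Ah x] \<tau>\<rho>[OF Ah x] qf'[OF y] \<tau>f'[OF y]
          W.adj_right[OF eW qW[OF y] qW[OF x]] U.adj_right[OF eU \<tau>U[OF y] \<tau>U[OF x]] ..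
      show "\<rho> A (f' x) = f' (\<rho> A x)" if x: "x \<in> V" for x
      proof (rule inj)
        have Ax: "\<rho> A x \<in> V" by (rule V.\<rho>_in[OF Ah x])
        show "q (\<rho> A (f' x)) = q (f' (\<rho> A x))"
          unfolding q\<rho>[OF Ah f'V[OF x]] qf'[OF x] qf'[OF Ax] q\<rho>[OF Ah x]
          using nW qW[OF x] by (simp add: normal_on_def)
        show "\<tau> (\<rho> A (f' x)) = \<tau> (f' (\<rho> A x))"
          unfolding \<tau>\<rho>[OF Ah f'V[OF x]] \<tau>f'[OF x] \<tau>f'[OF Ax] \<tau>\<rho>[OF Ah x]
          using nU \<tau>U[OF x] by (simp add: normal_on_def)
      qed
    qed
  qed
  ultimately show ?thesis unfolding adapted_def using ipP by blast
qed

text \<open>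
  Induction on the dimension. The inner product \<open>ip\<close> serves only to make \<open>a\<close> act semisimply, a property
  that is inherited by submodules and their orthogonal complements.
\<close>

theorem module_adapted:
  assumes V: "euclid V ip" and mod: "lie_module h br V \<rho>"
    and nor: "\<And>A. A \<in> a \<Longrightarrow> normal_on V ip (\<rho> A)"
  shows "\<exists>P. adapted V \<rho> P"
proof -
  have "\<exists>P. adapted V \<rho> P"
    if "finite B" "independent B" "span B = V" "card B = n" "euclid V ip" "lie_module h br V \<rho>"
      "\<And>A. A \<in> a \<Longrightarrow> normal_on V ip (\<rho> A)" for n B V \<rho>
    using that
  proof (induction n arbitrary: B V \<rho> rule: less_induct)
    case (less n)
    note basis = less.prems(1-4) and V = less.prems(5) and mod = less.prems(6) and nor = less.prems(7)
    interpret euclid V ip by fact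
    interpret V: reductive_module h br a parity G V \<rho> using mod by unfold_locales
    show ?case
    proof (cases "V = {0}")
      case True
      have "P = 0" if "P = ip 0 0" for P using that ip_0_left[OF V_0] by simp
      moreover have "\<rho> x 0 = 0" if "x \<in> h" for x using V.\<rho>_in[OF that V_0] True by simp
      ultimately have "adapted V \<rho> ip"
        unfolding adapted_def using inner_product_on_axioms nor True parity_carrier by auto
      then show ?thesis by blast
    next
      case False
      show ?thesis
      proof (cases V.irreducible_module)
        case True
        then show ?thesis using V.irreducible_adapted[OF findim False] by simp
      next
        case False
        then obtain W where W: "subspace W" "W \<subseteq> V" "\<And>x w. x \<in> h \<Longrightarrow> w \<in> W \<Longrightarrow> \<rho> x w \<in> W" "W \<noteq> {0}" "W \<noteq> V"
          unfolding V.irreducible_module_def by blast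
        show ?thesis
        proof (rule adapted_extension[OF V mod nor W(1) _ W(4,3)])
          show "W \<subset> V" using W by blast
          fix V' \<rho>' assume V': "subspace V'" "V' \<subset> V" "lie_module h br V' \<rho>'"
            "\<And>A. A \<in> a \<Longrightarrow> normal_on V' ip (\<rho>' A)"
          have sub': "V' \<subseteq> V" using V'(2) by blast
          obtain C where C: "finite C" "independent C" "span C = V'"
            using findim_sub[OF findim V'(1) sub'] by (rule findim_basis)
          have "card C < n" using card_basis_less[OF C basis(1-3) V'(2)] basis(4) by simp
          then show "\<exists>P. adapted V' \<rho>' P"
            using less.IH[OF _ C refl euclid_subspace[OF V V'(1) sub'] V'(3,4)] by blast
        qed
      qed
    qed
  qed
  moreover obtain B where "finite B" "independent B" "span B = V"
    using V euclid.findim[of V ip] by (metis findim_basis)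
  ultimately show ?thesis using assms by blast
qed

end

section \<open>The Ricci form\<close>

context euclid begin

text \<open>
Existence by expansion in an orthonormal basis, uniqueness by polarisation.
\<close>

lemma symmetric_operator_form:
  fixes \<beta> :: "'a \<Rightarrow> 'a \<Rightarrow> real"
  assumes \<beta>: "bilin_on V \<beta>" and sym: "\<And>x y. x \<in> V \<Longrightarrow> y \<in> V \<Longrightarrow> \<beta> x y = \<beta> y x"
    and q: "\<And>x. x \<in> V \<Longrightarrow> q x = \<beta> x x" and x: "x \<in> V"
  shows "symmetric_operator V ip q x \<in> V" "ip (symmetric_operator V ip q x) x = q x"
proof -
  obtain E where "orthonormal_basis V ip E" using onb_exists by blast
  then interpret onb V ip E by unfold_locales
  let ?Q = "\<lambda>T. endomorphism_on V T \<and> (\<forall>x\<in>V. \<forall>y\<in>V. ip (T x) y = ip x (T y)) \<and>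
             (\<forall>x\<in>V. ip (T x) x = q x) \<and> (\<forall>x. x \<notin> V \<longrightarrow> T x = 0)"
  define T where "T x = (if x \<in> V then \<Sum>e\<in>E. \<beta> x e *\<^sub>R e else 0)" for x
  have TV: "T x \<in> V" if "x \<in> V" for x using that by (simp add: T_def V_sum V_scale EV)
  have T: "ip (T x) y = \<beta> x y" if "x \<in> V" "y \<in> V" for x y
  proof -
    have "ip (T x) y = (\<Sum>e\<in>E. \<beta> x e * ip e y)"
      using that EV unfolding T_def by (simp only: if_True) (intro ip_sums_left)
    also have "\<dots> = (\<Sum>e\<in>E. ip y e * \<beta> x e)"
    proof (rule sum.cong[OF refl])
      fix e assume "e \<in> E"
      then show "\<beta> x e * ip e y = ip y e * \<beta> x e" using ip_commute[OF EV that(2)] by simp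
    qed
    also have "\<dots> = \<beta> x y" using lin_expand[OF bilin_right[OF \<beta> that(1)] that(2)] by simp
    finally show ?thesis .
  qed
  have "endomorphism_on V T"
    using TV lin_on_add[OF bilin_left[OF \<beta> EV]] lin_on_scale[OF bilin_left[OF \<beta> EV]] V_add V_scale
    by (auto simp: endomorphism_on_def T_def scaleR_add_left sum.distrib scaleR_sum_right intro!: sum.cong)
  then have QT: "?Q T" using T sym q ip_commute TV by (auto simp: T_def[of "_"])
  have uniq: "T' = T" if "?Q T'" for T'
  proof
    fix x
    show "T' x = T x"
    proof (cases "x \<in> V")
      case True
      have T'V: "T' y \<in> V" if "y \<in> V" for y using \<open>?Q T'\<close> that by (simp add: endo_in)
      show ?thesis
      proof (rule ip_eqI)
        fix y assume y: "y \<in> V"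
        have xy: "x + y \<in> V" using True y by (rule V_add)
        have "T' (x + y) = T' x + T' y" using that True y by (simp add: endomorphism_on_def)
        moreover have "q (x + y) = ip (T' (x + y)) (x + y)" using that xy by metis
        ultimately have "q (x + y) = ip (T' x + T' y) (x + y)" by (simp only:)
        also have "\<dots> = ip (T' x) x + ip (T' x) y + (ip (T' y) x + ip (T' y) y)"
          using True y T'V xy by (simp add: ip_add_left ip_add_right V_add)
        also have "ip (T' y) x = ip (T' x) y" using that True y ip_commute[OF T'V[OF True] y] by simp
        also have "ip (T' x) x = q x" using that True by blast
        also have "ip (T' y) y = q y" using that y by blast
        finally have 1: "q (x + y) = q x + q y + 2 * ip (T' x) y" by simp
        have "q (x + y) = \<beta> x x + \<beta> y x + (\<beta> x y + \<beta> y y)"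
          using q[OF xy] lin_on_add[OF bilin_left[OF \<beta> xy] True y]
            lin_on_add[OF bilin_right[OF \<beta> True] True y] lin_on_add[OF bilin_right[OF \<beta> y] True y] by simp
        then have "ip (T' x) y = \<beta> x y" using 1 q True y sym[OF True y] by simp
        then show "ip (T' x) y = ip (T x) y" using T[OF True y] by simp
      qed (use TV T'V True in auto)
    next
      case False
      then show ?thesis using that QT by simp
    qed
  qed
  have "symmetric_operator V ip q = T"
    unfolding symmetric_operator_def by (rule the_equality) (fact QT, erule uniq)
  then show "symmetric_operator V ip q x \<in> V" "ip (symmetric_operator V ip q x) x = q x"
    using TV[OF x] T[OF x x] q[OF x] by simp_all
qed

end

context lie_algebra begin

lemma br_lin_left: "y \<in> L \<Longrightarrow> lin_on L (\<lambda>x. br x y)"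
  by (rule lin_onI) (simp_all add: br_add_left br_scale_left)

lemma br_lin_right: "x \<in> L \<Longrightarrow> lin_on L (br x)"
  by (rule lin_onI) (simp_all add: br_add_right br_scale_right)

lemma ad_endo: "x \<in> L \<Longrightarrow> endomorphism_on L (br x)"
  by (intro endoI br_lin_right br_closed)

lemma br_anti:
  assumes "x \<in> L" "y \<in> L" shows "br x y = - br y x"
proof -
  have xy: "x + y \<in> L" using assms subspace_carrier by (simp add: subspace_add)
  have "0 = br (x + y) (x + y)" using br_self[OF xy] by simp
  also have "\<dots> = br x y + br y x"
    unfolding br_add_left[OF assms xy] using assms by (simp add: br_add_right br_self)
  finally show ?thesis by (simp add: eq_neg_iff_add_eq_0)
qed

lemma ad_br:
  assumes "x \<in> L" "y \<in> L" "z \<in> L" shows "br (br x y) z = br x (br y z) - br y (br x z)"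
proof -
  have "br z (br x y) = - br (br x y) z" using assms by (intro br_anti br_closed)
  moreover have "br y (br z x) = - br y (br x z)"
    using br_anti[OF assms(3,1)] lin_on_minus[OF br_lin_right[OF assms(2)] br_closed[OF assms(1,3)]] by simp
  ultimately show ?thesis using jacobi[OF assms] by (simp add: algebra_simps)
qed

lemma findim_L: "findim L"
  using finite_dimensional unfolding findim_def .

lemma subalgebra_lie:
  assumes "lie_subalgebra L br K" shows "lie_algebra K br"
proof -
  have K: "subspace K" "K \<subseteq> L" "\<And>x y. x \<in> K \<Longrightarrow> y \<in> K \<Longrightarrow> br x y \<in> K"
    using assms by (auto simp: lie_subalgebra_def)
  show ?thesis
    using K(1) K(3) findim_sub[OF findim_L K(1,2)] subsetD[OF K(2)]
    by unfold_locales
      (simp_all add: findim_def br_add_left br_add_right br_scale_left br_scale_right br_self jacobi)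
qed

end

locale metric_lie_algebra = lie_algebra L br + onb L ip E for L :: "'a::real_vector set" and br ip E
begin

lemma ad_square_endo: "x \<in> L \<Longrightarrow> y \<in> L \<Longrightarrow> endomorphism_on L (\<lambda>z. br x (br y z))"
  by (rule endo_comp[OF ad_endo ad_endo])

lemma trace_ad_lin: "lin_on L (\<lambda>x. trace_on L (br x))"
proof (rule lin_onI)
  fix x y assume xy: "x \<in> L" "y \<in> L"
  then show "trace_on L (br (x + y)) = trace_on L (br x) + trace_on L (br y)"
    using EV by (simp add: trace_endo[OF ad_endo] V_add br_add_left ip_add_left br_closed sum.distrib)
next
  fix c x assume "x \<in> L"
  then show "trace_on L (br (c *\<^sub>R x)) = c *\<^sub>R trace_on L (br x)"
    using EV by (simp add: trace_endo[OF ad_endo] V_scale br_scale_left ip_scale_left br_closed sum_distrib_left)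
qed

lemma trace_ad_br:
  assumes "x \<in> L" "y \<in> L" shows "trace_on L (br (br x y)) = 0"
proof -
  have "trace_on L (br (br x y)) = (\<Sum>e\<in>E. ip (br x (br y e)) e) - (\<Sum>e\<in>E. ip (br y (br x e)) e)"
    using assms EV by (simp add: trace_endo[OF ad_endo] br_closed ad_br ip_diff_left sum_subtractf)
  then show ?thesis
    using trace_commute[OF ad_endo[OF assms(1)] ad_endo[OF assms(2)]]
      trace_endo[OF ad_square_endo[OF assms]] trace_endo[OF ad_square_endo[OF assms(2,1)]] by simp
qed

lemma trace_ad_derived:
  assumes x: "x \<in> span {br y z | y z. y \<in> K \<and> z \<in> K}" and K: "K \<subseteq> L"
  shows "trace_on L (br x) = 0"
  by (rule lin_on_derived_zero[OF trace_ad_lin trace_ad_br K x]) (use K in auto)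

lemma trace_form_bilin: "bilin_on L (\<lambda>x y. trace_on L (\<lambda>z. br x (br y z)))"
proof (intro bilin_onI lin_onI)
  show "trace_on L (\<lambda>z. br (x + x') (br y z)) = trace_on L (\<lambda>z. br x (br y z)) + trace_on L (\<lambda>z. br x' (br y z))"
    if "y \<in> L" "x \<in> L" "x' \<in> L" for x x' y
    using that EV
    by (simp add: trace_endo[OF ad_square_endo] V_add br_add_left ip_add_left br_closed sum.distrib)
  show "trace_on L (\<lambda>z. br (c *\<^sub>R x) (br y z)) = c *\<^sub>R trace_on L (\<lambda>z. br x (br y z))"
    if "y \<in> L" "x \<in> L" for x y c
    using that EV
    by (simp add: trace_endo[OF ad_square_endo] V_scale br_scale_left ip_scale_left br_closed sum_distrib_left)
  show "trace_on L (\<lambda>z. br x (br (y + y') z)) = trace_on L (\<lambda>z. br x (br y z)) + trace_on L (\<lambda>z. br x (br y' z))"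
    if "x \<in> L" "y \<in> L" "y' \<in> L" for x y y'
    using that EV
    by (simp add: trace_endo[OF ad_square_endo] V_add br_add_left br_add_right ip_add_left br_closed sum.distrib)
  show "trace_on L (\<lambda>z. br x (br (c *\<^sub>R y) z)) = c *\<^sub>R trace_on L (\<lambda>z. br x (br y z))"
    if "x \<in> L" "y \<in> L" for x y c
    using that EV
    by (simp add: trace_endo[OF ad_square_endo] V_scale br_scale_left br_scale_right ip_scale_left br_closed sum_distrib_left)
qed

lemma trace_form_sym: "x \<in> L \<Longrightarrow> y \<in> L \<Longrightarrow> trace_on L (\<lambda>z. br x (br y z)) = trace_on L (\<lambda>z. br y (br x z))"
  by (rule trace_commute[OF ad_endo ad_endo])

lemma killing_form_invariant:
  assumes x: "x \<in> L" and y: "y \<in> L" and z: "z \<in> L"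
  shows "killing_form L br (br x y) z = - killing_form L br y (br x z)"
proof -
  note e = ad_endo[OF x] ad_endo[OF y] ad_endo[OF z]
  have t: "trace_on L (\<lambda>w. br p (br q (br s w))) = (\<Sum>u\<in>E. ip (br p (br q (br s u))) u)"
    if "p \<in> L" "q \<in> L" "s \<in> L" for p q s
    by (rule trace_endo[OF endo_comp[OF ad_endo[OF that(1)] endo_comp[OF ad_endo[OF that(2)] ad_endo[OF that(3)]]]])
  have yx: "trace_on L (\<lambda>w. br y (br x (br z w))) = (\<Sum>u\<in>E. ip (br y (br x (br z u))) u)" by (rule t[OF y x z])
  have 1: "killing_form L br (br x y) z = (\<Sum>u\<in>E. ip (br x (br y (br z u))) u) - (\<Sum>u\<in>E. ip (br y (br x (br z u))) u)"
    unfolding killing_form_def using x y z EV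
    by (simp add: trace_endo[OF ad_square_endo] br_closed ad_br ip_diff_left sum_subtractf)
  have 2: "killing_form L br y (br x z) = (\<Sum>u\<in>E. ip (br y (br x (br z u))) u) - (\<Sum>u\<in>E. ip (br y (br z (br x u))) u)"
    unfolding killing_form_def using x y z EV
    by (simp add: trace_endo[OF ad_square_endo] br_closed ad_br lin_on_diff[OF br_lin_right sub] ip_diff_left sum_subtractf)
  have "(\<Sum>u\<in>E. ip (br x (br y (br z u))) u) = (\<Sum>u\<in>E. ip (br y (br z (br x u))) u)"
    using trace_commute[OF e(1) endo_comp[OF e(2,3)]] t[OF x y z] t[OF y z x] by simp
  then show ?thesis using 1 2 by simp
qed

lemma M_form_eq:
  assumes x: "x \<in> L"
  shows "M_form L br ip x = - (1/2) * (\<Sum>u\<in>E. \<Sum>v\<in>E. (ip (br x u) v)\<^sup>2)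
         + (1/4) * (\<Sum>u\<in>E. \<Sum>v\<in>E. (ip (br u v) x)\<^sup>2)"
proof -
  define F where "F = (SOME E. orthonormal_basis L ip E)"
  have F: "orthonormal_basis L ip F" unfolding F_def by (rule someI[of _ E]) (rule onb)
  interpret F: onb L ip F using F by unfold_locales
  have "(\<Sum>u\<in>F. \<Sum>v\<in>F. (ip (br x u) v)\<^sup>2) = (\<Sum>u\<in>F. ip (br x u) (br x u))"
    using x F.EV by (intro sum.cong refl) (simp add: F.parseval[OF br_closed br_closed] power2_eq_square)
  also have "\<dots> = (\<Sum>u\<in>E. ip (br x u) (br x u))"
    using x by (intro sum_onb_independent[OF _ F] bilin_onI lin_onI)
      (simp_all add: br_add_right br_scale_right ip_add_left ip_add_right ip_scale_left ip_scale_right br_closed)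
  also have "\<dots> = (\<Sum>u\<in>E. \<Sum>v\<in>E. (ip (br x u) v)\<^sup>2)"
    using x EV by (intro sum.cong refl) (simp add: parseval[OF br_closed br_closed] power2_eq_square)
  finally have 1: "(\<Sum>u\<in>F. \<Sum>v\<in>F. (ip (br x u) v)\<^sup>2) = (\<Sum>u\<in>E. \<Sum>v\<in>E. (ip (br x u) v)\<^sup>2)" .
  have "(\<Sum>u\<in>F. \<Sum>v\<in>F. (ip (br u v) x)\<^sup>2) = (\<Sum>u\<in>F. \<Sum>v\<in>E. (ip (br u v) x)\<^sup>2)"
    unfolding power2_eq_square
  proof (rule sum.cong[OF refl])
    fix u assume "u \<in> F"
    then have u: "u \<in> L" by (rule F.EV)
    show "(\<Sum>v\<in>F. ip (br u v) x * ip (br u v) x) = (\<Sum>v\<in>E. ip (br u v) x * ip (br u v) x)"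
      using x u by (intro sum_onb_independent[OF _ F] bilin_onI lin_onI)
        (simp_all add: br_add_right br_scale_right ip_add_left ip_scale_left br_closed algebra_simps)
  qed
  also have "\<dots> = (\<Sum>v\<in>E. \<Sum>u\<in>F. (ip (br u v) x)\<^sup>2)" by (rule sum.swap)
  also have "\<dots> = (\<Sum>v\<in>E. \<Sum>u\<in>E. (ip (br u v) x)\<^sup>2)"
    unfolding power2_eq_square
  proof (rule sum.cong[OF refl])
    fix v assume "v \<in> E"
    then have v: "v \<in> L" by (rule EV)
    show "(\<Sum>u\<in>F. ip (br u v) x * ip (br u v) x) = (\<Sum>u\<in>E. ip (br u v) x * ip (br u v) x)"
      using x v by (intro sum_onb_independent[OF _ F] bilin_onI lin_onI)
        (simp_all add: br_add_left br_scale_left ip_add_left ip_scale_left br_closed algebra_simps)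
  qed
  also have "\<dots> = (\<Sum>u\<in>E. \<Sum>v\<in>E. (ip (br u v) x)\<^sup>2)" by (rule sum.swap)
  finally have 2: "(\<Sum>u\<in>F. \<Sum>v\<in>F. (ip (br u v) x)\<^sup>2) = (\<Sum>u\<in>E. \<Sum>v\<in>E. (ip (br u v) x)\<^sup>2)" .
  show ?thesis unfolding M_form_def F_def[symmetric] Let_def 1 2 ..
qed

lemma mean_curvature_vector_eqI:
  assumes "h \<in> L" "\<And>x. x \<in> L \<Longrightarrow> ip h x = trace_on L (br x)"
  shows "mean_curvature_vector L br ip = h"
  unfolding mean_curvature_vector_def
proof (rule the_equality)
  show "h' = h" if "h' \<in> L \<and> (\<forall>x\<in>L. ip h' x = trace_on L (br x))" for h'
    using that assms by (intro ip_eqI) auto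
qed (use assms in auto)

text \<open>
  Only the quadratic form of the Ricci operator matters for its sign, so the operators in its definition
  are replaced by the forms that they represent.
\<close>

lemma ricci_form:
  assumes x: "x \<in> L" and H: "H \<in> L" "mean_curvature_vector L br ip = H"
  shows "ip (ricci_operator L br ip x) x = - (1/2) * (\<Sum>u\<in>E. \<Sum>v\<in>E. (ip (br x u) v)\<^sup>2)
         + (1/4) * (\<Sum>u\<in>E. \<Sum>v\<in>E. (ip (br u v) x)\<^sup>2)
         - (1/2) * trace_on L (\<lambda>z. br x (br x z)) - ip (br H x) x"
proof -
  define \<beta> where "\<beta> x y = - (1/2) * (\<Sum>u\<in>E. \<Sum>v\<in>E. ip (br x u) v * ip (br y u) v)
         + (1/4) * (\<Sum>u\<in>E. \<Sum>v\<in>E. ip (br u v) x * ip (br u v) y)" for x y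
  let ?M = "symmetric_operator L ip (M_form L br ip) x"
  let ?B = "symmetric_operator L ip (\<lambda>y. trace_on L (\<lambda>z. br y (br y z))) x"
  let ?S = "symmetric_part L ip (br H) x"
  have \<beta>_sym: "\<beta> x y = \<beta> y x" for x y by (simp add: \<beta>_def mult.commute)
  have "lin_on L (\<lambda>x. \<beta> x y)" if y: "y \<in> L" for y
  proof (rule lin_onI)
    fix x x' assume "x \<in> L" "x' \<in> L"
    then show "\<beta> (x + x') y = \<beta> x y + \<beta> x' y"
      using y EV by (simp add: \<beta>_def br_add_left ip_add_left ip_add_right br_closed distrib_right distrib_left sum.distrib)
  next
    fix c x assume "x \<in> L"
    then show "\<beta> (c *\<^sub>R x) y = c *\<^sub>R \<beta> x y"
      using y EV by (simp add: \<beta>_def br_scale_left ip_scale_left ip_scale_right br_closed distrib_left sum_distrib_left mult_ac)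
  qed
  then have \<beta>: "bilin_on L \<beta>" using \<beta>_sym by (intro bilin_onI) auto
  have q: "M_form L br ip x = \<beta> x x" if "x \<in> L" for x
    unfolding M_form_eq[OF that] by (simp add: \<beta>_def power2_eq_square)
  have M: "?M \<in> L" "ip ?M x = M_form L br ip x"
    using symmetric_operator_form[OF \<beta> \<beta>_sym q x] by simp_all
  have B: "?B \<in> L" "ip ?B x = trace_on L (\<lambda>z. br x (br x z))"
    using symmetric_operator_form[OF trace_form_bilin trace_form_sym refl x] by simp_all
  have e: "endomorphism_on L (br H)" using H(1) by (rule ad_endo)
  have S: "?S \<in> L" "ip ?S x = ip (br H x) x"
    using adj_in[OF e x] adj_left[OF e x x] ip_commute[OF x endo_in[OF e x]] x H(1)
    by (simp_all add: symmetric_part_def V_scale V_add br_closed ip_scale_left ip_add_left)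
  have "ip (ricci_operator L br ip x) x = ip ?M x - (1/2) * ip ?B x - ip ?S x"
    unfolding ricci_operator_def H(2) using M(1) B(1) S(1) x
    by (simp add: ip_diff_left V_diff V_scale ip_scale_left)
  then show ?thesis unfolding M(2) B(2) S(2) M_form_eq[OF x] by simp
qed

end

section \<open>Perfectness from a Cartan involution\<close>

text \<open>
  If \<open>z\<close> is orthogonal to \<open>[L, L]\<close> for the Cartan inner product \<open>P\<close>, then invariance of the Killing form
  makes \<open>ad (\<theta> z)\<close> vanish, and \<open>P z z = - tr (ad z ad (\<theta> z)) = 0\<close>.
\<close>

lemma cartan_derived:
  assumes L: "lie_algebra L br" and c: "cartan_involution L br \<theta>" and x: "x \<in> L"
  shows "x \<in> span {br y z | y z. y \<in> L \<and> z \<in> L}"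
proof -
  interpret lie_algebra L br by fact
  define P where "P x y = - killing_form L br x (\<theta> y)" for x y
  have "inner_product_on L P" using c unfolding P_def cartan_involution_def by blast
  then interpret euclid L P using findim_L by (simp add: euclid_def euclid_axioms_def)
  obtain E where "orthonormal_basis L P E" using onb_exists by blast
  then interpret metric_lie_algebra L br P E by unfold_locales
  have \<theta>: "endomorphism_on L \<theta>" "\<And>x. x \<in> L \<Longrightarrow> \<theta> (\<theta> x) = x" using c by (auto simp: cartan_involution_def)
  define D where "D = span {br y z | y z. y \<in> L \<and> z \<in> L}"
  have DL: "D \<subseteq> L" unfolding D_def using br_closed sub by (intro span_minimal) auto
  have subD: "subspace D" by (simp add: D_def)
  obtain \<pi> where \<pi>: "\<And>x. x \<in> L \<Longrightarrow> \<pi> x \<in> D" "\<And>x w. x \<in> L \<Longrightarrow> w \<in> D \<Longrightarrow> P (x - \<pi> x) w = 0"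
    using orthogonal_projection[OF subD DL] by metis
  define z where "z = x - \<pi> x"
  have zL: "z \<in> L" unfolding z_def using x \<pi>(1)[OF x] DL by (intro V_diff) auto
  have z0: "P z w = 0" if "w \<in> D" for w unfolding z_def by (rule \<pi>(2)[OF x that])
  have tz: "\<theta> z \<in> L" using \<theta>(1) zL by (rule endo_in)
  have "br y (\<theta> z) = 0" if y: "y \<in> L" for y
  proof -
    define w where "w = br y (\<theta> z)"
    have wL: "w \<in> L" unfolding w_def by (intro br_closed y tz)
    have tw: "\<theta> w \<in> L" using \<theta>(1) wL by (rule endo_in)
    have "killing_form L br (\<theta> w) w = - killing_form L br (br y (\<theta> w)) (\<theta> z)"
      using killing_form_invariant[OF y tw tz] by (simp add: w_def)
    also have "\<dots> = P (br y (\<theta> w)) z" by (simp add: P_def)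
    also have "\<dots> = P z (br y (\<theta> w))" by (intro ip_commute br_closed y tw zL)
    also have "\<dots> = 0" using y tw by (intro z0) (auto simp: D_def intro!: span_base)
    finally have "killing_form L br w (\<theta> w) = 0"
      unfolding killing_form_def using trace_form_sym[OF wL tw] by simp
    then have "P w w = 0" by (simp add: P_def)
    then show ?thesis using ip_self_0[OF wL] by (simp add: w_def)
  qed
  then have 0: "br (\<theta> z) y = 0" if "y \<in> L" for y using br_anti[OF tz that] that by simp
  have "trace_on L (\<lambda>y. br z (br (\<theta> z) y)) = (\<Sum>e\<in>E. P (br z (br (\<theta> z) e)) e)"
    by (rule trace_endo[OF ad_square_endo[OF zL tz]])
  also have "\<dots> = 0"
    using 0 EV lin_on_zero[OF br_lin_right[OF zL] sub] ip_0_left by (intro sum.neutral ballI) simp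
  finally have "P z z = 0" by (simp add: P_def killing_form_def)
  then have "z = 0" using ip_self_0[OF zL] by simp
  then have "x = \<pi> x" by (simp add: z_def)
  then show ?thesis using \<pi>(1)[OF x] by (simp add: D_def)
qed

section \<open>Orthogonal direct sums\<close>

lemma direct_sum_subspace: "direct_sum V U W \<Longrightarrow> subspace V"
  using subspace_sums by (force simp: direct_sum_def)

lemma direct_sum_projections:
  assumes "direct_sum V U W"
  obtains p q where "lin_on V p" "lin_on V q" "\<And>x. x \<in> V \<Longrightarrow> p x \<in> U \<and> q x \<in> W \<and> x = p x + q x"
    "\<And>u. u \<in> U \<Longrightarrow> p u = u \<and> q u = 0" "\<And>w. w \<in> W \<Longrightarrow> p w = 0 \<and> q w = w"
proof -
  have U: "subspace U" and W: "subspace W" and int: "U \<inter> W = {0}" and V: "V = {u + w | u w. u \<in> U \<and> w \<in> W}"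
    using assms unfolding direct_sum_def by blast+
  have uniq: "u = u' \<and> w = w'" if "u \<in> U" "w \<in> W" "u' \<in> U" "w' \<in> W" "u + w = u' + w'" for u w u' w'
  proof -
    have "u - u' = w' - w" using that(5) by (simp add: algebra_simps)
    moreover have "u - u' \<in> U" "w' - w \<in> W"
      by (rule subspace_diff[OF U that(1,3)], rule subspace_diff[OF W that(4,2)])
    ultimately have "u - u' \<in> U \<inter> W" "w' - w \<in> U \<inter> W" by simp_all
    then show ?thesis unfolding int by simp
  qed
  have "\<forall>x\<in>V. \<exists>p. fst p \<in> U \<and> snd p \<in> W \<and> x = fst p + snd p" unfolding V by force
  then obtain f where f: "\<And>x. x \<in> V \<Longrightarrow> fst (f x) \<in> U \<and> snd (f x) \<in> W \<and> x = fst (f x) + snd (f x)"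
    by metis
  have eq: "fst (f (u + w)) = u \<and> snd (f (u + w)) = w" if "u \<in> U" "w \<in> W" for u w
  proof -
    have "u + w \<in> V" using that V by blast
    then show ?thesis using uniq[of "fst (f (u+w))" "snd (f (u+w))" u w] f[of "u+w"] that by auto
  qed
  have add: "f (x + y) = f x + f y" if "x \<in> V" "y \<in> V" for x y
  proof -
    have "x + y = (fst (f x) + fst (f y)) + (snd (f x) + snd (f y))"
      using f[OF that(1)] f[OF that(2)] by (metis add.assoc add.left_commute)
    then show ?thesis
      using eq[of "fst (f x) + fst (f y)" "snd (f x) + snd (f y)"] f[OF that(1)] f[OF that(2)] U W
      by (simp add: subspace_add prod_eq_iff)
  qed
  have scale: "f (c *\<^sub>R x) = c *\<^sub>R f x" if "x \<in> V" for c x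
  proof -
    have "c *\<^sub>R x = c *\<^sub>R fst (f x) + c *\<^sub>R snd (f x)"
      using f[OF that] by (metis scaleR_add_right)
    then show ?thesis
      using eq[of "c *\<^sub>R fst (f x)" "c *\<^sub>R snd (f x)"] f[OF that] U W by (simp add: subspace_scale prod_eq_iff)
  qed
  show ?thesis
  proof
    show "lin_on V (\<lambda>x. fst (f x))" "lin_on V (\<lambda>x. snd (f x))"
      using add scale by (auto simp: lin_on_def)
    show "fst (f x) \<in> U \<and> snd (f x) \<in> W \<and> x = fst (f x) + snd (f x)" if "x \<in> V" for x using f[OF that] .
    show "fst (f u) = u \<and> snd (f u) = 0" if "u \<in> U" for u using eq[OF that subspace_0[OF W]] by simp
    show "fst (f w) = 0 \<and> snd (f w) = w" if "w \<in> W" for w using eq[OF subspace_0[OF U] that] by simp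
  qed
qed

lemma orthogonal_sum:
  assumes d: "direct_sum V U W" and U: "onb U P1 E1" and W: "onb W P2 E2"
  obtains ip where "onb V ip (E1 \<union> E2)" "E1 \<inter> E2 = {}"
    "\<And>x y. x \<in> U \<Longrightarrow> y \<in> U \<Longrightarrow> ip x y = P1 x y" "\<And>x y. x \<in> W \<Longrightarrow> y \<in> W \<Longrightarrow> ip x y = P2 x y"
    "\<And>x y. x \<in> U \<Longrightarrow> y \<in> W \<Longrightarrow> ip x y = 0" "\<And>x y. x \<in> W \<Longrightarrow> y \<in> U \<Longrightarrow> ip x y = 0"
proof -
  interpret U: onb U P1 E1 by fact
  interpret W: onb W P2 E2 by fact
  obtain p q where pq: "lin_on V p" "lin_on V q" "\<And>x. x \<in> V \<Longrightarrow> p x \<in> U \<and> q x \<in> W \<and> x = p x + q x"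
    "\<And>u. u \<in> U \<Longrightarrow> p u = u \<and> q u = 0" "\<And>w. w \<in> W \<Longrightarrow> p w = 0 \<and> q w = w"
    using direct_sum_projections[OF d] by blast
  have UV: "U \<subseteq> V" and WV: "W \<subseteq> V"
    using d U.V_0 W.V_0 by (force simp: direct_sum_def)+
  have subV: "subspace V" using d by (rule direct_sum_subspace)
  define ip where "ip x y = P1 (p x) (p y) + P2 (q x) (q y)" for x y
  have spanE: "span (E1 \<union> E2) = V"
  proof
    show "span (E1 \<union> E2) \<subseteq> V" using UV WV U.EV W.EV by (intro span_minimal subV) auto
    show "V \<subseteq> span (E1 \<union> E2)"
    proof
      fix x assume "x \<in> V"
      then have x: "p x \<in> span E1" "q x \<in> span E2" "x = p x + q x" using pq(3) U.spanE W.spanE by auto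
      have "p x \<in> span (E1 \<union> E2)" "q x \<in> span (E1 \<union> E2)"
        using x(1,2) span_mono[of E1 "E1 \<union> E2"] span_mono[of E2 "E1 \<union> E2"] by auto
      then have "p x + q x \<in> span (E1 \<union> E2)" by (rule span_add)
      then show "x \<in> span (E1 \<union> E2)" using x(3) by simp
    qed
  qed
  have vals: "ip x y = P1 x y" if "x \<in> U" "y \<in> U" for x y
    using pq(4)[OF that(1)] pq(4)[OF that(2)] W.ip_0_left[OF W.V_0] by (simp add: ip_def)
  have vals2: "ip x y = P2 x y" if "x \<in> W" "y \<in> W" for x y
    using pq(5)[OF that(1)] pq(5)[OF that(2)] U.ip_0_left[OF U.V_0] by (simp add: ip_def)
  have vals3: "ip x y = 0" "ip y x = 0" if "x \<in> U" "y \<in> W" for x y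
    using pq(4)[OF that(1)] pq(5)[OF that(2)] U.ip_0_left[OF that(1)] U.ip_0_right[OF that(1)] 
      W.ip_0_left[OF that(2)] W.ip_0_right[OF that(2)] by (simp_all add: ip_def)
  have disj: "E1 \<inter> E2 = {}"
  proof -
    have False if "e \<in> E1" "e \<in> E2" for e
    proof -
      have "e \<in> U \<inter> W" using that U.EV W.EV by blast
      then have "e = 0" using d by (auto simp: direct_sum_def)
      then show False using U.ip_E[OF that(1,1)] U.ip_0_left[OF U.V_0] by simp
    qed
    then show ?thesis by blast
  qed
  have "inner_product_on V ip"
  proof
    fix x assume x: "x \<in> V" "x \<noteq> 0"
    have "p x \<noteq> 0 \<or> q x \<noteq> 0" using pq(3)[OF x(1)] x(2) by auto
    then show "ip x x > 0"
      using U.ip_pos[of "p x"] W.ip_pos[of "q x"] U.ip_ge0[of "p x"] W.ip_ge0[of "q x"] pq(3)[OF x(1)]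
      unfolding ip_def by fastforce
  next
    fix x y assume "x \<in> V" "y \<in> V"
    then show "ip x y = ip y x"
      using pq(3) U.ip_commute[of "p x" "p y"] W.ip_commute[of "q x" "q y"] by (simp add: ip_def)
  next
    fix x y z assume "x \<in> V" "y \<in> V" "z \<in> V"
    then show "ip (x + y) z = ip x z + ip y z"
      using pq(3) U.ip_add_left[of "p x" "p y" "p z"] W.ip_add_left[of "q x" "q y" "q z"] lin_on_add[OF pq(1)] lin_on_add[OF pq(2)]
      by (simp add: ip_def)
  next
    fix c x y assume "x \<in> V" "y \<in> V"
    then show "ip (c *\<^sub>R x) y = c * ip x y"
      using pq(3) U.ip_scale_left[of "p x" "p y" c] W.ip_scale_left[of "q x" "q y" c] lin_on_scale[OF pq(1)] lin_on_scale[OF pq(2)]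
      by (simp add: ip_def distrib_left)
  qed
  moreover have "findim V" using spanE U.finE W.finE by (intro findimI[of "E1 \<union> E2"]) auto
  moreover have "orthonormal_basis V ip (E1 \<union> E2)"
    unfolding orthonormal_basis_def
  proof (intro conjI ballI)
    fix x y assume xy: "x \<in> E1 \<union> E2" "y \<in> E1 \<union> E2"
    consider "x \<in> E1" "y \<in> E1" | "x \<in> E2" "y \<in> E2" | "x \<in> E1" "y \<in> E2" | "x \<in> E2" "y \<in> E1" using xy by blast
    then show "ip x y = (if x = y then 1 else 0)"
      by cases (use vals vals2 vals3 U.EV W.EV U.ip_E W.ip_E disj in auto)
  qed (use U.finE W.finE spanE in auto)
  ultimately have "onb V ip (E1 \<union> E2)" by (simp add: onb_def onb_axioms_def euclid_def euclid_axioms_def)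
  then show ?thesis using that disj vals vals2 vals3 by blast
qed

section \<open>The Ricci form of the semidirect product\<close>

text \<open>
  The sums over the orthonormal basis are split into the blocks of \<open>a + r\<close> and \<open>n\<close>. With
  \<open>N = \<Sum> |[u, X]|\<^sup>2\<close> over the basis of \<open>a + r\<close>, the first sum contributes \<open>- 1/2 N\<close>. The mixed brackets in the
  second sum contribute \<open>1/4 * 2 N\<close> by normality, which cancels it. For \<open>D = ad Z\<close> on \<open>n\<close>, the terms
  \<open>|D|\<^sup>2\<close> and \<open>tr D\<^sup>2\<close> combine to \<open>1/2 |D + D\<^sup>t|\<^sup>2\<close>. Normality enters in the form that row and column
  norms of each basis element agree.
\<close>

lemma semidirect_ricci_form:
  fixes a r n g :: "'a::real_vector set"
  assumes g: "metric_lie_algebra g br ip ((Ea \<union> Er) \<union> En)"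
    and disj: "Ea \<inter> Er = {}" "(Ea \<union> Er) \<inter> En = {}"
    and a: "onb a ip Ea" "a \<subseteq> g" and r: "onb r ip Er" "r \<subseteq> g" and n: "onb n ip En" "n \<subseteq> g"
    and orth: "\<And>x y. x \<in> a \<Longrightarrow> y \<in> r \<Longrightarrow> ip x y = 0" "\<And>x y. x \<in> a \<Longrightarrow> y \<in> n \<Longrightarrow> ip x y = 0"
      "\<And>x y. x \<in> r \<Longrightarrow> y \<in> n \<Longrightarrow> ip x y = 0"
    and r_closed: "\<And>x y. x \<in> r \<Longrightarrow> y \<in> r \<Longrightarrow> br x y \<in> r"
    and n_ideal: "\<And>x y. x \<in> g \<Longrightarrow> y \<in> n \<Longrightarrow> br x y \<in> n"
    and central: "\<And>x y. x \<in> a \<Longrightarrow> y \<in> a \<union> r \<Longrightarrow> br x y = 0"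
    and normal: "\<And>u x. u \<in> Ea \<union> Er \<Longrightarrow> x \<in> n \<Longrightarrow> (\<Sum>v\<in>En. (ip (br u v) x)\<^sup>2) = ip (br u x) (br u x)"
    and H: "H \<in> a" "mean_curvature_vector g br ip = H"
    and A: "A \<in> a" and Y: "Y \<in> r" and X: "X \<in> n" and Z: "Z = A + Y + X"
  shows "ip (ricci_operator g br ip Z) Z =
     (- (1/2) * (\<Sum>u\<in>Er. \<Sum>v\<in>Er. (ip (br Y u) v)\<^sup>2) + (1/4) * (\<Sum>u\<in>Er. \<Sum>v\<in>Er. (ip (br u v) Y)\<^sup>2)
       - (1/2) * trace_on r (\<lambda>z. br Y (br Y z)))
     - (1/4) * (\<Sum>u\<in>En. \<Sum>v\<in>En. (ip (br Z u) v + ip (br Z v) u)\<^sup>2)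
     + (1/4) * (\<Sum>u\<in>En. \<Sum>v\<in>En. (ip (br u v) X)\<^sup>2) - ip (br H X) X"
proof -
  interpret metric_lie_algebra g br ip "(Ea \<union> Er) \<union> En" by fact
  interpret a: onb a ip Ea by fact
  interpret r: onb r ip Er by fact
  interpret n: onb n ip En by fact
  have ag: "x \<in> a \<Longrightarrow> x \<in> g" and rg: "x \<in> r \<Longrightarrow> x \<in> g" and ng: "x \<in> n \<Longrightarrow> x \<in> g" for x
    using a(2) r(2) n(2) by blast+
  have orth': "ip y x = 0" if "x \<in> a" "y \<in> r" for x y using orth(1)[OF that] ip_commute[OF ag rg, OF that] by simp
  have orth2': "ip y x = 0" if "x \<in> a" "y \<in> n" for x y using orth(2)[OF that] ip_commute[OF ag ng, OF that] by simp
  have orth3': "ip y x = 0" if "x \<in> r" "y \<in> n" for x y using orth(3)[OF that] ip_commute[OF rg ng, OF that] by simp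
  have Zg: "Z \<in> g" unfolding Z using ag[OF A] rg[OF Y] ng[OF X] by (intro V_add)
  have rZ: "ip w Z = ip w Y" if "w \<in> r" for w
    unfolding Z using that ag[OF A] rg[OF Y] ng[OF X] rg[OF that] orth'[OF A that] orth(3)[OF that X]
    by (simp add: ip_add_right V_add)
  have nZ: "ip w Z = ip w X" if "w \<in> n" for w
    unfolding Z using that ag[OF A] rg[OF Y] ng[OF X] ng[OF that] orth2'[OF A that] orth3'[OF Y that]
    by (simp add: ip_add_right V_add)
  have brZ: "br Z u = br A u + br Y u + br X u" if "u \<in> g" for u
    unfolding Z using that ag[OF A] rg[OF Y] ng[OF X] by (simp add: br_add_left V_add)
  have Xu: "br X u = - br u X" if "u \<in> g" for u using br_anti[OF ng[OF X] that] .
  have Za: "br Z u = - br u X" if "u \<in> a" for u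
  proof -
    have "br Y u = - br u Y" using br_anti[OF rg[OF Y] ag[OF that]] .
    then have "br Y u = 0" using central[OF that, of Y] Y by simp
    then show ?thesis using brZ[OF ag[OF that]] central[OF A, of u] that Xu[OF ag[OF that]] by simp
  qed
  have Zr: "br Z u = br Y u - br u X" if "u \<in> r" for u
    using brZ[OF rg[OF that]] central[OF A, of u] that Xu[OF rg[OF that]] by simp
  have uX: "br u X \<in> n" if "u \<in> g" for u using n_ideal[OF that X] .
  have Zn: "br Z u \<in> n" if "u \<in> n" for u using n_ideal[OF Zg that] .
  define Eh where "Eh = Ea \<union> Er"
  have fin: "finite Ea" "finite Er" "finite En" "finite Eh" using a.finE r.finE n.finE by (simp_all add: Eh_def)
  have Eh_g: "u \<in> g" if "u \<in> Eh" for u using that a.EV r.EV ag rg by (auto simp: Eh_def)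
  have split: "(\<Sum>u\<in>(Ea \<union> Er) \<union> En. f u) = (\<Sum>u\<in>Eh. f u) + (\<Sum>u\<in>En. f u)" for f :: "'a \<Rightarrow> real"
    unfolding Eh_def using fin disj(2) by (intro sum.union_disjoint) auto
  have splith: "(\<Sum>u\<in>Eh. f u) = (\<Sum>u\<in>Ea. f u) + (\<Sum>u\<in>Er. f u)" for f :: "'a \<Rightarrow> real"
    unfolding Eh_def using fin disj(1) by (intro sum.union_disjoint) auto
  define N where "N = (\<Sum>u\<in>Eh. ip (br u X) (br u X))"
  define RR where "RR = (\<Sum>u\<in>Er. \<Sum>v\<in>Er. (ip (br Y u) v)\<^sup>2)"
  define DD where "DD = (\<Sum>u\<in>En. \<Sum>v\<in>En. (ip (br Z u) v)\<^sup>2)"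

  have term1: "(\<Sum>u\<in>(Ea \<union> Er) \<union> En. \<Sum>v\<in>(Ea \<union> Er) \<union> En. (ip (br Z u) v)\<^sup>2) = RR + N + DD"
  proof -
    have "(\<Sum>u\<in>(Ea \<union> Er) \<union> En. \<Sum>v\<in>(Ea \<union> Er) \<union> En. (ip (br Z u) v)\<^sup>2)
        = (\<Sum>u\<in>(Ea \<union> Er) \<union> En. ip (br Z u) (br Z u))"
    proof (rule sum.cong[OF refl])
      fix u assume "u \<in> (Ea \<union> Er) \<union> En"
      then have "br Z u \<in> g" using EV Zg by (intro br_closed)
      from parseval[OF this this]
      show "(\<Sum>v\<in>(Ea \<union> Er) \<union> En. (ip (br Z u) v)\<^sup>2) = ip (br Z u) (br Z u)" by (simp only: power2_eq_square)
    qed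
    also have "\<dots> = (\<Sum>u\<in>Ea. ip (br Z u) (br Z u)) + (\<Sum>u\<in>Er. ip (br Z u) (br Z u)) + (\<Sum>u\<in>En. ip (br Z u) (br Z u))"
      unfolding split splith ..
    also have "(\<Sum>u\<in>Ea. ip (br Z u) (br Z u)) = (\<Sum>u\<in>Ea. ip (br u X) (br u X))"
    proof (rule sum.cong[OF refl])
      fix u assume "u \<in> Ea"
      then have u: "u \<in> a" by (rule a.EV)
      have "br u X \<in> g" using ng[OF uX[OF ag[OF u]]] .
      then show "ip (br Z u) (br Z u) = ip (br u X) (br u X)"
        unfolding Za[OF u] by (simp add: ip_minus_left ip_minus_right V_neg)
    qed
    also have "(\<Sum>u\<in>Er. ip (br Z u) (br Z u)) = RR + (\<Sum>u\<in>Er. ip (br u X) (br u X))"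
      unfolding RR_def sum.distrib[symmetric]
    proof (rule sum.cong[OF refl])
      fix u assume "u \<in> Er"
      then have u: "u \<in> r" by (rule r.EV)
      have V: "br Y u \<in> r" "br Y u \<in> g" "br u X \<in> n" "br u X \<in> g"
        using r_closed[OF Y u] uX[OF rg[OF u]] rg ng by auto
      have "ip (br Z u) (br Z u) = ip (br Y u) (br Y u) + ip (br u X) (br u X)"
        unfolding Zr[OF u] using V orth(3)[OF V(1,3)] orth3'[OF V(1,3)]
        by (simp add: ip_diff_left ip_diff_right V_diff)
      then show "ip (br Z u) (br Z u) = (\<Sum>v\<in>Er. (ip (br Y u) v)\<^sup>2) + ip (br u X) (br u X)"
        unfolding r.parseval[OF V(1,1)] power2_eq_square .
    qed
    also have "(\<Sum>u\<in>En. ip (br Z u) (br Z u)) = DD"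
      unfolding DD_def power2_eq_square by (intro sum.cong refl n.parseval Zn n.EV)
    finally show ?thesis unfolding N_def splith by simp
  qed
  define QQ where "QQ = (\<Sum>u\<in>Er. \<Sum>v\<in>Er. (ip (br u v) Y)\<^sup>2)"
  define NN where "NN = (\<Sum>u\<in>En. \<Sum>v\<in>En. (ip (br u v) X)\<^sup>2)"
  have term2: "(\<Sum>u\<in>(Ea \<union> Er) \<union> En. \<Sum>v\<in>(Ea \<union> Er) \<union> En. (ip (br u v) Z)\<^sup>2) = QQ + 2 * N + NN"
  proof -
    have hh: "(\<Sum>u\<in>Eh. \<Sum>v\<in>Eh. (ip (br u v) Z)\<^sup>2) = QQ"
    proof -
      have z: "(ip (br u v) Z)\<^sup>2 = 0" if uv: "u \<in> Ea \<and> v \<in> Eh \<or> u \<in> Eh \<and> v \<in> Ea" for u v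
      proof -
        have "br u v = 0"
          using uv
        proof
          assume "u \<in> Ea \<and> v \<in> Eh"
          then show ?thesis using a.EV r.EV by (intro central) (auto simp: Eh_def)
        next
          assume *: "u \<in> Eh \<and> v \<in> Ea"
          then have "br v u = 0" using a.EV r.EV by (intro central) (auto simp: Eh_def)
          moreover have "v \<in> g" using * by (simp add: Eh_g Eh_def)
          ultimately show ?thesis using br_anti[of u v] Eh_g * by simp
        qed
        then show ?thesis using ip_0_left[OF Zg] by simp
      qed
      have "(\<Sum>u\<in>Eh. \<Sum>v\<in>Eh. (ip (br u v) Z)\<^sup>2) = (\<Sum>u\<in>Er. \<Sum>v\<in>Eh. (ip (br u v) Z)\<^sup>2)"
        unfolding splith[of "\<lambda>u. \<Sum>v\<in>Eh. (ip (br u v) Z)\<^sup>2"] using z by (simp add: sum.neutral)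
      also have "\<dots> = (\<Sum>u\<in>Er. \<Sum>v\<in>Er. (ip (br u v) Z)\<^sup>2)"
      proof (rule sum.cong[OF refl])
        fix u assume "u \<in> Er"
        then have "(\<Sum>v\<in>Ea. (ip (br u v) Z)\<^sup>2) = 0" by (intro sum.neutral ballI z) (simp add: Eh_def)
        then show "(\<Sum>v\<in>Eh. (ip (br u v) Z)\<^sup>2) = (\<Sum>v\<in>Er. (ip (br u v) Z)\<^sup>2)" unfolding splith by simp
      qed
      also have "\<dots> = QQ" unfolding QQ_def by (intro sum.cong refl) (simp add: rZ r_closed r.EV)
      finally show ?thesis .
    qed
    have hn: "(\<Sum>u\<in>Eh. \<Sum>v\<in>En. (ip (br u v) Z)\<^sup>2) = N"
      unfolding N_def
    proof (rule sum.cong[OF refl])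
      fix u assume u: "u \<in> Eh"
      have "(\<Sum>v\<in>En. (ip (br u v) Z)\<^sup>2) = (\<Sum>v\<in>En. (ip (br u v) X)\<^sup>2)"
        by (intro sum.cong refl) (simp add: nZ n_ideal n.EV Eh_g[OF u])
      then show "(\<Sum>v\<in>En. (ip (br u v) Z)\<^sup>2) = ip (br u X) (br u X)"
        using normal[OF _ X, of u] u by (simp add: Eh_def)
    qed
    have nh: "(\<Sum>u\<in>En. \<Sum>v\<in>Eh. (ip (br u v) Z)\<^sup>2) = N"
    proof -
      have "(\<Sum>u\<in>En. \<Sum>v\<in>Eh. (ip (br u v) Z)\<^sup>2) = (\<Sum>u\<in>En. \<Sum>v\<in>Eh. (ip (br v u) Z)\<^sup>2)"
      proof (intro sum.cong refl)
        fix u v assume "u \<in> En" "v \<in> Eh"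
        then have V: "u \<in> g" "v \<in> g" using ng[OF n.EV] Eh_g by auto
        show "(ip (br u v) Z)\<^sup>2 = (ip (br v u) Z)\<^sup>2"
          unfolding br_anti[OF V] using ip_minus_left[OF Zg br_closed[OF V(2,1)]] by simp
      qed
      also have "\<dots> = (\<Sum>v\<in>Eh. \<Sum>u\<in>En. (ip (br v u) Z)\<^sup>2)" by (rule sum.swap)
      finally show ?thesis using hn by simp
    qed
    have nn: "(\<Sum>u\<in>En. \<Sum>v\<in>En. (ip (br u v) Z)\<^sup>2) = NN"
      unfolding NN_def by (intro sum.cong refl) (simp add: nZ n_ideal n.EV ng)
    show ?thesis unfolding split sum.distrib hh hn nh nn by simp
  qed
  define TT where "TT = (\<Sum>u\<in>En. \<Sum>v\<in>En. ip (br Z u) v * ip (br Z v) u)"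
  have term3: "trace_on g (\<lambda>z. br Z (br Z z)) = trace_on r (\<lambda>z. br Y (br Y z)) + TT"
  proof -
    have "trace_on g (\<lambda>z. br Z (br Z z)) = (\<Sum>u\<in>Ea. ip (br Z (br Z u)) u) + (\<Sum>u\<in>Er. ip (br Z (br Z u)) u)
        + (\<Sum>u\<in>En. ip (br Z (br Z u)) u)"
      unfolding trace_endo[OF ad_square_endo[OF Zg Zg]] split splith ..
    also have "(\<Sum>u\<in>Ea. ip (br Z (br Z u)) u) = 0"
    proof (rule sum.neutral, rule ballI)
      fix u assume "u \<in> Ea"
      then have u: "u \<in> a" by (rule a.EV)
      have "- br u X \<in> n" using n.V_neg[OF uX[OF ag[OF u]]] .
      then have "br Z (br Z u) \<in> n" unfolding Za[OF u] by (rule Zn)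
      then show "ip (br Z (br Z u)) u = 0" using orth2'[OF u] by simp
    qed
    also have "(\<Sum>u\<in>Er. ip (br Z (br Z u)) u) = (\<Sum>u\<in>Er. ip (br Y (br Y u)) u)"
    proof (rule sum.cong[OF refl])
      fix u assume "u \<in> Er"
      then have u: "u \<in> r" by (rule r.EV)
      have V: "br Y u \<in> r" "br u X \<in> n" "br Y (br Y u) \<in> r" using r_closed[OF Y] u uX[OF rg[OF u]] by auto
      have 1: "br (br Y u) X \<in> n" "br Z (br u X) \<in> n" using uX[OF rg[OF V(1)]] Zn[OF V(2)] .
      have "br Z (br Z u) = br Z (br Y u) - br Z (br u X)"
        unfolding Zr[OF u] by (rule lin_on_diff[OF br_lin_right[OF Zg] sub rg[OF V(1)] ng[OF V(2)]])
      also have "br Z (br Y u) = br Y (br Y u) - br (br Y u) X" by (rule Zr[OF V(1)])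
      finally have "ip (br Z (br Z u)) u = ip (br Y (br Y u)) u - ip (br (br Y u) X) u - ip (br Z (br u X)) u"
        using rg[OF u] rg[OF V(3)] ng[OF 1(1)] ng[OF 1(2)] by (simp add: ip_diff_left V_diff)
      then show "ip (br Z (br Z u)) u = ip (br Y (br Y u)) u"
        using orth3'[OF u 1(1)] orth3'[OF u 1(2)] by simp
    qed
    also have "\<dots> = trace_on r (\<lambda>z. br Y (br Y z))"
    proof (rule r.trace_endo[symmetric])
      show "endomorphism_on r (\<lambda>z. br Y (br Y z))"
        using endo_lin[OF ad_square_endo[OF rg[OF Y] rg[OF Y]]] r_closed[OF Y] rg
        by (intro endoI) (auto simp: lin_on_def)
    qed
    also have "(\<Sum>u\<in>En. ip (br Z (br Z u)) u) = TT"
      unfolding TT_def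
    proof (rule sum.cong[OF refl])
      fix u assume u: "u \<in> En"
      have "lin_on n (\<lambda>x. ip (br Z x) u)"
        using lin_on_add[OF br_lin_right[OF Zg]] lin_on_scale[OF br_lin_right[OF Zg]] Zn n.EV[OF u] ng
        by (intro lin_onI) (simp_all add: n.ip_add_left n.ip_scale_left)
      from n.lin_expand[OF this Zn[OF n.EV[OF u]]]
      show "ip (br Z (br Z u)) u = (\<Sum>v\<in>En. ip (br Z u) v * ip (br Z v) u)" by simp
    qed
    finally show ?thesis by simp
  qed
  have term4: "ip (br H Z) Z = ip (br H X) X"
  proof -
    have "br H Z = br H A + br H Y + br H X"
      unfolding Z using ag[OF A] rg[OF Y] ng[OF X] ag[OF H(1)] by (simp add: br_add_right V_add)
    also have "\<dots> = br H X" using central[OF H(1), of A] central[OF H(1), of Y] A Y by simp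
    finally show ?thesis using nZ[OF uX[OF ag[OF H(1)]]] by simp
  qed
  have sq: "(\<Sum>u\<in>En. \<Sum>v\<in>En. (ip (br Z u) v + ip (br Z v) u)\<^sup>2) = 2 * DD + 2 * TT"
  proof -
    have "(\<Sum>u\<in>En. \<Sum>v\<in>En. (ip (br Z u) v + ip (br Z v) u)\<^sup>2)
        = (\<Sum>u\<in>En. \<Sum>v\<in>En. (ip (br Z u) v)\<^sup>2 + (ip (br Z v) u)\<^sup>2 + 2 * (ip (br Z u) v * ip (br Z v) u))"
      by (simp add: power2_sum mult.assoc)
    also have "\<dots> = DD + (\<Sum>u\<in>En. \<Sum>v\<in>En. (ip (br Z v) u)\<^sup>2) + 2 * TT"
      by (simp only: sum.distrib sum_distrib_left[symmetric] DD_def TT_def)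
    also have "(\<Sum>u\<in>En. \<Sum>v\<in>En. (ip (br Z v) u)\<^sup>2) = DD" unfolding DD_def by (rule sum.swap)
    finally show ?thesis by simp
  qed
  show ?thesis
    unfolding ricci_form[OF Zg ag[OF H(1)] H(2)] term1 term2 term3 term4 sq
    unfolding RR_def[symmetric] QQ_def[symmetric] NN_def[symmetric] by (simp add: algebra_simps)
qed

section \<open>Cartan decompositions and adapted bases\<close>

lemma (in euclid) onb_orthogonal_union:
  assumes K: "subspace K" "K \<subseteq> V" and P: "subspace P" "P \<subseteq> V"
    and sum: "\<And>x. x \<in> V \<Longrightarrow> \<exists>y\<in>K. \<exists>z\<in>P. x = y + z"
    and orth: "\<And>y z. y \<in> K \<Longrightarrow> z \<in> P \<Longrightarrow> ip y z = 0"
  obtains EK EP where "EK \<subseteq> K" "EP \<subseteq> P" "orthonormal_basis V ip (EK \<union> EP)"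
proof -
  obtain EK where EK: "EK \<subseteq> K" "orthonormal_basis K ip EK" using onb_subspace[OF K] by blast
  obtain EP where EP: "EP \<subseteq> P" "orthonormal_basis P ip EP" using onb_subspace[OF P] by blast
  have orth': "ip z y = 0" if "y \<in> K" "z \<in> P" for y z
    using orth[OF that] ip_commute[of z y] that K P by auto
  have ne: "x \<noteq> y" if "x \<in> EK" "y \<in> EP" for x y
  proof
    assume "x = y"
    then have "ip x x = 0" using orth[of x y] that EK(1) EP(1) by blast
    moreover have "ip x x = 1" using EK(2) that(1) by (simp add: orthonormal_basis_def)
    ultimately show False by simp
  qed
  have "orthonormal_basis V ip (EK \<union> EP)"
    unfolding orthonormal_basis_def
  proof (intro conjI ballI)
    show "finite (EK \<union> EP)" using EK EP by (simp add: orthonormal_basis_def)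
    have span: "span EK = K" "span EP = P" using EK EP by (simp_all add: orthonormal_basis_def)
    show "span (EK \<union> EP) = V"
    proof
      show "span (EK \<union> EP) \<subseteq> V" using EK(1) EP(1) K(2) P(2) sub by (intro span_minimal) auto
      show "V \<subseteq> span (EK \<union> EP)"
      proof
        fix x assume "x \<in> V"
        then obtain y z where "y \<in> span EK" "z \<in> span EP" "x = y + z" using sum span by blast
        then show "x \<in> span (EK \<union> EP)"
          using span_mono[of EK "EK \<union> EP"] span_mono[of EP "EK \<union> EP"] by (auto intro!: span_add)
      qed
    qed
    fix x y assume xy: "x \<in> EK \<union> EP" "y \<in> EK \<union> EP"
    consider "x \<in> EK" "y \<in> EK" | "x \<in> EP" "y \<in> EP" | "x \<in> EK" "y \<in> EP" | "x \<in> EP" "y \<in> EK" using xy by blast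
    then show "ip x y = (if x = y then 1 else 0)"
    proof cases
      case 1 then show ?thesis using EK(2) by (simp add: orthonormal_basis_def)
    next
      case 2 then show ?thesis using EP(2) by (simp add: orthonormal_basis_def)
    next
      case 3 then show ?thesis using orth[of x y] EK(1) EP(1) ne[OF 3] by auto
    next
      case 4 then show ?thesis using orth'[of y x] EK(1) EP(1) ne[OF 4(2,1)] by auto
    qed
  qed
  then show ?thesis using that EK(1) EP(1) by blast
qed

lemma onb_cong:
  assumes "onb V P E" "\<And>x y. x \<in> V \<Longrightarrow> y \<in> V \<Longrightarrow> P' x y = P x y"
  shows "onb V P' E"
proof -
  interpret onb V P E by fact
  have "inner_product_on V P'"
    by unfold_locales (simp_all add: assms(2) V_add V_scale ip_add_left ip_scale_left ip_add_right ip_scale_right ip_pos ip_commute)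
  moreover have "orthonormal_basis V P' E"
    using finE spanE ip_E EV assms(2) by (simp add: orthonormal_basis_def)
  ultimately show ?thesis using findim by (simp add: onb_def onb_axioms_def euclid_def euclid_axioms_def)
qed

text \<open>
  The sign is minus the eigenvalue of \<open>\<theta>\<close>, because elements fixed by \<open>\<theta>\<close> have to act as skew operators.
\<close>

definition cartan_parity :: "'a::real_vector set \<Rightarrow> ('a \<Rightarrow> 'a) \<Rightarrow> 'a \<Rightarrow> real \<Rightarrow> bool" where
  "cartan_parity r \<theta> x e \<longleftrightarrow> x \<in> r \<and> (\<theta> x = x \<and> e = -1 \<or> \<theta> x = - x \<and> e = 1)"

lemma cartan_eigenspaces:
  assumes "endomorphism_on r \<theta>" "subspace r" "\<And>x. x \<in> r \<Longrightarrow> \<theta> (\<theta> x) = x"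
  shows "subspace {x \<in> r. \<theta> x = x}" "subspace {x \<in> r. \<theta> x = - x}"
    "\<And>x. x \<in> r \<Longrightarrow> \<exists>y\<in>{x \<in> r. \<theta> x = x}. \<exists>z\<in>{x \<in> r. \<theta> x = - x}. x = y + z"
proof -
  note lin = lin_on_zero[OF endo_lin[OF assms(1)] assms(2)] lin_on_add[OF endo_lin[OF assms(1)]]
    lin_on_scale[OF endo_lin[OF assms(1)]] lin_on_diff[OF endo_lin[OF assms(1)] assms(2)]
  note cl = subspace_0[OF assms(2)] subspace_add[OF assms(2)] subspace_scale[OF assms(2)] subspace_diff[OF assms(2)]
  show "subspace {x \<in> r. \<theta> x = x}" "subspace {x \<in> r. \<theta> x = - x}"
    by (simp_all add: subspace_def lin cl)
  fix x assume x: "x \<in> r"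
  have tx: "\<theta> x \<in> r" using assms(1) x by (rule endo_in)
  have "(1/2) *\<^sub>R (x + \<theta> x) \<in> {x \<in> r. \<theta> x = x}" "(1/2) *\<^sub>R (x - \<theta> x) \<in> {x \<in> r. \<theta> x = - x}"
    using x tx assms(3)[OF x] by (simp_all add: lin cl add.commute flip: scaleR_minus_right)
  moreover have "x = (1/2) *\<^sub>R (x + \<theta> x) + (1/2) *\<^sub>R (x - \<theta> x)"
    by (simp add: scaleR_add_right[symmetric] scaleR_2[symmetric])
  ultimately show "\<exists>y\<in>{x \<in> r. \<theta> x = x}. \<exists>z\<in>{x \<in> r. \<theta> x = - x}. x = y + z" by blast
qed

text \<open>
  For the Cartan inner product the adjoint of \<open>ad x\<close> is \<open>- ad (\<theta> x)\<close>, by invariance of the Killing form.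
  So \<open>ad x\<close> has a skew or symmetric matrix in an orthonormal basis of \<open>r\<close>, and it kills \<open>a\<close>.
\<close>

lemma cartan_reductive:
  assumes g: "lie_algebra g br" and ar: "direct_sum ar a r" "ar \<subseteq> g"
    and r: "lie_subalgebra g br r" and central: "\<And>x y. x \<in> a \<Longrightarrow> y \<in> ar \<Longrightarrow> br x y = 0"
    and \<theta>: "cartan_involution r br \<theta>"
  shows "\<exists>G. reductive ar br a (cartan_parity r \<theta>) G"
proof -
  interpret g: lie_algebra g br by fact
  have sa: "subspace a" and sr: "subspace r" and int: "a \<inter> r = {0}" and
    ar_eq: "ar = {u + w | u w. u \<in> a \<and> w \<in> r}"
    using ar(1) unfolding direct_sum_def by blast+
  have rg: "r \<subseteq> g" and rcl: "\<And>x y. x \<in> r \<Longrightarrow> y \<in> r \<Longrightarrow> br x y \<in> r" using r by (auto simp: lie_subalgebra_def)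
  have sar: "subspace ar" using ar(1) by (rule direct_sum_subspace)
  have aar: "a \<subseteq> ar" unfolding ar_eq using subspace_0[OF sr] by force
  have rar: "r \<subseteq> ar" unfolding ar_eq using subspace_0[OF sa] by force
  have ag: "a \<subseteq> g" using aar ar(2) by blast
  interpret r: lie_algebra r br using g.subalgebra_lie[OF r] .
  have "br x y \<in> ar" if x: "x \<in> ar" and y: "y \<in> ar" for x y
  proof -
    obtain A Y where A: "x = A + Y" "A \<in> a" "Y \<in> r" using x ar_eq by blast
    obtain A' Y' where A': "y = A' + Y'" "A' \<in> a" "Y' \<in> r" using y ar_eq by blast
    have V: "A \<in> g" "Y \<in> g" "A' \<in> g" "Y' \<in> g" "y \<in> g" using A A' ag rg y ar(2) by auto
    have Yar: "Y \<in> ar" using A(3) rar by blast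
    have "br x y = br A y + br Y y" unfolding A(1) using V by (simp add: g.br_add_left)
    also have "br A y = 0" using central[OF A(2) y] .
    also have "br Y y = br Y A' + br Y Y'" unfolding A'(1) using V by (simp add: g.br_add_right)
    also have "br Y A' = 0" using g.br_anti[OF V(2,3)] central[OF A'(2) Yar] by simp
    finally show ?thesis using rcl[OF A(3) A'(3)] rar by auto
  qed
  then have "lie_subalgebra g br ar" using sar ar(2) by (simp add: lie_subalgebra_def)
  then interpret ar: lie_algebra ar br by (rule g.subalgebra_lie)
  have \<theta>e: "endomorphism_on r \<theta>" and \<theta>\<theta>: "\<And>x. x \<in> r \<Longrightarrow> \<theta> (\<theta> x) = x"
    and \<theta>br: "\<And>x y. x \<in> r \<Longrightarrow> y \<in> r \<Longrightarrow> \<theta> (br x y) = br (\<theta> x) (\<theta> y)"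
    using \<theta> by (auto simp: cartan_involution_def)
  define P where "P x y = - killing_form r br x (\<theta> y)" for x y
  have "inner_product_on r P" using \<theta> unfolding P_def cartan_involution_def by blast
  then interpret euclid r P using r.findim_L by (simp add: euclid_def euclid_axioms_def)
  have kp: "P y z = 0" if y: "y \<in> {x \<in> r. \<theta> x = x}" and z: "z \<in> {x \<in> r. \<theta> x = - x}" for y z
  proof -
    obtain E where "orthonormal_basis r P E" using onb_exists by blast
    then interpret metric_lie_algebra r br P E by unfold_locales
    have V: "y \<in> r" "z \<in> r" "\<theta> y = y" "\<theta> z = - z" using y z by auto
    have "killing_form r br y (- z) = - killing_form r br y z"
      using lin_on_minus[OF bilin_right[OF trace_form_bilin V(1)] V(2)] by (simp add: killing_form_def)
    then have "P y z = killing_form r br y z" using V by (simp add: P_def)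
    moreover have "P z y = - killing_form r br y z"
      using V trace_form_sym[OF V(1,2)] by (simp add: P_def killing_form_def)
    moreover have "P y z = P z y" using V(1,2) by (rule ip_commute)
    ultimately show ?thesis by simp
  qed
  obtain EK EP where ER: "EK \<subseteq> {x \<in> r. \<theta> x = x}" "EP \<subseteq> {x \<in> r. \<theta> x = - x}" "orthonormal_basis r P (EK \<union> EP)"
    using onb_orthogonal_union[OF cartan_eigenspaces(1)[OF \<theta>e sr \<theta>\<theta>] _ cartan_eigenspaces(2)[OF \<theta>e sr \<theta>\<theta>] _
      cartan_eigenspaces(3)[OF \<theta>e sr \<theta>\<theta>] kp] by blast
  define R where "R = EK \<union> EP"
  interpret metric_lie_algebra r br P R using ER(3) unfolding R_def by unfold_locales
  have "findim a" using findim_sub[OF g.findim_L sa ag] .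
  then obtain A0 where A0: "finite A0" "independent A0" "span A0 = a" by (rule findim_basis)
  have A0a: "x \<in> a" if "x \<in> A0" for x using A0(3) that span_base[of x A0] by simp
  have disj: "A0 \<inter> R = {}"
  proof -
    have False if "x \<in> A0" "x \<in> R" for x
    proof -
      have "x \<in> a \<inter> r" using A0a[OF that(1)] EV[OF that(2)] by blast
      then have "x = 0" unfolding int by simp
      then show False using A0(2) that(1) dependent_zero by blast
    qed
    then show ?thesis by blast
  qed
  have inv: "P (br x y) z = e * P (br x z) y" if x: "cartan_parity r \<theta> x e" and y: "y \<in> r" and z: "z \<in> r" for x e y z
  proof -
    have xr: "x \<in> r" and ee: "\<theta> x = (- e) *\<^sub>R x" using x by (auto simp: cartan_parity_def)
    have tz: "\<theta> z \<in> r" "\<theta> x \<in> r" using \<theta>e z xr by (auto intro: endo_in)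
    have "P (br x y) z = killing_form r br y (br x (\<theta> z))"
      using killing_form_invariant[OF xr y tz(1)] by (simp add: P_def)
    also have "br x (\<theta> z) = \<theta> (br (\<theta> x) z)" using \<theta>br[OF tz(2) z] \<theta>\<theta>[OF xr] by simp
    also have "killing_form r br y \<dots> = - P y (br (\<theta> x) z)" by (simp add: P_def)
    also have "br (\<theta> x) z = (- e) *\<^sub>R br x z" unfolding ee by (rule r.br_scale_left[OF xr z])
    also have "P y \<dots> = - e * P y (br x z)" by (intro ip_scale_right rcl xr z y)
    also have "P y (br x z) = P (br x z) y" by (intro ip_commute rcl xr z y)
    finally show ?thesis by simp
  qed
  have "reductive ar br a (cartan_parity r \<theta>) (A0 \<union> R)"
  proof
    show "A \<in> ar" if "A \<in> a" for A using that aar by blast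
    show "br A x = 0" if "A \<in> a" "x \<in> ar" for A x using central[OF that] .
    show "x \<in> ar" if "cartan_parity r \<theta> x e" for x e using that rar by (auto simp: cartan_parity_def)
    show "e * e = 1" if "cartan_parity r \<theta> x e" for x e using that by (auto simp: cartan_parity_def)
    show "x \<in> span {br y z | y z. y \<in> ar \<and> z \<in> ar}" if "cartan_parity r \<theta> x e" for x e
    proof -
      have "x \<in> span {br y z | y z. y \<in> r \<and> z \<in> r}"
        using cartan_derived[OF r.lie_algebra_axioms \<theta>] that by (auto simp: cartan_parity_def)
      moreover have "{br y z | y z. y \<in> r \<and> z \<in> r} \<subseteq> {br y z | y z. y \<in> ar \<and> z \<in> ar}" using rar by blast
      ultimately show ?thesis using span_mono by blast
    qed
    show "finite (A0 \<union> R)" using A0(1) finE by simp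
    show "span (A0 \<union> R) = ar"
    proof
      show "span (A0 \<union> R) \<subseteq> ar" using A0a EV aar rar by (intro span_minimal sar) auto
      show "ar \<subseteq> span (A0 \<union> R)"
      proof
        fix x assume "x \<in> ar"
        then obtain A Y where "x = A + Y" "A \<in> span A0" "Y \<in> span R" using ar_eq A0(3) spanE by blast
        then show "x \<in> span (A0 \<union> R)"
          using span_mono[of A0 "A0 \<union> R"] span_mono[of R "A0 \<union> R"] by (auto intro!: span_add)
      qed
    qed
    show "g \<in> a \<or> (\<exists>e. cartan_parity r \<theta> g e)" if "g \<in> A0 \<union> R" for g
      using that A0a ER(1,2) by (auto simp: R_def cartan_parity_def)
    fix x e assume x: "cartan_parity r \<theta> x e"
    have xr: "x \<in> r" using x by (simp add: cartan_parity_def)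
    define s where "s g g' = (if g \<in> R \<and> g' \<in> R then P (br x g) g' else 0)" for g g'
    have "br x g = (\<Sum>g'\<in>A0 \<union> R. s g g' *\<^sub>R g')" if g: "g \<in> A0 \<union> R" for g
    proof (cases "g \<in> R")
      case True
      have "(\<Sum>g'\<in>A0 \<union> R. s g g' *\<^sub>R g') = (\<Sum>g'\<in>R. s g g' *\<^sub>R g')"
        using A0(1) finE disj by (intro sum.mono_neutral_right) (auto simp: s_def)
      also have "\<dots> = (\<Sum>g'\<in>R. P (br x g) g' *\<^sub>R g')" using True by (simp add: s_def)
      also have "\<dots> = br x g" by (rule expand) (intro rcl xr EV True)
      finally show ?thesis ..
    next
      case False
      then have ga: "g \<in> a" using g A0a by blast
      have "br x g = - br g x" using xr ga rg ag by (intro g.br_anti) auto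
      then have "br x g = 0" using central[OF ga, of x] xr rar by auto
      then show ?thesis using False by (simp add: s_def)
    qed
    moreover have "s g g' = e * s g' g" for g g'
    proof (cases "g \<in> R \<and> g' \<in> R")
      case True
      then have eq: "s g g' = P (br x g) g'" "s g' g = P (br x g') g" by (simp_all add: s_def)
      show ?thesis unfolding eq by (rule inv[OF x]) (use True EV in auto)
    qed (auto simp: s_def)
    ultimately show "\<exists>s. (\<forall>g\<in>A0 \<union> R. br x g = (\<Sum>g'\<in>A0 \<union> R. s g g' *\<^sub>R g')) \<and>
          (\<forall>g\<in>A0 \<union> R. \<forall>g'\<in>A0 \<union> R. s g g' = e * s g' g)" by blast
  qed
  then show ?thesis by blast
qed

text \<open>
  \<open>ad X\<close> maps \<open>g\<close> into \<open>n\<close> and moves down the lower central series of \<open>n\<close>.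
\<close>

lemma trace_ad_nilpotent_ideal:
  assumes g: "metric_lie_algebra g br ip E" and n: "lie_ideal g br n" "lie_nilpotent n br" and X: "X \<in> n"
  shows "trace_on g (br X) = 0"
proof -
  interpret metric_lie_algebra g br ip E by fact
  have sn: "subspace n" and ng: "n \<subseteq> g" and ideal: "\<And>x y. x \<in> g \<Longrightarrow> y \<in> n \<Longrightarrow> br x y \<in> n"
    using n(1) by (auto simp: lie_ideal_def)
  have Xg: "X \<in> g" using X ng by blast
  interpret n: euclid n ip using euclid_axioms sn ng by (rule euclid_subspace)
  have Xn: "br X v \<in> n" if "v \<in> g" for v
    using br_anti[OF Xg that] ideal[OF that X] n.V_neg by simp
  have e: "endomorphism_on n (br X)"
    using endo_lin[OF ad_endo[OF Xg]] ng Xn by (simp add: endomorphism_on_iff lin_on_def subset_iff)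
  obtain m where m: "(bracket_space br n ^^ m) n = {0}" using n(2) by (auto simp: lie_nilpotent_def)
  have mono: "bracket_space br n U \<subseteq> bracket_space br n W" if "U \<subseteq> W" for U W
    unfolding bracket_space_def using that by (intro span_mono) blast
  have "trace_on g (br X) = trace_on n (br X)"
    by (rule trace_into_subspace[OF ad_endo[OF Xg] sn ng Xn])
  also have "\<dots> = 0"
  proof (rule n.trace_nilpotent[OF e, of "\<lambda>i. (bracket_space br n ^^ i) n" m])
    show "subspace ((bracket_space br n ^^ i) n)" for i
      by (cases i) (simp_all add: sn bracket_space_def)
    show "(bracket_space br n ^^ Suc i) n \<subseteq> (bracket_space br n ^^ i) n" for i
    proof (induction i)
      case 0
      have "{br u w | u w. u \<in> n \<and> w \<in> n} \<subseteq> n" using ideal ng by blast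
      then show ?case using sn by (simp add: bracket_space_def span_minimal)
    next
      case (Suc i)
      then show ?case using mono[OF Suc] by simp
    qed
    show "br X x \<in> (bracket_space br n ^^ Suc i) n" if "x \<in> (bracket_space br n ^^ i) n" for i x
      using that X by (auto simp: bracket_space_def intro!: span_base)
  qed (use m in simp_all)
  finally show ?thesis .
qed

section \<open>Negative Ricci curvature\<close>

text \<open>
  The line of \<open>A0\<close> is made orthogonal to the kernel of \<open>\<phi>\<close>, and the length of \<open>A0\<close> is then fixed by the
  value at \<open>s A0\<close>. With \<open>\<phi> A = tr (ad A)\<close> this prescribes the mean curvature vector.
\<close>

lemma inner_product_with_dual_vector:
  fixes \<phi> :: "'a::real_vector \<Rightarrow> real"
  assumes a: "findim a" and \<phi>: "lin_on a \<phi>" and A0: "A0 \<in> a" "\<phi> A0 > 0" and s: "s > 0"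
  obtains P where "euclid a P" "\<And>x. x \<in> a \<Longrightarrow> P (s *\<^sub>R A0) x = \<phi> x"
proof -
  obtain B where B: "finite B" "independent B" "span B = a" using a by (rule findim_basis)
  define Q where "Q = (\<lambda>x y. \<Sum>b\<in>B. representation B x b * representation B y b)"
  interpret Q: onb a Q B unfolding Q_def using B by (rule basis_inner_product)
  define \<delta> where "\<delta> x = x - (\<phi> x / \<phi> A0) *\<^sub>R A0" for x
  have \<delta>a: "\<delta> x \<in> a" if "x \<in> a" for x unfolding \<delta>_def using that A0(1) by (intro Q.V_diff Q.V_scale)
  have \<delta>lin: "\<delta> (x + y) = \<delta> x + \<delta> y" "\<delta> (c *\<^sub>R x) = c *\<^sub>R \<delta> x" if "x \<in> a" "y \<in> a" for x y c
    using that \<phi> by (simp_all add: \<delta>_def lin_on_def add_divide_distrib scaleR_add_left scaleR_diff_right)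
  define P where "P x y = \<phi> x * \<phi> y / (s * \<phi> A0) + Q (\<delta> x) (\<delta> y)" for x y
  have pos: "s * \<phi> A0 > 0" using s A0(2) by simp
  have "inner_product_on a P"
  proof
    fix x assume x: "x \<in> a" "x \<noteq> 0"
    show "P x x > 0"
    proof (cases "\<phi> x = 0")
      case True
      then have "\<delta> x = x" by (simp add: \<delta>_def)
      then show ?thesis using True Q.ip_pos[OF x] by (simp add: P_def)
    next
      case False
      have "\<phi> x * \<phi> x > 0" using False not_real_square_gt_zero by blast
      then have "\<phi> x * \<phi> x / (s * \<phi> A0) > 0" using pos by (rule divide_pos_pos)
      then show ?thesis using Q.ip_ge0[OF \<delta>a[OF x(1)]] by (simp add: P_def)
    qed
  next
    fix x y assume "x \<in> a" "y \<in> a"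
    then show "P x y = P y x" using Q.ip_commute[OF \<delta>a \<delta>a] by (simp add: P_def mult.commute)
  next
    fix x y z assume xyz: "x \<in> a" "y \<in> a" "z \<in> a"
    then show "P (x + y) z = P x z + P y z"
      by (simp add: P_def \<delta>lin Q.ip_add_left \<delta>a lin_on_add[OF \<phi>] distrib_right add_divide_distrib)
  next
    fix c x y assume xy: "x \<in> a" "y \<in> a"
    then show "P (c *\<^sub>R x) y = c * P x y"
      by (simp add: P_def \<delta>lin Q.ip_scale_left \<delta>a lin_on_scale[OF \<phi>] distrib_left)
  qed
  then have "euclid a P" using a by (simp add: euclid_def euclid_axioms_def)
  moreover have "P (s *\<^sub>R A0) x = \<phi> x" if x: "x \<in> a" for x
  proof -
    have "\<delta> A0 = 0" using A0(2) by (simp add: \<delta>_def)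
    then have "\<delta> (s *\<^sub>R A0) = 0" using \<delta>lin(2)[OF A0(1) A0(1), of s] by simp
    then show ?thesis
      using s A0(2) Q.ip_0_left[OF \<delta>a[OF x]] by (simp add: P_def lin_on_scale[OF \<phi> A0(1)])
  qed
  ultimately show ?thesis by (rule that)
qed

theorem theorem1p3:
  fixes g ar a r n :: "'a::real_vector set"
    and br :: "'a \<Rightarrow> 'a \<Rightarrow> 'a"
  assumes "lie_algebra g br"
    and "direct_sum g ar n" and "direct_sum ar a r"
    and "lie_subalgebra g br r" and "lie_semisimple r br" and "no_compact_factors r br"
    and "lie_ideal g br n" and "lie_nilpotent n br"
    and "\<forall>x\<in>a. \<forall>y\<in>ar. br x y = 0"
    and "\<exists>ip. inner_product_on n ip \<and> (\<forall>A\<in>a. normal_on n ip (br A))"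
    and "\<not> (\<exists>A\<in>a. A \<noteq> 0 \<and> (\<forall>c. complex_eigenvalue_on n (br A) c \<longrightarrow> Re c = 0))"
    and "\<exists>A0\<in>a. \<forall>c. complex_eigenvalue_on n (br A0) c \<longrightarrow> Re c > 0"
    and "\<exists>ip. inner_product_on r ip \<and> negative_ricci r br ip \<and>
           (\<exists>k p. cartan_decomposition r br k p \<and> (\<forall>x\<in>k. \<forall>y\<in>p. ip x y = 0))"
  shows "\<exists>ip. inner_product_on g ip \<and> negative_ricci g br ip"
proof -
  interpret g: lie_algebra g br by fact
  note dg = assms(2) and dar = assms(3)
  have sn: "subspace n" and sar: "subspace ar" and g_eq: "g = {u + w | u w. u \<in> ar \<and> w \<in> n}"
    using dg unfolding direct_sum_def by blast+
  have sa: "subspace a" and sr: "subspace r" and ar_eq: "ar = {u + w | u w. u \<in> a \<and> w \<in> r}"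
    using dar unfolding direct_sum_def by blast+
  have arg: "ar \<subseteq> g" unfolding g_eq using subspace_0[OF sn] by force
  have ng: "n \<subseteq> g" using assms(7) by (simp add: lie_ideal_def)
  have aar: "a \<subseteq> ar" unfolding ar_eq using subspace_0[OF sr] by force
  have rar: "r \<subseteq> ar" unfolding ar_eq using subspace_0[OF sa] by force
  have ag: "a \<subseteq> g" and rg: "r \<subseteq> g" using aar rar arg by auto
  have rcl: "br x y \<in> r" if "x \<in> r" "y \<in> r" for x y using assms(4) that by (simp add: lie_subalgebra_def)
  have ideal: "br x y \<in> n" if "x \<in> g" "y \<in> n" for x y using assms(7) that by (simp add: lie_ideal_def)
  have central: "br x y = 0" if "x \<in> a" "y \<in> ar" for x y using assms(9) that by blast
  obtain ipr k p where ipr: "inner_product_on r ipr" and negr: "negative_ricci r br ipr"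
    and cart: "cartan_decomposition r br k p" and kp: "\<And>x y. x \<in> k \<Longrightarrow> y \<in> p \<Longrightarrow> ipr x y = 0"
    using assms(13) by blast
  obtain \<theta> where \<theta>: "cartan_involution r br \<theta>" and k: "k = {x \<in> r. \<theta> x = x}" and p: "p = {x \<in> r. \<theta> x = - x}"
    using cart unfolding cartan_decomposition_def by blast
  show ?thesis
  proof (cases "n = {0}")
    case True
    have "A = 0" if A: "A \<in> a" for A
    proof (rule ccontr)
      assume "A \<noteq> 0"
      moreover have "\<not> complex_eigenvalue_on n (br A) c" for c
        using True by (auto simp: complex_eigenvalue_on_def zero_prod_def)
      ultimately show False using assms(11) A by blast
    qed
    then have "a = {0}" using subspace_0[OF sa] by auto
    then have "ar = r" unfolding ar_eq by auto
    then have "g = r" unfolding g_eq True by auto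
    then show ?thesis using ipr negr by blast
  next
    case False
    interpret rr: lie_algebra r br using g.subalgebra_lie[OF assms(4)] .
    obtain G where "reductive ar br a (cartan_parity r \<theta>) G"
      using cartan_reductive[OF assms(1) dar arg assms(4) central \<theta>] by blast
    then interpret red: reductive ar br a "cartan_parity r \<theta>" G .
    have mod: "lie_module ar br n br"
      unfolding lie_module_def
    proof (intro conjI ballI)
      show "endomorphism_on n (br x)" if "x \<in> ar" for x
        using endo_lin[OF g.ad_endo] that arg ng ideal by (auto simp: endomorphism_on_iff lin_on_def subset_iff)
      show "lin_on ar (\<lambda>x. br x v)" if "v \<in> n" for v
        using g.br_lin_left[of v] that arg ng by (simp add: lin_on_def subset_iff)
      show "br (br x y) v = br x (br y v) - br y (br x v)" if "x \<in> ar" "y \<in> ar" "v \<in> n" for x y v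
        using that arg ng by (intro g.ad_br) auto
    qed
    have fn: "findim n" using findim_sub[OF g.findim_L sn ng] .
    have fa: "findim a" using findim_sub[OF g.findim_L sa ag] .
    obtain ip0 where ip0: "inner_product_on n ip0" "\<And>A. A \<in> a \<Longrightarrow> normal_on n ip0 (br A)"
      using assms(10) by blast
    have "euclid n ip0" using ip0(1) fn by (simp add: euclid_def euclid_axioms_def)
    then obtain P where P: "red.adapted n br P" using red.module_adapted[OF _ mod ip0(2)] by blast
    interpret n: euclid n P using P fn by (simp add: red.adapted_def euclid_def euclid_axioms_def)
    have par: "P (br x u) v = e * P u (br x v)" if "cartan_parity r \<theta> x e" "u \<in> n" "v \<in> n" for x e u v
      using P that by (simp add: red.adapted_def)
    have nor: "normal_on n P (br A)" if "A \<in> a" for A using P that by (simp add: red.adapted_def)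
    have adn: "endomorphism_on n (br x)" if "x \<in> ar" for x using mod that by (simp add: lie_module_def)
    obtain En where "orthonormal_basis n P En" using n.onb_exists by blast
    then interpret n: onb n P En by unfold_locales

    obtain A0 where A0: "A0 \<in> a" "\<And>c. complex_eigenvalue_on n (br A0) c \<Longrightarrow> Re c > 0" using assms(12) by blast
    have A0ar: "A0 \<in> ar" using A0(1) aar by blast
    obtain \<mu> where \<mu>: "\<mu> > 0" "\<And>x. x \<in> n \<Longrightarrow> \<mu> * P x x \<le> P (br A0 x) x"
      using n.normal_coercive[OF adn[OF A0ar] nor[OF A0(1)] A0(2)] by blast
    define \<phi> where "\<phi> A = trace_on n (br A)" for A
    have \<phi>: "\<phi> A = (\<Sum>u\<in>En. P (br A u) u)" if "A \<in> a" for A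
      unfolding \<phi>_def using that aar by (intro n.trace_endo adn) auto
    have \<phi>lin: "lin_on a \<phi>"
    proof (rule lin_onI)
      fix x y assume xy: "x \<in> a" "y \<in> a"
      have "x + y \<in> a" using sa xy by (simp add: subspace_add)
      then show "\<phi> (x + y) = \<phi> x + \<phi> y"
        using xy ag ng n.EV ideal by (simp add: \<phi> g.br_add_left subset_iff n.ip_add_left sum.distrib)
    next
      fix c x assume x: "x \<in> a"
      have "c *\<^sub>R x \<in> a" using sa x by (simp add: subspace_scale)
      then show "\<phi> (c *\<^sub>R x) = c *\<^sub>R \<phi> x"
        using x ag ng n.EV ideal by (simp add: \<phi> g.br_scale_left subset_iff n.ip_scale_left sum_distrib_left)
    qed
    have "\<phi> A0 > 0"
    proof -
      have "En \<noteq> {}" using False n.spanE by auto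
      moreover have "P (br A0 u) u > 0" if "u \<in> En" for u
        using \<mu>(2)[OF n.EV[OF that]] \<mu>(1) n.ip_E[OF that that] by simp
      ultimately show ?thesis unfolding \<phi>[OF A0(1)] using n.finE by (intro sum_pos) auto
    qed
    \<comment> \<open>\<open>K\<close> bounds the only positive term of the Ricci form by Cauchy-Schwarz, and \<open>s\<close> makes \<open>s \<mu>\<close> exceed \<open>K\<close>.\<close>
    define K where "K = (1/4) * (\<Sum>u\<in>En. \<Sum>v\<in>En. P (br u v) (br u v))"
    have brE: "br u v \<in> n" if "u \<in> En" "v \<in> En" for u v
      using ideal n.EV[OF that(1)] n.EV[OF that(2)] ng by blast
    have K0: "K \<ge> 0"
      unfolding K_def by (intro mult_nonneg_nonneg sum_nonneg n.ip_ge0 brE) auto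
    have K: "(1/4) * (\<Sum>u\<in>En. \<Sum>v\<in>En. (P (br u v) x)\<^sup>2) \<le> K * P x x" if x: "x \<in> n" for x
    proof -
      have "(\<Sum>u\<in>En. \<Sum>v\<in>En. (P (br u v) x)\<^sup>2) \<le> (\<Sum>u\<in>En. \<Sum>v\<in>En. P (br u v) (br u v) * P x x)"
        using x by (intro sum_mono n.cauchy_schwarz brE)
      also have "\<dots> = (\<Sum>u\<in>En. \<Sum>v\<in>En. P (br u v) (br u v)) * P x x" by (simp only: sum_distrib_right)
      finally show ?thesis by (simp add: K_def)
    qed
    define s where "s = (K + 1) / \<mu>"
    have s: "s > 0" "s * \<mu> = K + 1" using K0 \<mu>(1) by (simp_all add: s_def)
    obtain ipa where ipa: "euclid a ipa" "\<And>x. x \<in> a \<Longrightarrow> ipa (s *\<^sub>R A0) x = \<phi> x"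
      using inner_product_with_dual_vector[OF fa \<phi>lin A0(1) \<open>\<phi> A0 > 0\<close> s(1)] by blast
    obtain Ea where Ea: "orthonormal_basis a ipa Ea" using euclid.onb_exists[OF ipa(1)] by blast
    have onba: "onb a ipa Ea" using ipa(1) Ea by (simp add: onb_def onb_axioms_def)

    have eur: "euclid r ipr" using ipr rr.findim_L by (simp add: euclid_def euclid_axioms_def)
    have \<theta>': "endomorphism_on r \<theta>" "\<And>x. x \<in> r \<Longrightarrow> \<theta> (\<theta> x) = x" using \<theta> by (auto simp: cartan_involution_def)
    obtain EK EP where EKP: "EK \<subseteq> k" "EP \<subseteq> p" "orthonormal_basis r ipr (EK \<union> EP)"
      using euclid.onb_orthogonal_union[OF eur cartan_eigenspaces(1)[OF \<theta>'(1) sr \<theta>'(2)] _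
        cartan_eigenspaces(2)[OF \<theta>'(1) sr \<theta>'(2)] _ cartan_eigenspaces(3)[OF \<theta>'(1) sr \<theta>'(2)], folded k p] kp k p by blast
    define Er where "Er = EK \<union> EP"
    have onbr: "onb r ipr Er" using eur EKP(3) by (simp add: onb_def onb_axioms_def Er_def)
    have Er_par: "\<exists>e. cartan_parity r \<theta> u e" if "u \<in> Er" for u
      using that EKP(1,2) by (auto simp: Er_def cartan_parity_def k p)

    obtain ip1 where ip1: "onb ar ip1 (Ea \<union> Er)" "Ea \<inter> Er = {}"
      "\<And>x y. x \<in> a \<Longrightarrow> y \<in> a \<Longrightarrow> ip1 x y = ipa x y" "\<And>x y. x \<in> r \<Longrightarrow> y \<in> r \<Longrightarrow> ip1 x y = ipr x y"
      "\<And>x y. x \<in> a \<Longrightarrow> y \<in> r \<Longrightarrow> ip1 x y = 0"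
      using orthogonal_sum[OF dar onba onbr] by metis
    obtain ip where ip: "onb g ip ((Ea \<union> Er) \<union> En)" "(Ea \<union> Er) \<inter> En = {}"
      "\<And>x y. x \<in> ar \<Longrightarrow> y \<in> ar \<Longrightarrow> ip x y = ip1 x y" "\<And>x y. x \<in> n \<Longrightarrow> y \<in> n \<Longrightarrow> ip x y = P x y"
      "\<And>x y. x \<in> ar \<Longrightarrow> y \<in> n \<Longrightarrow> ip x y = 0"
      using orthogonal_sum[OF dg ip1(1) n.onb_axioms] by metis
    have aar': "x \<in> ar" if "x \<in> a" for x using that aar by blast
    have rar': "x \<in> ar" if "x \<in> r" for x using that rar by blast
    have ipa': "ip x y = ipa x y" if "x \<in> a" "y \<in> a" for x y
      by (simp add: ip(3) ip1(3) that aar')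
    have ipr': "ip x y = ipr x y" if "x \<in> r" "y \<in> r" for x y
      by (simp add: ip(3) ip1(4) that rar')
    have ipar: "ip x y = 0" if "x \<in> a" "y \<in> r" for x y
      by (simp add: ip(3) ip1(5) that aar' rar')
    have ipan: "ip x y = 0" if "x \<in> a" "y \<in> n" for x y
      by (simp add: ip(5) that aar')
    have iprn: "ip x y = 0" if "x \<in> r" "y \<in> n" for x y
      by (simp add: ip(5) that rar')
    interpret M: metric_lie_algebra g br ip "(Ea \<union> Er) \<union> En"
      using assms(1) ip(1) by (simp add: metric_lie_algebra_def)
    have onba': "onb a ip Ea" using onb_cong[OF onba ipa'] .
    have onbr': "onb r ip Er" using onb_cong[OF onbr ipr'] .
    have onbn': "onb n ip En" using onb_cong[OF n.onb_axioms ip(4)] .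
    interpret r: metric_lie_algebra r br ipr Er
      using rr.lie_algebra_axioms onbr by (simp add: metric_lie_algebra_def)

    have derived: "x \<in> span {br y z | y z. y \<in> r \<and> z \<in> r}" if "x \<in> r" for x
      using cartan_derived[OF rr.lie_algebra_axioms \<theta> that] .
    define H where "H = s *\<^sub>R A0"
    have Ha: "H \<in> a" unfolding H_def using sa A0(1) by (rule subspace_scale)
    have H: "mean_curvature_vector g br ip = H"
    proof (rule M.mean_curvature_vector_eqI)
      show "H \<in> g" using Ha ag by blast
      fix x assume "x \<in> g"
      then obtain A Y X where x: "x = A + Y + X" and A: "A \<in> a" and Y: "Y \<in> r" and X: "X \<in> n"
        unfolding g_eq ar_eq by blast
      have V: "A \<in> g" "Y \<in> g" "X \<in> g" "H \<in> g" using A Y X Ha ag rg ng by auto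
      have "trace_on g (br x) = trace_on g (br A) + trace_on g (br Y) + trace_on g (br X)"
        unfolding x using V by (simp add: lin_on_add[OF M.trace_ad_lin] M.V_add)
      also have "trace_on g (br X) = 0"
        by (rule trace_ad_nilpotent_ideal[OF M.metric_lie_algebra_axioms assms(7,8) X])
      also have "trace_on g (br Y) = 0" by (rule M.trace_ad_derived[OF derived[OF Y] rg])
      also have "trace_on g (br A) = \<phi> A"
        unfolding \<phi>_def
      proof (rule M.trace_into_subspace[OF g.ad_endo[OF V(1)] sn ng])
        fix v assume "v \<in> g"
        then obtain w z where v: "v = w + z" "w \<in> ar" "z \<in> n" unfolding g_eq by blast
        have "br A v = br A z" unfolding v(1)
          using g.br_add_right[of A w z] central[OF A v(2)] v arg ng V(1) by auto
        then show "br A v \<in> n" using ideal[OF V(1) v(3)] by simp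
      qed
      also have "\<phi> A = ip H A" using ipa(2)[OF A] ipa'[OF Ha A] by (simp add: H_def)
      also have "\<dots> = ip H x"
        unfolding x using V ipar[OF Ha Y] ipan[OF Ha X] by (simp add: M.ip_add_right M.V_add)
      finally show "ip H x = trace_on g (br x)" by simp
    qed
    \<comment> \<open>Every basis vector of \<open>a\<close> acts by a normal operator, every one of \<open>r\<close> by a skew or symmetric operator.\<close>
    have normal: "(\<Sum>v\<in>En. (ip (br u v) x)\<^sup>2) = ip (br u x) (br u x)" if u: "u \<in> Ea \<union> Er" and x: "x \<in> n" for u x
    proof -
      have uar: "u \<in> ar" using u onb.EV[OF onba] onb.EV[OF onbr] aar rar by blast
      have ux: "br u x \<in> n" using ideal uar arg x by blast
      have "(\<Sum>v\<in>En. (ip (br u v) x)\<^sup>2) = (\<Sum>v\<in>En. (P (br u v) x)\<^sup>2)"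
        using ideal uar arg n.EV x by (intro sum.cong refl) (auto simp: ip(4))
      also have "\<dots> = P (br u x) (br u x)"
      proof (cases "u \<in> Ea")
        case True
        then have ua: "u \<in> a" by (rule onb.EV[OF onba])
        have "(\<Sum>v\<in>En. (P (br u v) x)\<^sup>2) = (\<Sum>v\<in>En. P (n.adj (br u) x) v * P (n.adj (br u) x) v)"
        proof (rule sum.cong[OF refl])
          fix v assume "v \<in> En"
          then have v: "v \<in> n" by (rule n.EV)
          have "P (br u v) x = P (n.adj (br u) x) v"
            using n.adj_left[OF adn[OF uar] x v] n.ip_commute[OF x endo_in[OF adn[OF uar] v]] by simp
          then show "(P (br u v) x)\<^sup>2 = P (n.adj (br u) x) v * P (n.adj (br u) x) v" by (simp add: power2_eq_square)
        qed
        also have "\<dots> = P (n.adj (br u) x) (n.adj (br u) x)"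
          by (rule n.parseval[symmetric]) (rule n.adj_in[OF adn[OF uar] x])+
        also have "\<dots> = P (br u x) (br u x)" by (rule n.normal_norm_adj[OF adn[OF uar] nor[OF ua] x])
        finally show ?thesis .
      next
        case False
        then obtain e where e: "cartan_parity r \<theta> u e" using Er_par u by blast
        have ee: "e * e = 1" using e by (rule red.parity_sq)
        have "(\<Sum>v\<in>En. (P (br u v) x)\<^sup>2) = (\<Sum>v\<in>En. P (br u x) v * P (br u x) v)"
        proof (rule sum.cong[OF refl])
          fix v assume "v \<in> En"
          then have v: "v \<in> n" by (rule n.EV)
          have "P (br u v) x = e * P (br u x) v" using par[OF e v x] n.ip_commute[OF v ux] by simp
          then have "(P (br u v) x)\<^sup>2 = (e * e) * (P (br u x) v * P (br u x) v)"
            by (simp add: power2_eq_square mult_ac)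
          then show "(P (br u v) x)\<^sup>2 = P (br u x) v * P (br u x) v" using ee by simp
        qed
        also have "\<dots> = P (br u x) (br u x)" by (rule n.parseval[symmetric]) (rule ux)+
        finally show ?thesis .
      qed
      finally show ?thesis using ip(4)[OF ux ux] by simp
    qed

    define Rr where "Rr Y = - (1/2) * (\<Sum>u\<in>Er. \<Sum>v\<in>Er. (ip (br Y u) v)\<^sup>2)
        + (1/4) * (\<Sum>u\<in>Er. \<Sum>v\<in>Er. (ip (br u v) Y)\<^sup>2) - (1/2) * trace_on r (\<lambda>z. br Y (br Y z))" for Y
    have Rr: "Rr Y = ipr (ricci_operator r br ipr Y) Y" if Y: "Y \<in> r" for Y
    proof -
      have H0: "mean_curvature_vector r br ipr = 0"
        using r.trace_ad_derived[OF derived] r.ip_0_left r.V_0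
        by (intro r.mean_curvature_vector_eqI) auto
      have "br 0 Y = 0" using lin_on_zero[OF rr.br_lin_left[OF Y] r.sub] .
      then have "ipr (br 0 Y) Y = 0" using r.ip_0_left[OF Y] by simp
      then show ?thesis unfolding Rr_def r.ricci_form[OF Y r.V_0 H0]
        using rcl r.EV Y by (simp add: ipr')
    qed
    have Rr_neg: "Rr Y < 0" if "Y \<in> r" "Y \<noteq> 0" for Y
      using negr that unfolding Rr[OF that(1)] negative_ricci_def by blast
    have Rr_0: "Rr 0 = 0"
    proof -
      have b0: "br 0 z = 0" if "z \<in> r" for z using lin_on_zero[OF rr.br_lin_left[OF that] r.sub] .
      have "trace_on r (\<lambda>z. br 0 (br 0 z)) = 0"
        unfolding r.trace_endo[OF r.ad_square_endo[OF r.V_0 r.V_0]]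
        using r.EV r.V_0 by (intro sum.neutral ballI) (simp add: b0 r.ip_0_left)
      moreover have "ip (br u v) 0 = 0" if "u \<in> Er" "v \<in> Er" for u v
        using M.ip_0_right[of "br u v"] rcl[OF r.EV r.EV, OF that] rg by blast
      ultimately show ?thesis
        unfolding Rr_def using r.EV rg by (simp add: b0 M.ip_0_left subset_iff)
    qed
    have neg: "ip (ricci_operator g br ip Z) Z < 0" if Z: "Z \<in> g" "Z \<noteq> 0" for Z
    proof -
      obtain A Y X where ZAYX: "Z = A + Y + X" and A: "A \<in> a" and Y: "Y \<in> r" and X: "X \<in> n"
        using Z(1) unfolding g_eq ar_eq by blast
      define D where "D = (\<Sum>u\<in>En. \<Sum>v\<in>En. (ip (br Z u) v + ip (br Z v) u)\<^sup>2)"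
      have D0: "D \<ge> 0" unfolding D_def by (intro sum_nonneg) simp
      have XX: "(\<Sum>u\<in>En. \<Sum>v\<in>En. (ip (br u v) X)\<^sup>2) = (\<Sum>u\<in>En. \<Sum>v\<in>En. (P (br u v) X)\<^sup>2)"
        using X by (intro sum.cong refl) (simp add: ip(4) brE)
      have HX: "ip (br H X) X = s * P (br A0 X) X"
      proof -
        have V: "A0 \<in> g" "X \<in> g" using A0(1) ag X ng by auto
        have "br H X = s *\<^sub>R br A0 X" unfolding H_def by (rule g.br_scale_left[OF V])
        then show ?thesis using ip(4)[of "br H X" X] ideal[OF V(1) X] X n.V_scale by (simp add: n.ip_scale_left)
      qed
      have form: "ip (ricci_operator g br ip Z) Z
          = Rr Y - (1/4) * D + (1/4) * (\<Sum>u\<in>En. \<Sum>v\<in>En. (P (br u v) X)\<^sup>2) - s * P (br A0 X) X"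
        unfolding Rr_def D_def XX[symmetric] HX[symmetric]
        by (rule semidirect_ricci_form[OF M.metric_lie_algebra_axioms ip1(2) ip(2) onba' ag onbr' rg onbn' ng
              ipar ipan iprn rcl ideal _ normal Ha H A Y X ZAYX])
          (use central aar rar in auto)
      have RY: "Rr Y \<le> 0" using Rr_neg[OF Y] Rr_0 by (cases "Y = 0") auto
      have XP: "(1/4) * (\<Sum>u\<in>En. \<Sum>v\<in>En. (P (br u v) X)\<^sup>2) - s * P (br A0 X) X \<le> - P X X"
      proof -
        have "s * (\<mu> * P X X) \<le> s * P (br A0 X) X" using \<mu>(2)[OF X] s(1) by (intro mult_left_mono) auto
        moreover have "s * (\<mu> * P X X) = (K + 1) * P X X" using s(2) by (simp flip: mult.assoc)
        ultimately show ?thesis using K[OF X] by (simp add: distrib_right)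
      qed
      show ?thesis
      proof (cases "X = 0")
        case X0: False
        then show ?thesis using form RY D0 XP n.ip_pos[OF X X0] by linarith
      next
        case X0: True
        have XP': "(1/4) * (\<Sum>u\<in>En. \<Sum>v\<in>En. (P (br u v) X)\<^sup>2) - s * P (br A0 X) X \<le> 0"
          using XP X0 n.ip_0_left[OF n.V_0] by simp
        show ?thesis
        proof (cases "Y = 0")
          case Y0: False
          then show ?thesis using form D0 XP' Rr_neg[OF Y Y0] by linarith
        next
          case Y0: True
          have ZA: "Z = A" using ZAYX X0 Y0 by simp
          have Aar: "A \<in> ar" using A aar by blast
          \<comment> \<open>Otherwise \<open>ad A\<close> would be skew on \<open>n\<close>, and all its eigenvalues purely imaginary.\<close>
          have "D \<noteq> 0"
          proof
            assume "D = 0"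
            then have "\<forall>u\<in>En. (\<Sum>v\<in>En. (ip (br Z u) v + ip (br Z v) u)\<^sup>2) = 0"
              unfolding D_def using n.finE by (subst (asm) sum_nonneg_eq_0_iff) (auto intro: sum_nonneg)
            then have "(ip (br Z u) v + ip (br Z v) u)\<^sup>2 = 0" if "u \<in> En" "v \<in> En" for u v
              using that n.finE by (subst (asm) sum_nonneg_eq_0_iff) auto
            then have z: "P (br A u) v + P (br A v) u = 0" if "u \<in> En" "v \<in> En" for u v
              using that ip(4)[OF endo_in[OF adn[OF Aar] n.EV] n.EV] by (simp add: ZA)
            have lin: "lin_on n (\<lambda>x. P (br A x) y + P (br A y) x)" if "y \<in> n" for y
              using adn[OF Aar] that by (intro lin_onI)
                (simp_all add: endomorphism_on_def n.ip_add_left n.ip_add_right n.ip_scale_left n.ip_scale_right distrib_left)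
            have z1: "P (br A x) v + P (br A v) x = 0" if "x \<in> n" "v \<in> En" for x v
              using n.lin_expand[OF lin[OF n.EV[OF that(2)]] that(1)] z that(2) by simp
            have z2: "P (br A x) y + P (br A y) x = 0" if "x \<in> n" "y \<in> n" for x y
              using n.lin_expand[OF lin[OF that(1)] that(2)] z1[OF that(1)] by (simp add: add.commute)
            have "Re c = 0" if "complex_eigenvalue_on n (br A) c" for c
            proof (rule n.skew_imaginary[OF _ _ adn[OF Aar] that])
              show "P (br A x) x = 0" if "x \<in> n" for x using z2[OF that that] by simp
              show "P (br A x) y = - P x (br A y)" if "x \<in> n" "y \<in> n" for x y
                using z2[OF that] n.ip_commute[OF that(1) endo_in[OF adn[OF Aar] that(2)]] by simp
            qed
            then show False using assms(11) A Z(2) ZA by blast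
          qed
          then show ?thesis using form D0 XP' RY by linarith
        qed
      qed
    qed
    then have "negative_ricci g br ip" unfolding negative_ricci_def by blast
    then show ?thesis using M.inner_product_on_axioms by blast
  qed
qed

end
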